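(* Let $w\in\mathfrak S_n$ and suppose that the modified Kazhdan-Lusztig basis element $\widetilde C_w(q)$ of $H_n(q)$ satisfies $$g(q)\,\widetilde C_w(q)=\widetilde C_{s_{J_1}}(q)\cdots\widetilde C_{s_{J_m}}(q)$$ for some polynomial $g(q)$ and some sequence $J_1,\dotsc,J_m$ of subintervals of $[n]$. Let $G=G_{J_1}\circ\cdots\circ G_{J_m}$ be the corresponding star network. Then for every partition $\lambda\vdash n$, $$\epsilon_q^\lambda(\widetilde C_w(q))=\frac1{g(q)}\sum_U q^{\mathrm{invnc}(U)+\mathrm{cr}(U)/2},$$ where the sum is over all column-strict $G$-tableaux $U$ of type $e$ and shape $\lambda^\top$ (the conjugate of $\lambda$).
   Context: Hecke algebra. $H_n(q)$ is the algebra over $\mathbb Z[q^{1/2},q^{-1/2}]$ with unit $T_e$ generated by $T_{s_1},\dotsc,T_{s_{n-1}}$ ($s_i$ the adjacent transpositions in the symmetric group $\mathfrak S_n$) with relations $T_{s_i}^2=(q-1)T_{s_i}+qT_e$, $T_{s_i}T_{s_j}T_{s_i}=T_{s_j}T_{s_i}T_{s_j}$ if $|i-j|=1$, $T_{s_i}T_{s_j}=T_{s_j}T_{s_i}$ if $|i-j|\ge 2$; it has natural basis $\{T_w\mid w\in\mathfrak S_n\}$. The (modified, signless) Kazhdan-Lusztig basis is $\widetilde C_w(q)=q^{\ell(w)/2}C'_w(q)=\sum_{v\le w}P_{v,w}(q)T_v$, where $P_{v,w}(q)$ are the Kazhdan-Lusztig polynomials and $\le$ is the Bruhat order. For an interval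 $J=[a,b]\subseteq[n]$, $\mathfrak S_J=\langle s_a,\dotsc,s_{b-1}\rangle$, $s_J$ (a reversal) is its longest element, and $\widetilde C_{s_J}(q)=\sum_{v\in\mathfrak S_J}T_v$. Induced sign characters. For $\lambda=(\lambda_1,\dotsc,\lambda_r)\vdash n$, $H_\lambda(q)$ is the subalgebra generated by the $T_{s_i}$ with $i\in\{1,\dotsc,n-1\}\setminus\{\lambda_1,\lambda_1+\lambda_2,\dotsc,n-\lambda_r\}$; the sign character is $\mathrm{sgn}(T_{s_i})=-1$, and $\epsilon_q^\lambda$ is the character of $H_n(q)$ induced from $\mathrm{sgn}$ on $H_\lambda(q)$. Star networks. For $1\le a<b\le n$, $G_{[a,b]}$ is the planar directed graph with sources $1,\dotsc,n$ in a column on the left (bottom to top), sinks $1,\dotsc,n$ in a column on the right (bottom to top), one interior (central) vertex, an edge from source $i$ to sink $i$ for $i<a$ and $i>b$, and, for $a\le i\le b$, an edge from source $i$ to the interior vertex and an edge from the interior vertex to sink $i$. $G_{[a,a]}$ has just the edges from source $i$ to sink $i$. $G\circ H$ identifies sink $i$ of $G$ with source $i$ of $H$. Path families. A path family of type $w=w_1\cdots w_n\in\mathfrak S_n$ in $G$ is a sequence $\pi=(\pi_1,\dotsc,\pi_n)$ with $\pi_i$ a directed path from source $i$ to sink $w_i$. It covers $G$ if every edge of $G$ is contained in exactly one path, exactly once. If two distinct paths $\pi_i,\pi_j$ pass through the central vertex of $G_{J_p}$, the triple $(\pi_i,\pi_j,p)=(\pi_j,\pi_i,p)$ is a crossing if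 the path which enters that vertex below the other leaves it above the other, and a noncrossing otherwise. $\mathrm{cr}(\pi)$ is the number of crossings of $\pi$. Tableaux. A $G$-tableau is a $\pi$-tableau for some path family $\pi$ covering $G$: a filling of a (French) Young diagram of shape some $\mu\vdash n$ (rows of lengths $\mu_1\ge\mu_2\ge\cdots$ from bottom to top) by the paths $\pi_1,\dotsc,\pi_n$, each used exactly once; its type is the type of $\pi$, and for a $\pi$-tableau $U$ we put $\mathrm{cr}(U)=\mathrm{cr}(\pi)$. It is column-strict if, whenever $\pi_i$ lies below $\pi_j$ in the same column, the path $\pi_i$ lies entirely below the path $\pi_j$ in $G$ (so $i<j$ and the paths have no common vertex). A noncrossing $(\pi_i,\pi_j,p)$, with $\pi_i$ entering and leaving the central vertex of $G_{J_p}$ below $\pi_j$, is an inverted noncrossing of $U$ if $\pi_j$ appears in a strictly earlier (further left) column of $U$ than $\pi_i$. $\mathrm{invnc}(U)$ is the number of inverted noncrossings of $U$. *)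

theory Defs
  imports
    "HOL-Algebra.Algebra"
    "HOL-Algebra.Algebraic_Closure_Type"
    "HOL-Combinatorics.Permutations"
    "HOL-Computational_Algebra.Polynomial_Factorial"
    "HOL-Library.Poly_Mapping"
    "Graph_Theory.Graph_Theory"
begin

section \<open>The ground ring\<close>

text \<open>Laurent polynomials in the square root of \<open>q\<close> with integer coefficients; the exponent \<open>k\<close>
  stands for the monomial \<open>q\<^sup>k\<^sup>/\<^sup>2\<close>, so \<open>q\<close> itself is \<open>qh 2\<close>.\<close>

type_synonym laurent = "int \<Rightarrow>\<^sub>0 int"

abbreviation qh :: "int \<Rightarrow> laurent" where
  "qh k \<equiv> Poly_Mapping.single k 1"

abbreviation laurent_ring :: "laurent ring" where
  "laurent_ring \<equiv> ring_of_type_algebra"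

definition at_q :: "int poly \<Rightarrow> laurent" where
  "at_q p = poly (map_poly of_int p) (qh 2)"

text \<open>The ring involution exchanging \<open>q\<^sup>1\<^sup>/\<^sup>2\<close> and \<open>q\<^sup>-\<^sup>1\<^sup>/\<^sup>2\<close>.\<close>

definition bar :: "laurent \<Rightarrow> laurent" where
  "bar c = Poly_Mapping.map_key uminus c"


section \<open>The symmetric group\<close>

text \<open>Elements of the symmetric group on \<open>n\<close> letters are functions \<open>w\<close> with \<open>w permutes {1..n}\<close>;
  \<open>apply_adj_transps [i\<^sub>1, \<dots>, i\<^sub>k]\<close> is the product of the adjacent transpositions with these indices.\<close>

definition perm_length :: "nat \<Rightarrow> (nat \<Rightarrow> nat) \<Rightarrow> nat" where
  "perm_length n w =
     (LEAST k. \<exists>is. set is \<subseteq> {1..<n} \<and> apply_adj_transps is = w \<and> length is = k)"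

definition reduced_word :: "nat \<Rightarrow> (nat \<Rightarrow> nat) \<Rightarrow> nat list \<Rightarrow> bool" where
  "reduced_word n w is \<longleftrightarrow>
     set is \<subseteq> {1..<n} \<and> apply_adj_transps is = w \<and> length is = perm_length n w"

definition bruhat_step :: "nat \<Rightarrow> (nat \<Rightarrow> nat) \<Rightarrow> (nat \<Rightarrow> nat) \<Rightarrow> bool" where
  "bruhat_step n v w \<longleftrightarrow>
     (\<exists>i j. 1 \<le> i \<and> i < j \<and> j \<le> n \<and> w = v \<circ> Transposition.transpose i j) \<and>
     perm_length n v < perm_length n w"

definition bruhat_le :: "nat \<Rightarrow> (nat \<Rightarrow> nat) \<Rightarrow> (nat \<Rightarrow> nat) \<Rightarrow> bool" where
  "bruhat_le n = (bruhat_step n)\<^sup>*\<^sup>*"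

definition bruhat_below :: "nat \<Rightarrow> (nat \<Rightarrow> nat) \<Rightarrow> (nat \<Rightarrow> nat) set" where
  "bruhat_below n w = {v. v permutes {1..n} \<and> bruhat_le n v w}"

text \<open>The longest element of the parabolic subgroup belonging to the interval \<open>J = [a,b]\<close>.\<close>

definition reversal :: "nat \<times> nat \<Rightarrow> nat \<Rightarrow> nat" where
  "reversal J i = (if fst J \<le> i \<and> i \<le> snd J then fst J + snd J - i else i)"


section \<open>The Hecke algebra\<close>

text \<open>The free associative algebra on generators \<open>x\<^sub>i\<close> is the monoid algebra of the free monoid.
  A separate copy of the list type serves as the free monoid, since lists are not an instance of
  \<^class>\<open>monoid_add\<close>; concatenation is written additively to obtain the convolution product of
  \<^theory>\<open>HOL-Library.Poly_Mapping\<close>.\<close>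

datatype gen_word = Gen_Word (letters: "nat list")

instantiation gen_word :: monoid_add
begin

definition "0 = Gen_Word []"

definition "u + v = Gen_Word (letters u @ letters v)"

instance
  by standard (simp_all add: zero_gen_word_def plus_gen_word_def)

end

type_synonym free_elem = "gen_word \<Rightarrow>\<^sub>0 laurent"

definition gen :: "nat \<Rightarrow> free_elem" where
  "gen i = Poly_Mapping.single (Gen_Word [i]) 1"

definition scalar :: "laurent \<Rightarrow> free_elem" where
  "scalar c = Poly_Mapping.single 0 c"

definition free_alg :: "nat \<Rightarrow> free_elem ring" where
  "free_alg n = ring_of_type_algebra
     \<lparr>carrier := {f. \<forall>u\<in>Poly_Mapping.keys f. set (letters u) \<subseteq> {1..<n}}\<rparr>"

definition hecke_relators :: "nat \<Rightarrow> free_elem set" where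
  "hecke_relators n =
     {gen i * gen i - (scalar (qh 2 - 1) * gen i + scalar (qh 2)) | i. i \<in> {1..<n}}
   \<union> {gen i * gen j * gen i - gen j * gen i * gen j | i j.
        i \<in> {1..<n} \<and> j \<in> {1..<n} \<and> \<bar>int i - int j\<bar> = 1}
   \<union> {gen i * gen j - gen j * gen i | i j.
        i \<in> {1..<n} \<and> j \<in> {1..<n} \<and> \<bar>int i - int j\<bar> \<ge> 2}"

text \<open>\<^const>\<open>genideal\<close> is the generated two-sided ideal.\<close>

definition hecke_ideal :: "nat \<Rightarrow> free_elem set" where
  "hecke_ideal n = Idl\<^bsub>free_alg n\<^esub> (hecke_relators n)"

definition hecke_ring :: "nat \<Rightarrow> free_elem set ring" where
  "hecke_ring n = free_alg n Quot hecke_ideal n"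

definition hecke :: "nat \<Rightarrow> (laurent, free_elem set) module" where
  "hecke n = ring.extend (hecke_ring n)
     (module.fields (\<lambda>c S. (hecke_ideal n +>\<^bsub>free_alg n\<^esub> scalar c) \<otimes>\<^bsub>hecke_ring n\<^esub> S))"

definition T_gen :: "nat \<Rightarrow> nat \<Rightarrow> free_elem set" where
  "T_gen n i = hecke_ideal n +>\<^bsub>free_alg n\<^esub> gen i"

definition hecke_prod :: "nat \<Rightarrow> free_elem set list \<Rightarrow> free_elem set" where
  "hecke_prod n Ss = foldr (\<lambda>x y. x \<otimes>\<^bsub>hecke n\<^esub> y) Ss \<one>\<^bsub>hecke n\<^esub>"

text \<open>By Matsumoto's theorem the choice of the reduced word is irrelevant.\<close>

definition T_basis :: "nat \<Rightarrow> (nat \<Rightarrow> nat) \<Rightarrow> free_elem set" where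
  "T_basis n w = hecke_prod n (map (T_gen n) (SOME is. reduced_word n w is))"


section \<open>The Kazhdan--Lusztig basis\<close>

text \<open>The bar involution of the Hecke algebra sends \<open>\<Sum>\<^sub>v c\<^sub>v T\<^sub>v\<close> to
  \<open>\<Sum>\<^sub>v bar c\<^sub>v (T\<^sub>u)\<^sup>-\<^sup>1\<close> with \<open>u\<close> the inverse of \<open>v\<close>. The Kazhdan--Lusztig polynomials
  \<open>P\<^sub>v\<^sub>,\<^sub>w\<close>, for fixed \<open>w\<close>, are the unique family satisfying the degree bounds below for which
  \<open>C'\<^sub>w = q\<^sup>-\<^sup>\<ell>\<^sup>(\<^sup>w\<^sup>)\<^sup>/\<^sup>2 \<Sum>\<^sub>v P\<^sub>v\<^sub>,\<^sub>w(q) T\<^sub>v\<close> is fixed by that involution. The degree condition is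
  \<open>deg P\<^sub>v\<^sub>,\<^sub>w \<le> (\<ell>(w) - \<ell>(v) - 1) / 2\<close>.\<close>

definition is_kl_family ::
  "nat \<Rightarrow> (nat \<Rightarrow> nat) \<Rightarrow> ((nat \<Rightarrow> nat) \<Rightarrow> int poly) \<Rightarrow> bool" where
  "is_kl_family n w P \<longleftrightarrow>
     P w = 1 \<and>
     (\<forall>v. v \<notin> bruhat_below n w \<longrightarrow> P v = 0) \<and>
     (\<forall>v \<in> bruhat_below n w. v \<noteq> w \<longrightarrow>
        2 * Polynomial.degree (P v) + perm_length n v + 1 \<le> perm_length n w) \<and>
     (let c = (\<lambda>v. qh (- int (perm_length n w)) * at_q (P v)) in
       (\<Oplus>\<^bsub>hecke n\<^esub>v\<in>bruhat_below n w. c v \<odot>\<^bsub>hecke n\<^esub> T_basis n v) =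
       (\<Oplus>\<^bsub>hecke n\<^esub>v\<in>bruhat_below n w.
          bar (c v) \<odot>\<^bsub>hecke n\<^esub> m_inv (hecke n) (T_basis n (inv_into UNIV v))))"

definition kl_poly :: "nat \<Rightarrow> (nat \<Rightarrow> nat) \<Rightarrow> (nat \<Rightarrow> nat) \<Rightarrow> int poly" where
  "kl_poly n v w = (THE P. is_kl_family n w P) v"

definition kl_basis :: "nat \<Rightarrow> (nat \<Rightarrow> nat) \<Rightarrow> free_elem set" where
  "kl_basis n w =
     (\<Oplus>\<^bsub>hecke n\<^esub>v\<in>bruhat_below n w. at_q (kl_poly n v w) \<odot>\<^bsub>hecke n\<^esub> T_basis n v)"


section \<open>Traces on free modules\<close>

definition module_basis :: "('r, 'p) ring_scheme \<Rightarrow> ('r, 'a, 'm) module_scheme \<Rightarrow> 'a set \<Rightarrow> bool" where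
  "module_basis R M B \<longleftrightarrow> finite B \<and> B \<subseteq> carrier M \<and>
     (\<forall>x\<in>carrier M. \<exists>!c. c \<in> B \<rightarrow>\<^sub>E carrier R \<and> x = (\<Oplus>\<^bsub>M\<^esub>b\<in>B. c b \<odot>\<^bsub>M\<^esub> b))"

definition module_trace ::
  "('r, 'p) ring_scheme \<Rightarrow> ('r, 'a, 'm) module_scheme \<Rightarrow> ('a \<Rightarrow> 'a) \<Rightarrow> 'r" where
  "module_trace R M f = (THE t. \<exists>B A. module_basis R M B \<and>
     (\<forall>b\<in>B. (\<lambda>b'. A b' b) \<in> B \<rightarrow> carrier R \<and>
             f b = (\<Oplus>\<^bsub>M\<^esub>b'\<in>B. A b' b \<odot>\<^bsub>M\<^esub> b')) \<and>
     t = (\<Oplus>\<^bsub>R\<^esub>b\<in>B. A b b))"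


section \<open>Partitions and induced sign characters\<close>

text \<open>Partitions are weakly decreasing lists of positive parts.\<close>

definition is_partition :: "nat \<Rightarrow> nat list \<Rightarrow> bool" where
  "is_partition n lam \<longleftrightarrow> sorted_wrt (\<ge>) lam \<and> (\<forall>k\<in>set lam. k > 0) \<and> sum_list lam = n"

definition conjugate :: "nat list \<Rightarrow> nat list" where
  "conjugate lam =
     map (\<lambda>j. length (filter (\<lambda>k. j < k) lam)) [0..<(if lam = [] then 0 else hd lam)]"

definition parabolic_indices :: "nat \<Rightarrow> nat list \<Rightarrow> nat set" where
  "parabolic_indices n lam = {1..<n} - {sum_list (take k lam) | k. k \<le> length lam}"

definition parabolic_subalgebra :: "nat \<Rightarrow> nat list \<Rightarrow> free_elem set set" where
  "parabolic_subalgebra n lam = generate_ring (hecke n)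
     (T_gen n ` parabolic_indices n lam \<union> range (\<lambda>c. c \<odot>\<^bsub>hecke n\<^esub> \<one>\<^bsub>hecke n\<^esub>))"

definition sgn_char :: "nat \<Rightarrow> nat list \<Rightarrow> free_elem set \<Rightarrow> laurent" where
  "sgn_char n lam = (THE \<chi>.
     \<chi> \<in> ring_hom ((hecke n)\<lparr>carrier := parabolic_subalgebra n lam\<rparr>) laurent_ring \<and>
     \<chi> \<in> extensional (parabolic_subalgebra n lam) \<and>
     (\<forall>c. \<chi> (c \<odot>\<^bsub>hecke n\<^esub> \<one>\<^bsub>hecke n\<^esub>) = c) \<and>
     (\<forall>i\<in>parabolic_indices n lam. \<chi> (T_gen n i) = -1))"

text \<open>The induced module is the tensor product of the Hecke algebra \<open>H\<close> with the one-dimensional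
  sign module over the parabolic subalgebra \<open>A\<close>. As the latter has rank one over the ground ring,
  this is the quotient of \<open>H\<close> by the balancing relations
  \<open>h a \<otimes> 1 = h \<otimes> sgn(a)\<close>. These differences are closed under the ground ring (put \<open>c h\<close> for \<open>h\<close>), so
  their additive span is a submodule.\<close>

definition induced_relations :: "nat \<Rightarrow> nat list \<Rightarrow> free_elem set set" where
  "induced_relations n lam = generate (add_monoid (hecke n))
     {(h \<otimes>\<^bsub>hecke n\<^esub> a) \<ominus>\<^bsub>hecke n\<^esub> (sgn_char n lam a \<odot>\<^bsub>hecke n\<^esub> h) | h a.
        h \<in> carrier (hecke n) \<and> a \<in> parabolic_subalgebra n lam}"

text \<open>The multiplicative fields of the record \<^type>\<open>module_ext\<close> play no role for a module.\<close>

definition induced_module :: "nat \<Rightarrow> nat list \<Rightarrow> (laurent, free_elem set set) module" where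
  "induced_module n lam =
     \<lparr>carrier = a_rcosets\<^bsub>hecke n\<^esub> (induced_relations n lam),
      monoid.mult = undefined, one = undefined,
      ring.zero = induced_relations n lam,
      ring.add = set_add (hecke n),
      module.smult = (\<lambda>c S. \<Union>x\<in>S. induced_relations n lam +>\<^bsub>hecke n\<^esub> (c \<odot>\<^bsub>hecke n\<^esub> x))\<rparr>"

definition induced_action ::
  "nat \<Rightarrow> nat list \<Rightarrow> free_elem set \<Rightarrow> free_elem set set \<Rightarrow> free_elem set set" where
  "induced_action n lam h S =
     (\<Union>x\<in>S. induced_relations n lam +>\<^bsub>hecke n\<^esub> (h \<otimes>\<^bsub>hecke n\<^esub> x))"

definition induced_sgn :: "nat \<Rightarrow> nat list \<Rightarrow> free_elem set \<Rightarrow> laurent" where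
  "induced_sgn n lam h =
     module_trace laurent_ring (induced_module n lam) (induced_action n lam h)"


section \<open>Star networks\<close>

text \<open>In the composition of the networks for \<open>J\<^sub>0, \<dots>, J\<^sub>m\<^sub>-\<^sub>1\<close>, the vertex \<open>Col p i\<close> is source \<open>i\<close> of
  the \<open>p\<close>-th factor (counted from 0), identified with sink \<open>i\<close> of the preceding one; \<open>Centre p\<close> is the
  interior vertex of the \<open>p\<close>-th factor, which is absent if that interval is a single point.
  The composition of zero factors has \<open>n\<close> vertices, each a source and a sink, and no edges.\<close>

datatype vertex = Col nat nat | Centre nat

fun star_verts :: "nat \<Rightarrow> nat \<Rightarrow> nat \<times> nat \<Rightarrow> vertex set" where
  "star_verts n p (a, b) =
     {Col p i | i. i \<in> {1..n}} \<union> {Col (Suc p) i | i. i \<in> {1..n}} \<union>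
     (if a < b then {Centre p} else {})"

fun star_arcs :: "nat \<Rightarrow> nat \<Rightarrow> nat \<times> nat \<Rightarrow> (vertex \<times> vertex) set" where
  "star_arcs n p (a, b) =
     (if a < b then
        {(Col p i, Col (Suc p) i) | i. i \<in> {1..n} - {a..b}} \<union>
        {(Col p i, Centre p) | i. i \<in> {a..b}} \<union>
        {(Centre p, Col (Suc p) i) | i. i \<in> {a..b}}
      else {(Col p i, Col (Suc p) i) | i. i \<in> {1..n}})"

definition star_network :: "nat \<Rightarrow> (nat \<times> nat) list \<Rightarrow> vertex pair_pre_digraph" where
  "star_network n Js =
     \<lparr>pverts = {Col 0 i | i. i \<in> {1..n}} \<union> (\<Union>p<length Js. star_verts n p (Js ! p)),
      parcs = (\<Union>p<length Js. star_arcs n p (Js ! p))\<rparr>"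


section \<open>Path families and tableaux\<close>

text \<open>Paths are lists of vertices; the family \<open>(\<pi>\<^sub>1, \<dots>, \<pi>\<^sub>n)\<close> is a list, with \<open>\<pi>\<^sub>i\<close> at position
  \<open>i - 1\<close>.\<close>

definition path_family ::
  "nat \<Rightarrow> (nat \<times> nat) list \<Rightarrow> (nat \<Rightarrow> nat) \<Rightarrow> vertex list list \<Rightarrow> bool" where
  "path_family n Js w ps \<longleftrightarrow> length ps = n \<and>
     (\<forall>i\<in>{1..n}. vpath (ps ! (i - 1)) (with_proj (star_network n Js)) \<and>
        hd (ps ! (i - 1)) = Col 0 i \<and> last (ps ! (i - 1)) = Col (length Js) (w i))"

definition covers :: "nat \<Rightarrow> (nat \<times> nat) list \<Rightarrow> vertex list list \<Rightarrow> bool" where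
  "covers n Js ps \<longleftrightarrow>
     (\<forall>e\<in>parcs (star_network n Js). count_list (concat (map vwalk_arcs ps)) e = 1)"

definition enters_below :: "nat \<Rightarrow> vertex list \<Rightarrow> vertex list \<Rightarrow> bool" where
  "enters_below p P Q \<longleftrightarrow> (\<exists>i j. Col p i \<in> set P \<and> Col p j \<in> set Q \<and> i < j)"

definition leaves_below :: "nat \<Rightarrow> vertex list \<Rightarrow> vertex list \<Rightarrow> bool" where
  "leaves_below p P Q \<longleftrightarrow> (\<exists>i j. Col (Suc p) i \<in> set P \<and> Col (Suc p) j \<in> set Q \<and> i < j)"

text \<open>Crossings and noncrossings are unordered in the two paths; each is recorded once, with the path
  entering from below in the first component.\<close>

definition crossing :: "vertex list \<Rightarrow> vertex list \<Rightarrow> nat \<Rightarrow> bool" where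
  "crossing P Q p \<longleftrightarrow> P \<noteq> Q \<and> Centre p \<in> set P \<and> Centre p \<in> set Q \<and>
     enters_below p P Q \<and> leaves_below p Q P"

definition noncrossing :: "vertex list \<Rightarrow> vertex list \<Rightarrow> nat \<Rightarrow> bool" where
  "noncrossing P Q p \<longleftrightarrow> P \<noteq> Q \<and> Centre p \<in> set P \<and> Centre p \<in> set Q \<and>
     enters_below p P Q \<and> leaves_below p P Q"

definition cr :: "vertex list list \<Rightarrow> nat" where
  "cr ps = card {(P, Q, p). P \<in> set ps \<and> Q \<in> set ps \<and> crossing P Q p}"

text \<open>A tableau is the list of its rows from bottom to top.\<close>

type_synonym tableau = "vertex list list list"

definition is_tableau_of :: "vertex list list \<Rightarrow> nat list \<Rightarrow> tableau \<Rightarrow> bool" where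
  "is_tableau_of ps mu U \<longleftrightarrow> map length U = mu \<and> mset (concat U) = mset ps"

definition G_tableau ::
  "nat \<Rightarrow> (nat \<times> nat) list \<Rightarrow> (nat \<Rightarrow> nat) \<Rightarrow> nat list \<Rightarrow> tableau \<Rightarrow> bool" where
  "G_tableau n Js w mu U \<longleftrightarrow> is_partition n mu \<and>
     (\<exists>ps. path_family n Js w ps \<and> covers n Js ps \<and> is_tableau_of ps mu U)"

definition cr_tableau :: "tableau \<Rightarrow> nat" where
  "cr_tableau U = cr (concat U)"

definition entirely_below :: "vertex list \<Rightarrow> vertex list \<Rightarrow> bool" where
  "entirely_below P Q \<longleftrightarrow> set P \<inter> set Q = {} \<and>
     (\<forall>k i j. Col k i \<in> set P \<longrightarrow> Col k j \<in> set Q \<longrightarrow> i < j)"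

definition column_strict :: "tableau \<Rightarrow> bool" where
  "column_strict U \<longleftrightarrow>
     (\<forall>r s c. r < s \<and> s < length U \<and> c < length (U ! r) \<and> c < length (U ! s) \<longrightarrow>
        entirely_below (U ! r ! c) (U ! s ! c))"

definition in_column :: "tableau \<Rightarrow> vertex list \<Rightarrow> nat \<Rightarrow> bool" where
  "in_column U P c \<longleftrightarrow> (\<exists>row\<in>set U. c < length row \<and> row ! c = P)"

definition invnc :: "tableau \<Rightarrow> nat" where
  "invnc U = card {(P, Q, p). P \<in> set (concat U) \<and> Q \<in> set (concat U) \<and> noncrossing P Q p \<and>
     (\<exists>c d. in_column U Q c \<and> in_column U P d \<and> c < d)}"

end

(* A word c of content lam (the number of letters k among c 1, ..., c n is the k-th part of lam) is a
   colouring of n strands. The free module on such words carries a left Hecke action in which T_i swaps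
   positions i and i+1; in the symmetric normalisation, with q^(1/2) as off-diagonal entry, it is the
   module induced from the sign character. The element of the reversal of J acts by a very simple matrix:
   the entry (c, c') vanishes unless c' is obtained from c by permuting the positions in J and c has
   distinct letters there, and then it is q^((inv_J c + inv_J c')/2). Hence the trace of the product over
   J_1, ..., J_m is a sum over closed sequences of colourings. Strands of equal colour never meet, so such
   a sequence is the same thing as a column-strict tableau of type e, colours being columns. At the p-th
   vertex, inv_J c + inv_J c' counts every inverted noncrossing twice and every crossing once. *)

theory Submission
  imports Defs
begin

section \<open>Inversions of words\<close>

text \<open>The Kazhdan-Lusztig polynomials, the sign character and the trace are given by definite
  descriptions, so each has to be identified before anything can be computed. One action on
  functions of words, \<open>act\<close>, serves all three. Applied to \<open>delta id\<close> it
  reads off the coefficients at the T_w, which yields the uniqueness of Kazhdan-Lusztig families. At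
  a constant word it is the sign. Applied to the sorted word of content lam it separates the
  elements of the induced module, whose spanning set comes from reduced words. The matrix of a
  reversal element X is simple for two reasons. In the row of a word that increases on J, each T_v
  with v in the subgroup of J has a single nonzero entry. And T_i X = q X for every s_i in this
  subgroup: compared with the definition of T_i, this relates the rows of two words that differ by a
  swap in J, and it makes the row of a word with two equal neighbours in J vanish, since T_i is -1
  there. Division by g is legitimate because a constant sequence of words with distinct letters is
  always closed, so that the product of the reversal elements is not zero.\<close>

abbreviation pinv :: "(nat \<Rightarrow> nat) \<Rightarrow> nat \<Rightarrow> nat" where
  "pinv w \<equiv> inv_into UNIV w"

definition inversions :: "nat \<Rightarrow> nat \<Rightarrow> (nat \<Rightarrow> nat) \<Rightarrow> (nat \<times> nat) set" where
  "inversions a b c = {(i, j). a \<le> i \<and> i < j \<and> j \<le> b \<and> c j < c i}"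

definition ninv :: "nat \<Rightarrow> nat \<Rightarrow> (nat \<Rightarrow> nat) \<Rightarrow> nat" where
  "ninv a b c = card (inversions a b c)"

abbreviation adj :: "nat \<Rightarrow> nat \<Rightarrow> nat" where
  "adj i \<equiv> Transposition.transpose i (Suc i)"

lemma finite_inversions [simp]: "finite (inversions a b c)"
  by (rule finite_subset[of _ "{a..b} \<times> {a..b}"]) (auto simp: inversions_def)

lemma ninv_id [simp]: "ninv a b id = 0"
  "ninv a b (\<lambda>x. x) = 0"
  by (auto simp: ninv_def inversions_def card_eq_0_iff)

lemma comp_adj_adj [simp]: "c \<circ> adj i \<circ> adj i = c"
  by (simp add: comp_assoc)

lemma adj_permutes: "a \<le> i \<Longrightarrow> i < b \<Longrightarrow> adj i permutes {a..b}"
  by (rule permutes_swap_id) auto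

text \<open>Exchanging i and i+1 in every pair of positions matches the inversions of the two words;
  only the pair (i, i+1) itself is lost.\<close>

lemma ninv_descent:
  assumes "a \<le> i" "i < b" "c (Suc i) < c i"
  shows "ninv a b c = Suc (ninv a b (c \<circ> adj i))"
proof -
  let ?f = "\<lambda>(x, y). (adj i x, adj i y)"
  have "bij_betw ?f (inversions a b c - {(i, Suc i)}) (inversions a b (c \<circ> adj i))"
  proof (rule bij_betw_byWitness[where f' = ?f])
    show "?f ` (inversions a b c - {(i, Suc i)}) \<subseteq> inversions a b (c \<circ> adj i)"
    proof -
      have "(adj i x, adj i y) \<in> inversions a b (c \<circ> adj i)"
        if "(x, y) \<in> inversions a b c" "\<not> (x = i \<and> y = Suc i)" for x y
      proof -
        have "adj i x < adj i y"
          using that by (auto simp: inversions_def Transposition.transpose_def)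
        then show ?thesis
          using that assms by (auto simp: inversions_def Transposition.transpose_def)
      qed
      then show ?thesis by auto
    qed
    show "?f ` inversions a b (c \<circ> adj i) \<subseteq> inversions a b c - {(i, Suc i)}"
    proof -
      have "(adj i x, adj i y) \<in> inversions a b c - {(i, Suc i)}" if "(x, y) \<in> inversions a b (c \<circ> adj i)" for x y
      proof -
        have "\<not> (x = i \<and> y = Suc i)"
          using that assms by (auto simp: inversions_def)
        then have "adj i x < adj i y"
          using that by (auto simp: inversions_def Transposition.transpose_def)
        then show ?thesis
          using that assms by (auto simp: inversions_def Transposition.transpose_def)
      qed
      then show ?thesis by auto
    qed
  qed auto
  then have "card (inversions a b c - {(i, Suc i)}) = ninv a b (c \<circ> adj i)"
    unfolding ninv_def by (rule bij_betw_same_card)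
  moreover have "(i, Suc i) \<in> inversions a b c"
    using assms by (auto simp: inversions_def)
  ultimately show ?thesis
    unfolding ninv_def by (metis card_Suc_Diff1 finite_inversions)
qed

lemma ninv_ascent:
  assumes "a \<le> i" "i < b" "c i < c (Suc i)"
  shows "ninv a b (c \<circ> adj i) = Suc (ninv a b c)"
  using ninv_descent[of a i b "c \<circ> adj i"] assms by (simp add: comp_assoc)

lemma comp_adj_eq: "c (Suc i) = c i \<Longrightarrow> c \<circ> adj i = c"
  by (auto simp: fun_eq_iff Transposition.transpose_def)

lemma ninv_adj_le: "a \<le> i \<Longrightarrow> i < b \<Longrightarrow> ninv a b (c \<circ> adj i) \<le> Suc (ninv a b c)"
  by (metis comp_adj_eq le_Suc_eq linorder_less_linear ninv_ascent ninv_descent order_refl)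

lemma no_descent_mono:
  assumes "\<And>i. a \<le> i \<Longrightarrow> i < b \<Longrightarrow> c i \<le> c (Suc i)" and "a \<le> i" "i \<le> j" "j \<le> (b::nat)"
  shows "(c i :: nat) \<le> c j"
  using assms(3,4)
proof (induction j rule: dec_induct)
  case (step j)
  then show ?case
    using assms(1)[of j] assms(2) by simp
qed simp

lemma ninv_eq_0_no_descent:
  assumes "ninv a b c = 0" "a \<le> i" "i < b"
  shows "c i \<le> c (Suc i)"
proof (rule ccontr)
  assume "\<not> ?thesis"
  then have "(i, Suc i) \<in> inversions a b c"
    using assms by (auto simp: inversions_def)
  then show False
    using assms(1) unfolding ninv_def by (metis card_eq_0_iff empty_iff finite_inversions)
qed

lemma no_descent_ninv_0:
  assumes "\<And>i. a \<le> i \<Longrightarrow> i < b \<Longrightarrow> c i \<le> c (Suc i)"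
  shows "ninv a b c = 0"
proof -
  have "inversions a b c = {}"
    using no_descent_mono[of a b c] assms by (fastforce simp: inversions_def leD)
  then show ?thesis by (simp add: ninv_def)
qed

text \<open>Read on a..b, both words are sorted lists with the same multiset of letters; elsewhere u
  is the identity.\<close>

lemma no_descent_unique:
  fixes c :: "nat \<Rightarrow> nat"
  assumes mono: "\<And>i. a \<le> i \<Longrightarrow> i < b \<Longrightarrow> c i \<le> c (Suc i)"
    and mono': "\<And>i. a \<le> i \<Longrightarrow> i < b \<Longrightarrow> c (u i) \<le> c (u (Suc i))"
    and u: "u permutes {a..b}"
  shows "c \<circ> u = c"
proof
  fix x
  have s1: "sorted (map c [a..<Suc b])"
    using no_descent_mono[of a b c, OF mono]
    by (auto simp: sorted_iff_nth_mono nth_append simp del: upt_Suc)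
  have s2: "sorted (map (c \<circ> u) [a..<Suc b])"
    using no_descent_mono[of a b "c \<circ> u"] mono'
    by (auto simp: sorted_iff_nth_mono nth_append simp del: upt_Suc)
  have "mset (map c [a..<Suc b]) = image_mset c (mset_set {a..b})"
    by (metis mset_map mset_upt atLeastLessThanSuc_atLeastAtMost)
  also have "\<dots> = image_mset c (image_mset u (mset_set {a..b}))"
    by (simp add: permutes_image[OF u] image_mset_mset_set permutes_inj_on[OF u])
  also have "\<dots> = mset (map (c \<circ> u) [a..<Suc b])"
    by (metis mset_map mset_upt atLeastLessThanSuc_atLeastAtMost multiset.map_comp)
  finally have "map c [a..<Suc b] = map (c \<circ> u) [a..<Suc b]"
    using s1 s2 by (metis properties_for_sort)
  then show "(c \<circ> u) x = c x"
    using permutes_not_in[OF u, of x] by (cases "x \<in> {a..b}") (auto simp del: upt_Suc)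
qed

text \<open>Passing to the inverse exchanges positions and values, and a pair is inverted in both
  readings or in neither.\<close>

lemma ninv_inv:
  assumes "w permutes {a..b}"
  shows "ninv a b (pinv w) = ninv a b w"
proof -
  let ?f = "\<lambda>(x, y). (w y, w x)" and ?g = "\<lambda>(x, y). (pinv w y, pinv w x)"
  note [simp] = permutes_inverses[OF assms]
  have "w x \<in> {a..b} \<longleftrightarrow> x \<in> {a..b}" "pinv w x \<in> {a..b} \<longleftrightarrow> x \<in> {a..b}" for x
    using permutes_in_image[OF assms] permutes_in_image[OF permutes_inv[OF assms]] by blast+
  then have b: "x \<in> {a..b} \<Longrightarrow> a \<le> w x \<and> w x \<le> b" "x \<in> {a..b} \<Longrightarrow> a \<le> pinv w x \<and> pinv w x \<le> b" for x
    by auto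
  have "bij_betw ?f (inversions a b w) (inversions a b (pinv w))"
    by (rule bij_betw_byWitness[where f' = ?g]) (auto simp: inversions_def b)
  then show ?thesis
    unfolding ninv_def by (metis bij_betw_same_card)
qed

text \<open>A pair inside i..j stays an inversion, because the larger letter moves to the front and
  the smaller one to the back; any other pair is carried along by the transposition, which keeps its
  order. Read backwards: a Bruhat step down has to undo an inversion.\<close>

lemma ninv_transpose_le:
  assumes "a \<le> i" "i < j" "j \<le> b" "c i < c j"
  shows "ninv a b c \<le> ninv a b (c \<circ> Transposition.transpose i j)"
proof -
  let ?t = "Transposition.transpose i j"
  let ?f = "\<lambda>(x, y). if i \<le> x \<and> y \<le> j then (x, y) else (?t x, ?t y)"
  have "inj_on ?f (inversions a b c)"
    using assms by (auto simp: inj_on_def inversions_def Transposition.transpose_def split: if_splits)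
  moreover have "?f ` inversions a b c \<subseteq> inversions a b (c \<circ> ?t)"
    using assms by (auto simp: inversions_def Transposition.transpose_def split: if_splits)
  ultimately show ?thesis
    unfolding ninv_def by (intro card_inj_on_le[of ?f]) auto
qed

section \<open>Reduced words by sorting, and the length as a number of inversions\<close>

lemma inv_adj_comp:
  assumes "bij w"
  shows "pinv (adj i \<circ> w) = pinv w \<circ> adj i"
  by (subst o_inv_distrib) (auto simp: assms)

lemma apply_adj_transps_permutes:
  "set is \<subseteq> {1..<n} \<Longrightarrow> apply_adj_transps is permutes {1..n}"
  by (rule permutes_apply_adj_transps) auto

lemma ninv_apply_adj_transps_le:
  "set is \<subseteq> {1..<n} \<Longrightarrow> ninv 1 n (pinv (apply_adj_transps is)) \<le> length is"
proof (induction "is")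
  case Nil
  then show ?case by simp
next
  case (Cons i "is")
  then have "bij (apply_adj_transps is)"
    using apply_adj_transps_permutes permutes_bij by auto
  then show ?case
    using Cons ninv_adj_le[of 1 i n "pinv (apply_adj_transps is)"]
    unfolding apply_adj_transps_Cons Suc_eq_plus1[symmetric] by (subst inv_adj_comp) auto
qed

text \<open>Taking the least descent makes sorting a function. That any other descent gives the same
  Hecke element is the content of \<open>word_elem_descent\<close>.\<close>

definition least_descent :: "nat \<Rightarrow> (nat \<Rightarrow> nat) \<Rightarrow> nat" where
  "least_descent n c = (LEAST i. i \<in> {1..<n} \<and> c (Suc i) < c i)"

lemma least_descent:
  assumes "ninv 1 n c \<noteq> 0"
  shows "least_descent n c \<in> {1..<n}" "c (Suc (least_descent n c)) < c (least_descent n c)"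
proof -
  have "\<exists>i. i \<in> {1..<n} \<and> c (Suc i) < c i"
    using no_descent_ninv_0[of 1 n c] assms by (metis atLeastLessThan_iff not_le)
  then have "least_descent n c \<in> {1..<n} \<and> c (Suc (least_descent n c)) < c (least_descent n c)"
    unfolding least_descent_def by (rule LeastI_ex)
  then show "least_descent n c \<in> {1..<n}" "c (Suc (least_descent n c)) < c (least_descent n c)"
    by auto
qed

function sorting_word :: "nat \<Rightarrow> (nat \<Rightarrow> nat) \<Rightarrow> nat list" where
  "sorting_word n c = (if ninv 1 n c = 0 then []
     else least_descent n c # sorting_word n (c \<circ> adj (least_descent n c)))"
  by auto
termination
proof (relation "measure (\<lambda>(n, c). ninv 1 n c)")
  fix n c
  assume "ninv 1 n c \<noteq> 0"
  then show "((n, c \<circ> adj (least_descent n c)), n, c) \<in> measure (\<lambda>(n, c). ninv 1 n c)"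
    using least_descent[of n c] ninv_descent[of 1 "least_descent n c" n c] by simp
qed auto

declare sorting_word.simps [simp del]

lemma sorting_word_sorted: "ninv 1 n c = 0 \<Longrightarrow> sorting_word n c = []"
  and sorting_word_Cons: "ninv 1 n c \<noteq> 0 \<Longrightarrow>
    sorting_word n c = least_descent n c # sorting_word n (c \<circ> adj (least_descent n c))"
  by (subst sorting_word.simps; simp only: simp_thms if_True if_False)+

lemma set_sorting_word: "set (sorting_word n c) \<subseteq> {1..<n}"
proof (induction n c rule: sorting_word.induct)
  case (1 n c)
  show ?case
  proof (cases "ninv 1 n c = 0")
    case True
    show ?thesis
      unfolding sorting_word_sorted[OF True] by simp
  next
    case False
    show ?thesis
      unfolding sorting_word_Cons[OF False] set_simps
      using least_descent(1)[OF False] "1.IH"[OF False] by (rule insert_subsetI)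
  qed
qed

lemma length_sorting_word: "length (sorting_word n c) = ninv 1 n c"
proof (induction n c rule: sorting_word.induct)
  case (1 n c)
  show ?case
  proof (cases "ninv 1 n c = 0")
    case True
    then show ?thesis
      unfolding sorting_word_sorted[OF True] by (metis list.size(3))
  next
    case False
    have "ninv 1 n c = Suc (ninv 1 n (c \<circ> adj (least_descent n c)))"
      using least_descent[OF False] by (intro ninv_descent) simp_all
    then show ?thesis
      unfolding sorting_word_Cons[OF False] using "1.IH"[OF False] by (metis list.size(4) add_Suc_right add.right_neutral)
  qed
qed

lemma apply_sorting_word:
  "w permutes {1..n} \<Longrightarrow> apply_adj_transps (sorting_word n (pinv w)) = w"
proof (induction "ninv 1 n (pinv w)" arbitrary: w)
  case 0
  have "pinv w permutes {1..n}"
    using "0.prems" by (rule permutes_inv)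
  then have "id \<circ> pinv w = id"
    using ninv_eq_0_no_descent[of 1 n "pinv w"] 0
    by (intro no_descent_unique[where a = 1 and b = n]) auto
  then have "w = id"
    using "0.prems" by (metis comp_id id_comp permutes_inv_o(1))
  then show ?case
    unfolding sorting_word_sorted[OF "0.hyps"[symmetric]] by (metis apply_adj_transps_Nil)
next
  case (Suc k)
  let ?i = "least_descent n (pinv w)"
  have nz: "ninv 1 n (pinv w) \<noteq> 0"
    using Suc.hyps(2) by simp
  note i = least_descent[OF nz]
  have p: "(adj ?i \<circ> w) permutes {1..n}"
    using i Suc.prems by (intro permutes_compose adj_permutes) auto
  have e: "pinv (adj ?i \<circ> w) = pinv w \<circ> adj ?i"
    using Suc.prems permutes_bij by (intro inv_adj_comp) auto
  have "ninv 1 n (pinv w) = Suc (ninv 1 n (pinv w \<circ> adj ?i))"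
    using i by (intro ninv_descent) simp_all
  then have "k = ninv 1 n (pinv (adj ?i \<circ> w))"
    using Suc.hyps(2) unfolding e by linarith
  from Suc.hyps(1)[OF this p] have "apply_adj_transps (sorting_word n (pinv w \<circ> adj ?i)) = adj ?i \<circ> w"
    unfolding e .
  then show ?case
    unfolding sorting_word_Cons[OF nz] apply_adj_transps_Cons
    by (metis Suc_eq_plus1 comp_assoc id_comp transpose_comp_involutory)
qed

text \<open>The sorting word attains the lower bound that \<open>ninv_apply_adj_transps_le\<close>
  gives for every word of w.\<close>

lemma perm_length_eq_ninv_inv:
  assumes "w permutes {1..n}"
  shows "perm_length n w = ninv 1 n (pinv w)"
  unfolding perm_length_def
proof (rule Least_equality)
  show "\<exists>is. set is \<subseteq> {1..<n} \<and> apply_adj_transps is = w \<and> length is = ninv 1 n (pinv w)"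
    using assms set_sorting_word length_sorting_word apply_sorting_word by blast
qed (use ninv_apply_adj_transps_le in blast)

lemma perm_length_eq_ninv: "w permutes {1..n} \<Longrightarrow> perm_length n w = ninv 1 n w"
  by (simp add: perm_length_eq_ninv_inv ninv_inv)

lemma reduced_word_exists:
  assumes "w permutes {1..n}"
  shows "\<exists>is. reduced_word n w is"
  unfolding reduced_word_def
  using assms
  by (intro exI[of _ "sorting_word n (pinv w)"])
    (auto simp only: set_sorting_word length_sorting_word apply_sorting_word perm_length_eq_ninv_inv)

section \<open>The Hecke algebra as a quotient of the free algebra\<close>

definition free_carrier :: "nat \<Rightarrow> free_elem set" where
  "free_carrier n = {f. \<forall>u\<in>Poly_Mapping.keys f. set (letters u) \<subseteq> {1..<n}}"

definition word :: "nat list \<Rightarrow> free_elem" where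
  "word is = Poly_Mapping.single (Gen_Word is) 1"

lemma free_alg_sel [simp]:
  "carrier (free_alg n) = free_carrier n" "x \<otimes>\<^bsub>free_alg n\<^esub> y = x * y"
  "x \<oplus>\<^bsub>free_alg n\<^esub> y = x + y" "\<one>\<^bsub>free_alg n\<^esub> = 1" "\<zero>\<^bsub>free_alg n\<^esub> = 0"
  by (auto simp: free_alg_def free_carrier_def ring_of_type_algebra_def)

lemma free_carrier_single: "set is \<subseteq> {1..<n} \<Longrightarrow> Poly_Mapping.single (Gen_Word is) c \<in> free_carrier n"
  by (auto simp: free_carrier_def)

lemma free_carrier_word [simp]: "set is \<subseteq> {1..<n} \<Longrightarrow> word is \<in> free_carrier n"
  by (simp add: word_def free_carrier_single)

lemma free_carrier_scalar [simp]: "scalar c \<in> free_carrier n"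
  by (auto simp: scalar_def free_carrier_def zero_gen_word_def)

lemma free_carrier_0 [simp]: "0 \<in> free_carrier n"
  by (auto simp: free_carrier_def)

lemma free_carrier_1 [simp]: "1 \<in> free_carrier n"
  by (auto simp: free_carrier_def zero_gen_word_def)

lemma free_carrier_add [simp]: "f \<in> free_carrier n \<Longrightarrow> g \<in> free_carrier n \<Longrightarrow> f + g \<in> free_carrier n"
  using Poly_Mapping.keys_add[of f g] by (auto simp: free_carrier_def)

lemma free_carrier_uminus [simp]: "f \<in> free_carrier n \<Longrightarrow> - f \<in> free_carrier n"
  by (auto simp: free_carrier_def in_keys_iff)

lemma free_carrier_diff [simp]: "f \<in> free_carrier n \<Longrightarrow> g \<in> free_carrier n \<Longrightarrow> f - g \<in> free_carrier n"
  using free_carrier_add[of f n "- g"] by simp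

lemma free_carrier_mult [simp]: "f \<in> free_carrier n \<Longrightarrow> g \<in> free_carrier n \<Longrightarrow> f * g \<in> free_carrier n"
  using Poly_Mapping.keys_mult[of f g] by (fastforce simp: free_carrier_def plus_gen_word_def)

lemma free_carrier_sum [simp]: "(\<And>x. x \<in> A \<Longrightarrow> f x \<in> free_carrier n) \<Longrightarrow> sum f A \<in> free_carrier n"
  by (induction A rule: infinite_finite_induct) auto

lemma word_Nil: "word [] = 1"
  by (simp add: word_def zero_gen_word_def[symmetric])

lemma word_append: "word (is @ js) = word is * word js"
  by (simp add: word_def mult_single plus_gen_word_def)

lemma word_Cons: "word (i # is) = gen i * word is"
  using word_append[of "[i]" "is"] by (simp add: word_def gen_def)

lemma free_carrier_gen [simp]: "1 \<le> i \<Longrightarrow> i < n \<Longrightarrow> gen i \<in> free_carrier n"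
  using free_carrier_word[of "[i]" n] by (simp add: word_Cons word_Nil)

lemma scalar_mult: "scalar (c * d) = scalar c * scalar d"
  by (simp add: scalar_def mult_single)

lemma scalar_add: "scalar (c + d) = scalar c + scalar d"
  by (simp add: scalar_def single_add)

lemma scalar_uminus: "scalar (- c) = - scalar c"
  by (simp add: scalar_def single_uminus)

lemma scalar_diff: "scalar (c - d) = scalar c - scalar d"
  by (simp add: scalar_def single_diff)

lemma scalar_0 [simp]: "scalar 0 = 0"
  by (simp add: scalar_def)

lemma scalar_1 [simp]: "scalar 1 = 1"
  by (simp add: scalar_def)

lemma scalar_word: "scalar c * word is = Poly_Mapping.single (Gen_Word is) c"
  by (simp add: scalar_def word_def mult_single)

lemma free_elem_expand: "f = (\<Sum>u\<in>Poly_Mapping.keys f. scalar (Poly_Mapping.lookup f u) * word (letters u))"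
  by (rule poly_mapping_eqI)
    (auto simp: scalar_word lookup_sum lookup_single when_def in_keys_iff sum.delta' split: if_splits)

lemma scalar_commute: "f * scalar c = scalar c * f"
proof -
  have "scalar d * word is * scalar c = scalar c * (scalar d * word is)" for d "is"
    by (simp add: scalar_def word_def mult_single mult.commute)
  then show ?thesis
    by (subst (1 2) free_elem_expand[of f]) (simp add: sum_distrib_left sum_distrib_right)
qed

lemma scalar_left_commute: "f * (scalar c * g) = scalar c * (f * g)"
  by (metis mult.assoc scalar_commute)

lemma free_elem_induct [consumes 1, case_names word add scale]:
  assumes "f \<in> free_carrier n"
    and word: "\<And>is. set is \<subseteq> {1..<n} \<Longrightarrow> P (word is)"
    and add: "\<And>f g. f \<in> free_carrier n \<Longrightarrow> g \<in> free_carrier n \<Longrightarrow> P f \<Longrightarrow> P g \<Longrightarrow> P (f + g)"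
    and scale: "\<And>c f. f \<in> free_carrier n \<Longrightarrow> P f \<Longrightarrow> P (scalar c * f)"
  shows "P f"
proof -
  have "P (\<Sum>u\<in>A. scalar (Poly_Mapping.lookup f u) * word (letters u)) \<and>
      (\<Sum>u\<in>A. scalar (Poly_Mapping.lookup f u) * word (letters u)) \<in> free_carrier n"
    if "finite A" "A \<subseteq> Poly_Mapping.keys f" for A
    using that
  proof (induction A)
    case empty
    show ?case
      using scale[OF free_carrier_word word, of "[]" 0] by simp
  next
    case (insert u A)
    then have "set (letters u) \<subseteq> {1..<n}"
      using assms(1) by (auto simp: free_carrier_def)
    with insert show ?case
      by (auto intro!: add scale word)
  qed
  from this[of "Poly_Mapping.keys f"] show ?thesis
    using free_elem_expand[of f] by simp
qed

section \<open>The defining ideal and its cosets\<close>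

lemma ring_free_alg: "ring (free_alg n)"
proof (rule ringI)
  show "abelian_group (free_alg n)"
    by (rule abelian_groupI) (auto simp: add_ac intro!: bexI[of _ "- _"])
  show "monoid (free_alg n)"
    by (rule monoidI) (auto simp: mult.assoc)
qed (auto simp: algebra_simps)

lemma hecke_relators_subset: "hecke_relators n \<subseteq> free_carrier n"
  by (auto simp: hecke_relators_def)

lemma ideal_hecke_ideal: "ideal (hecke_ideal n) (free_alg n)"
  unfolding hecke_ideal_def using hecke_relators_subset ring.genideal_ideal[OF ring_free_alg] by simp

lemma hecke_ideal_0 [simp]: "0 \<in> hecke_ideal n"
  using additive_subgroup.zero_closed[OF ideal.axioms(1)[OF ideal_hecke_ideal]] by simp

lemma hecke_ideal_add: "f \<in> hecke_ideal n \<Longrightarrow> g \<in> hecke_ideal n \<Longrightarrow> f + g \<in> hecke_ideal n"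
  using additive_subgroup.a_closed[OF ideal.axioms(1)[OF ideal_hecke_ideal]] by simp

lemma hecke_ideal_mult_left: "f \<in> free_carrier n \<Longrightarrow> g \<in> hecke_ideal n \<Longrightarrow> f * g \<in> hecke_ideal n"
  using ideal.I_l_closed[OF ideal_hecke_ideal] by simp

lemma hecke_ideal_mult_right: "f \<in> free_carrier n \<Longrightarrow> g \<in> hecke_ideal n \<Longrightarrow> g * f \<in> hecke_ideal n"
  using ideal.I_r_closed[OF ideal_hecke_ideal] by simp

lemma hecke_ideal_uminus: "f \<in> hecke_ideal n \<Longrightarrow> - f \<in> hecke_ideal n"
  using hecke_ideal_mult_left[of "- 1" n f] by simp

lemma hecke_ideal_relator: "r \<in> hecke_relators n \<Longrightarrow> r \<in> hecke_ideal n"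
  unfolding hecke_ideal_def
  using ring.genideal_self[OF ring_free_alg, of "hecke_relators n" n] hecke_relators_subset by auto

text \<open>Calculations are made with representatives in the free algebra, where the type class
  operations and their simplification rules apply. Equality of cosets takes the place of equality in
  the Hecke algebra, with explicit congruence rules.\<close>

definition hcoset :: "nat \<Rightarrow> free_elem \<Rightarrow> free_elem set" where
  "hcoset n f = hecke_ideal n +>\<^bsub>free_alg n\<^esub> f"

lemma hcoset_alt: "hcoset n f = {h + f | h. h \<in> hecke_ideal n}"
  by (auto simp: hcoset_def a_r_coset_def r_coset_def)

lemma hcoset_eq_iff: "hcoset n f = hcoset n g \<longleftrightarrow> f - g \<in> hecke_ideal n"
proof
  assume "hcoset n f = hcoset n g"
  then have "0 + f \<in> hcoset n g"
    using hecke_ideal_0 unfolding hcoset_alt by blast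
  then show "f - g \<in> hecke_ideal n"
    by (auto simp: hcoset_alt)
next
  assume *: "f - g \<in> hecke_ideal n"
  have "h + f \<in> hcoset n g" if "h \<in> hecke_ideal n" for h
    unfolding hcoset_alt using hecke_ideal_add[OF that *] by (auto intro!: exI[of _ "h + (f - g)"])
  moreover have "h + g \<in> hcoset n f" if "h \<in> hecke_ideal n" for h
    unfolding hcoset_alt using hecke_ideal_add[OF that hecke_ideal_uminus[OF *]]
    by (auto intro!: exI[of _ "h + - (f - g)"])
  ultimately show "hcoset n f = hcoset n g"
    by (auto simp: hcoset_alt)
qed

lemma hcoset_eqI: "f - g \<in> hecke_ideal n \<Longrightarrow> hcoset n f = hcoset n g"
  by (simp add: hcoset_eq_iff)

lemma hecke_sel:
  "carrier (hecke n) = carrier (hecke_ring n)" "monoid.mult (hecke n) = monoid.mult (hecke_ring n)"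
  "ring.add (hecke n) = ring.add (hecke_ring n)" "\<one>\<^bsub>hecke n\<^esub> = \<one>\<^bsub>hecke_ring n\<^esub>"
  "\<zero>\<^bsub>hecke n\<^esub> = \<zero>\<^bsub>hecke_ring n\<^esub>" "c \<odot>\<^bsub>hecke n\<^esub> x = hcoset n (scalar c) \<otimes>\<^bsub>hecke_ring n\<^esub> x"
  by (simp_all add: hecke_def ring.defs module.defs hcoset_def)

lemma hcoset_closed [simp]: "f \<in> free_carrier n \<Longrightarrow> hcoset n f \<in> carrier (hecke n)"
  by (auto simp: hecke_sel hecke_ring_def FactRing_def A_RCOSETS_def RCOSETS_def hcoset_def a_r_coset_def)

lemma hecke_elemE:
  assumes "x \<in> carrier (hecke n)"
  obtains f where "f \<in> free_carrier n" "x = hcoset n f"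
  using assms by (auto simp: hecke_sel hecke_ring_def FactRing_def A_RCOSETS_def RCOSETS_def hcoset_def a_r_coset_def)

lemma hcoset_mult:
  "f \<in> free_carrier n \<Longrightarrow> g \<in> free_carrier n \<Longrightarrow> hcoset n f \<otimes>\<^bsub>hecke n\<^esub> hcoset n g = hcoset n (f * g)"
  using ideal.rcoset_mult_add[OF ideal_hecke_ideal[of n], of f g]
  by (simp add: hecke_sel hecke_ring_def FactRing_def hcoset_def)

lemma hcoset_add:
  "f \<in> free_carrier n \<Longrightarrow> g \<in> free_carrier n \<Longrightarrow> hcoset n f \<oplus>\<^bsub>hecke n\<^esub> hcoset n g = hcoset n (f + g)"
  using abelian_subgroup.a_rcos_sum[OF abelian_subgroupI3[OF ideal.axioms(1)[OF ideal_hecke_ideal[of n]] ring.is_abelian_group[OF ring_free_alg]], of f g]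
  by (simp add: hecke_sel hecke_ring_def FactRing_def hcoset_def)

lemma hcoset_one: "\<one>\<^bsub>hecke n\<^esub> = hcoset n 1"
  by (simp add: hecke_sel hecke_ring_def FactRing_def hcoset_def)

lemma hcoset_zero: "\<zero>\<^bsub>hecke n\<^esub> = hcoset n 0"
  by (auto simp add: hecke_sel hecke_ring_def FactRing_def hcoset_alt)

lemma hcoset_smult: "f \<in> free_carrier n \<Longrightarrow> c \<odot>\<^bsub>hecke n\<^esub> hcoset n f = hcoset n (scalar c * f)"
  using hcoset_mult[of "scalar c" n f] by (simp add: hecke_sel)

text \<open>Derived from representatives, since \<open>hecke n\<close> is a module record whose
  operations are those of the quotient ring.\<close>

lemma ring_hecke: "ring (hecke n)"
proof (rule ringI)
  show "abelian_group (hecke n)"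
  proof (rule abelian_groupI)
    fix x assume "x \<in> carrier (hecke n)"
    then obtain f where f: "f \<in> free_carrier n" "x = hcoset n f" by (rule hecke_elemE)
    then show "\<exists>y\<in>carrier (hecke n). y \<oplus>\<^bsub>hecke n\<^esub> x = \<zero>\<^bsub>hecke n\<^esub>"
      by (intro bexI[of _ "hcoset n (- f)"]) (auto simp: hcoset_add hcoset_zero)
  qed (auto elim!: hecke_elemE simp: hcoset_add hcoset_zero add_ac)
  show "monoid (hecke n)"
    by (rule monoidI) (auto elim!: hecke_elemE simp: hcoset_mult hcoset_one mult.assoc)
qed (auto elim!: hecke_elemE simp: hcoset_mult hcoset_add algebra_simps)

lemma hcoset_a_inv: "f \<in> free_carrier n \<Longrightarrow> \<ominus>\<^bsub>hecke n\<^esub> hcoset n f = hcoset n (- f)"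
  by (rule abelian_group.minus_equality[OF ring.is_abelian_group[OF ring_hecke]])
    (auto simp: hcoset_add hcoset_zero)

lemma hcoset_minus:
  "f \<in> free_carrier n \<Longrightarrow> g \<in> free_carrier n \<Longrightarrow> hcoset n f \<ominus>\<^bsub>hecke n\<^esub> hcoset n g = hcoset n (f - g)"
  by (simp add: a_minus_def hcoset_a_inv hcoset_add)

lemma hcoset_finsum:
  "(\<And>x. x \<in> A \<Longrightarrow> f x \<in> free_carrier n) \<Longrightarrow> finite A \<Longrightarrow>
    (\<Oplus>\<^bsub>hecke n\<^esub>x\<in>A. hcoset n (f x)) = hcoset n (sum f A)"
proof (induction A rule: infinite_finite_induct)
  case empty
  then show ?case
    by (simp add: abelian_monoid.finsum_empty[OF abelian_group.axioms(1)[OF ring.is_abelian_group[OF ring_hecke]]] hcoset_zero)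
next
  case (insert x A)
  then show ?case
    by (subst abelian_monoid.finsum_insert[OF abelian_group.axioms(1)[OF ring.is_abelian_group[OF ring_hecke]]])
      (auto simp: hcoset_add)
qed simp

lemma T_gen_eq: "T_gen n i = hcoset n (gen i)"
  by (simp add: T_gen_def hcoset_def)

lemma hecke_prod_hcoset:
  "(\<And>f. f \<in> set fs \<Longrightarrow> f \<in> free_carrier n) \<Longrightarrow>
    hecke_prod n (map (hcoset n) fs) = hcoset n (prod_list fs) \<and> prod_list fs \<in> free_carrier n"
  by (induction fs) (auto simp: hecke_prod_def hcoset_one hcoset_mult)

lemma word_eq_prod_list: "word is = prod_list (map gen is)"
  by (induction "is") (simp_all add: word_Nil word_Cons)

lemma hecke_prod_T_gen:
  "set is \<subseteq> {1..<n} \<Longrightarrow> hecke_prod n (map (T_gen n) is) = hcoset n (word is)"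
proof -
  assume "set is \<subseteq> {1..<n}"
  then have "hecke_prod n (map (hcoset n) (map gen is)) = hcoset n (prod_list (map gen is))"
    by (intro hecke_prod_hcoset[THEN conjunct1]) auto
  moreover have "map (T_gen n) is = map (hcoset n) (map gen is)"
    by (simp add: T_gen_eq)
  ultimately show ?thesis
    by (simp only: word_eq_prod_list)
qed


section \<open>The representation on functions of words\<close>

type_synonym wfun = "(nat \<Rightarrow> nat) \<Rightarrow> laurent"

text \<open>On two words that differ by swapping distinct letters at i and i+1, this is the
  symmetric block with rows (0, q^(1/2)) and (q^(1/2), q - 1), whose eigenvalues are q and -1; at
  equal letters only the eigenvalue -1 remains.\<close>

definition opr :: "nat \<Rightarrow> wfun \<Rightarrow> wfun" where
  "opr i F c = (if c (Suc i) = c i then - F c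
     else qh 1 * F (c \<circ> adj i) + (if c (Suc i) < c i then (qh 2 - 1) * F c else 0))"

text \<open>The functions live on all words at once. A content is selected later, by starting from
  \<open>delta\<close> of a suitable word.\<close>

definition act :: "free_elem \<Rightarrow> wfun \<Rightarrow> wfun" where
  "act f F c = (\<Sum>u\<in>Poly_Mapping.keys f. Poly_Mapping.lookup f u * foldr opr (letters u) F c)"

lemma act_superset:
  "finite A \<Longrightarrow> Poly_Mapping.keys f \<subseteq> A \<Longrightarrow>
    act f F c = (\<Sum>u\<in>A. Poly_Mapping.lookup f u * foldr opr (letters u) F c)"
  unfolding act_def by (rule sum.mono_neutral_left) (auto simp: in_keys_iff)

lemma act_add: "act (f + g) F c = act f F c + act g F c"
  using Poly_Mapping.keys_add[of f g]
  by (subst (1 2 3) act_superset[of "Poly_Mapping.keys f \<union> Poly_Mapping.keys g"])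
    (auto simp: lookup_add sum.distrib algebra_simps)

lemma act_0 [simp]: "act 0 F c = 0"
  by (simp add: act_def)

lemma act_uminus: "act (- f) F c = - act f F c"
  using act_add[of f "- f" F c] by (simp add: eq_neg_iff_add_eq_0 add.commute)

lemma act_diff: "act (f - g) F c = act f F c - act g F c"
  using act_add[of f "- g" F c] by (simp add: act_uminus)

lemma act_sum: "act (sum f A) F c = (\<Sum>x\<in>A. act (f x) F c)"
  by (induction A rule: infinite_finite_induct) (simp_all add: act_add)

lemma act_single: "act (Poly_Mapping.single u a) F c = a * foldr opr (letters u) F c"
  by (cases "a = 0") (simp_all add: act_def)

lemma act_word: "act (word is) F = foldr opr is F"
  by (simp add: word_def act_single fun_eq_iff)

lemma act_gen: "act (gen i) F = opr i F"
  by (simp add: gen_def act_single fun_eq_iff)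

lemma act_scalar: "act (scalar a) F c = a * F c"
  by (simp add: scalar_def zero_gen_word_def act_single)

lemma act_1 [simp]: "act 1 F = F"
  using act_word[of "[]" F] by (simp add: word_Nil)

lemma opr_sum: "opr i (\<lambda>c. \<Sum>x\<in>A. a x * F x c) c = (\<Sum>x\<in>A. a x * opr i (F x) c)"
  by (simp add: opr_def sum_negf[symmetric] sum_distrib_left sum.distrib[symmetric] algebra_simps)

lemma opr_foldr_sum: "foldr opr is (\<lambda>c. \<Sum>x\<in>A. a x * F x c) c = (\<Sum>x\<in>A. a x * foldr opr is (F x) c)"
proof (induction "is" arbitrary: c)
  case (Cons i "is")
  then have "foldr opr is (\<lambda>c. \<Sum>x\<in>A. a x * F x c) = (\<lambda>c. \<Sum>x\<in>A. a x * foldr opr is (F x) c)"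
    by (simp add: fun_eq_iff)
  then show ?case
    by (simp add: opr_sum)
qed simp

lemma act_lincomb: "act f (\<lambda>c. \<Sum>x\<in>A. a x * F x c) c = (\<Sum>x\<in>A. a x * act f (F x) c)"
  unfolding act_def opr_foldr_sum sum_distrib_left
  by (subst sum.swap) (simp add: algebra_simps)

lemma act_scale: "act f (\<lambda>c. a * F c) c = a * act f F c"
  using act_lincomb[where A = "{()}" and a = "\<lambda>_. a" and F = "\<lambda>_. F"] by simp

lemma act_single_mult:
  "act (Poly_Mapping.single u a * g) F c = a * foldr opr (letters u) (act g F) c"
proof -
  have "Poly_Mapping.single u a * g =
      (\<Sum>v\<in>Poly_Mapping.keys g. Poly_Mapping.single (u + v) (a * Poly_Mapping.lookup g v))"
    by (subst free_elem_expand[of g])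
      (simp add: sum_distrib_left scalar_word mult_single)
  then have "act (Poly_Mapping.single u a * g) F c =
      (\<Sum>v\<in>Poly_Mapping.keys g. a * (Poly_Mapping.lookup g v * foldr opr (letters u) (foldr opr (letters v) F) c))"
    by (simp add: act_sum act_single plus_gen_word_def mult.assoc)
  moreover have "act g F = (\<lambda>c. \<Sum>v\<in>Poly_Mapping.keys g. Poly_Mapping.lookup g v * foldr opr (letters v) F c)"
    by (simp add: fun_eq_iff act_def)
  ultimately show ?thesis
    by (simp add: opr_foldr_sum sum_distrib_left)
qed

lemma act_mult: "act (f * g) F c = act f (act g F) c"
proof -
  have "f * g = (\<Sum>u\<in>Poly_Mapping.keys f. Poly_Mapping.single (Gen_Word (letters u)) (Poly_Mapping.lookup f u) * g)"
    by (subst free_elem_expand[of f]) (simp add: sum_distrib_right scalar_word)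
  then show ?thesis
    by (simp add: act_sum act_single_mult act_def[of f])
qed

lemma act_mult': "act (f * g) F = act f (act g F)"
  by (rule ext) (rule act_mult)

section \<open>The Hecke relations for the operators\<close>

lemma qh_mult: "qh a * qh b = qh (a + b)"
  by (simp add: mult_single)

text \<open>T_i sees only the letters x, y at positions i, i+1 and the values u, v of the function
  at the word and at its swap. With s for q^(1/2) the Hecke relations become polynomial identities
  in a commutative ring, one for each relative order of the letters.\<close>

definition opr_val :: "'a::comm_ring_1 \<Rightarrow> nat \<Rightarrow> nat \<Rightarrow> 'a \<Rightarrow> 'a \<Rightarrow> 'a" where
  "opr_val s x y u v = (if y = x then - u else s * v + (if y < x then (s * s - 1) * u else 0))"

lemma opr_eq_opr_val: "opr i F c = opr_val (qh 1) (c i) (c (Suc i)) (F c) (F (c \<circ> adj i))"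
  by (simp add: opr_def opr_val_def qh_mult)

lemma opr_val_quadratic:
  "opr_val s x y (opr_val s x y f0 f1) (opr_val s y x f1 f0) = (s * s - 1) * opr_val s x y f0 f1 + s * s * f0"
  unfolding opr_val_def by (cases x y rule: linorder_cases) (simp_all add: algebra_simps)

lemma opr_val_commute:
  "opr_val s x y (opr_val s u v f0 f2) (opr_val s u v f1 f12) = opr_val s u v (opr_val s x y f0 f1) (opr_val s x y f2 f12)"
  unfolding opr_val_def
  by (cases x y rule: linorder_cases; cases u v rule: linorder_cases) (simp_all add: algebra_simps)

lemma opr_quadratic: "opr i (opr i F) c = (qh 2 - 1) * opr i F c + qh 2 * F c"
proof -
  have "qh 2 = qh 1 * qh 1"
    by (simp add: qh_mult)
  moreover have "adj i i = Suc i" "adj i (Suc i) = i"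
    by auto
  ultimately show ?thesis
    unfolding opr_eq_opr_val[of i] by (simp only: comp_apply comp_adj_adj opr_val_quadratic)
qed

lemma adj_braid: "c \<circ> adj (Suc i) \<circ> adj i \<circ> adj (Suc i) = c \<circ> adj i \<circ> adj (Suc i) \<circ> adj i"
  by (auto simp: fun_eq_iff Transposition.transpose_def)

lemma adj_commute:
  "2 \<le> \<bar>int i - int j\<bar> \<Longrightarrow> c \<circ> adj i \<circ> adj j = c \<circ> adj j \<circ> adj i"
  by (auto simp: fun_eq_iff Transposition.transpose_def)

text \<open>The six values belong to the six rearrangements of the letters x, y, z, named after the
  swaps performed. Equal letters make some rearrangements coincide, and the hypotheses record
  exactly these coincidences.\<close>

lemma opr_val_braid:
  assumes xy: "x = y \<Longrightarrow> f1 = f0 \<and> f12 = f2 \<and> fw = f21"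
    and yz: "y = z \<Longrightarrow> f2 = f0 \<and> f21 = f1 \<and> fw = f12"
    and xz: "x = z \<Longrightarrow> f12 = f1 \<and> f21 = f2"
  shows "opr_val s x y (opr_val s y z (opr_val s x y f0 f1) (opr_val s x z f2 f21))
      (opr_val s x z (opr_val s y x f1 f0) (opr_val s y z f12 fw)) =
    opr_val s y z (opr_val s x y (opr_val s y z f0 f2) (opr_val s x z f1 f12))
      (opr_val s x z (opr_val s z y f2 f0) (opr_val s x y f21 fw))"
proof -
  consider (eq) "x = y" "y = z" | (xy) "x = y" "y \<noteq> z" | (yz) "y = z" "x \<noteq> y" | (xz) "x = z" "x \<noteq> y"
    | (distinct) "x \<noteq> y" "y \<noteq> z" "x \<noteq> z"
    by blast
  then show ?thesis
  proof cases
    case eq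
    then have f: "f1 = f0" "f2 = f0" "f12 = f0" "f21 = f0" "fw = f0"
      using xy yz xz by auto
    show ?thesis
      unfolding f eq by (simp add: opr_val_def)
  next
    case xy
    then have f: "f1 = f0" "f12 = f2" "fw = f21"
      using assms(1) by auto
    show ?thesis
      unfolding f xy(1) using xy(2)
      by (cases y z rule: linorder_cases) (simp_all add: opr_val_def algebra_simps)
  next
    case yz
    then have f: "f2 = f0" "f21 = f1" "fw = f12"
      using assms(2) by auto
    show ?thesis
      unfolding f yz(1) using yz(1,2)
      by (cases x y rule: linorder_cases) (simp_all add: opr_val_def algebra_simps)
  next
    case xz
    then have f: "f12 = f1" "f21 = f2"
      using assms(3) by auto
    show ?thesis
      unfolding f xz(1) using xz
      by (cases x y rule: linorder_cases) (simp_all add: opr_val_def algebra_simps)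
  next
    case distinct
    then consider "x < y" "y < z" | "x < z" "z < y" | "y < x" "x < z" | "y < z" "z < x" | "z < x" "x < y" | "z < y" "y < x"
      by linarith
    then show ?thesis
      by cases (simp_all add: opr_val_def algebra_simps)
  qed
qed

lemma opr_braid: "opr i (opr (Suc i) (opr i F)) c = opr (Suc i) (opr i (opr (Suc i) F)) c"
proof -
  have v: "adj i i = Suc i" "adj i (Suc i) = i" "adj i (Suc (Suc i)) = Suc (Suc i)"
    "adj (Suc i) i = i" "adj (Suc i) (Suc i) = Suc (Suc i)" "adj (Suc i) (Suc (Suc i)) = Suc i"
    by (auto simp: Transposition.transpose_def)
  have "opr_val (qh 1) x y (opr_val (qh 1) y z (opr_val (qh 1) x y (F c) (F (c \<circ> adj i))) (opr_val (qh 1) x z (F (c \<circ> adj (Suc i))) (F (c \<circ> adj (Suc i) \<circ> adj i))))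
      (opr_val (qh 1) x z (opr_val (qh 1) y x (F (c \<circ> adj i)) (F c)) (opr_val (qh 1) y z (F (c \<circ> adj i \<circ> adj (Suc i))) (F (c \<circ> adj i \<circ> adj (Suc i) \<circ> adj i)))) =
    opr_val (qh 1) y z (opr_val (qh 1) x y (opr_val (qh 1) y z (F c) (F (c \<circ> adj (Suc i)))) (opr_val (qh 1) x z (F (c \<circ> adj i)) (F (c \<circ> adj i \<circ> adj (Suc i)))))
      (opr_val (qh 1) x z (opr_val (qh 1) z y (F (c \<circ> adj (Suc i))) (F c)) (opr_val (qh 1) x y (F (c \<circ> adj (Suc i) \<circ> adj i)) (F (c \<circ> adj i \<circ> adj (Suc i) \<circ> adj i))))"
    if xyz: "x = c i" "y = c (Suc i)" "z = c (Suc (Suc i))" for x y z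
  proof (rule opr_val_braid)
    assume "x = y"
    then have "c \<circ> adj i = c"
      using xyz by (intro comp_adj_eq) simp
    then show "F (c \<circ> adj i) = F c \<and> F (c \<circ> adj i \<circ> adj (Suc i)) = F (c \<circ> adj (Suc i)) \<and>
        F (c \<circ> adj i \<circ> adj (Suc i) \<circ> adj i) = F (c \<circ> adj (Suc i) \<circ> adj i)"
      by simp
  next
    assume "y = z"
    then have "c \<circ> adj (Suc i) = c"
      using xyz by (intro comp_adj_eq) simp
    then show "F (c \<circ> adj (Suc i)) = F c \<and> F (c \<circ> adj (Suc i) \<circ> adj i) = F (c \<circ> adj i) \<and>
        F (c \<circ> adj i \<circ> adj (Suc i) \<circ> adj i) = F (c \<circ> adj i \<circ> adj (Suc i))"
      by (simp flip: adj_braid)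
  next
    assume "x = z"
    then have "c \<circ> adj (Suc i) \<circ> adj i = c \<circ> adj (Suc i)" "c \<circ> adj i \<circ> adj (Suc i) = c \<circ> adj i"
      using xyz by (intro comp_adj_eq; simp add: v)+
    then show "F (c \<circ> adj i \<circ> adj (Suc i)) = F (c \<circ> adj i) \<and> F (c \<circ> adj (Suc i) \<circ> adj i) = F (c \<circ> adj (Suc i))"
      by simp
  qed
  from this[OF refl refl refl] show ?thesis
    unfolding opr_eq_opr_val[of i] opr_eq_opr_val[of "Suc i"]
    by (simp only: comp_apply v comp_adj_adj adj_braid)
qed

lemma opr_commute:
  assumes "2 \<le> \<bar>int i - int j\<bar>"
  shows "opr i (opr j F) c = opr j (opr i F) c"
proof -
  have v: "adj i j = j" "adj i (Suc j) = Suc j" "adj j i = i" "adj j (Suc i) = Suc i"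
    using assms by (auto simp: Transposition.transpose_def)
  show ?thesis
    unfolding opr_eq_opr_val[of i] opr_eq_opr_val[of j]
    by (simp only: comp_apply v adj_commute[OF assms] opr_val_commute)
qed

lemma act_hecke_relators:
  assumes "r \<in> hecke_relators n"
  shows "act r F c = 0"
proof -
  consider (quad) i where "r = gen i * gen i - (scalar (qh 2 - 1) * gen i + scalar (qh 2))"
    | (braid) i j where "r = gen i * gen j * gen i - gen j * gen i * gen j" "\<bar>int i - int j\<bar> = 1"
    | (comm) i j where "r = gen i * gen j - gen j * gen i" "2 \<le> \<bar>int i - int j\<bar>"
    using assms unfolding hecke_relators_def by blast
  then show ?thesis
  proof cases
    case quad
    show ?thesis
      unfolding quad act_diff act_add act_mult' act_gen act_scalar opr_quadratic by simp
  next
    case braid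
    then have "i = Suc j \<or> j = Suc i"
      by auto
    then show ?thesis
      unfolding braid(1) act_diff act_mult' act_gen by (auto simp: opr_braid)
  next
    case comm
    show ?thesis
      unfolding comm(1) act_diff act_mult' act_gen opr_commute[OF comm(2)] by simp
  qed
qed

text \<open>The elements that annihilate all functions form a two-sided ideal, and it contains the
  relators.\<close>

lemma act_hecke_ideal:
  assumes "f \<in> hecke_ideal n"
  shows "act f F c = 0"
proof -
  let ?J = "{f \<in> free_carrier n. \<forall>F c. act f F c = 0}"
  have "ideal ?J (free_alg n)"
  proof (rule idealI[OF ring_free_alg])
    show "subgroup ?J (add_monoid (free_alg n))"
    proof
      show "inv\<^bsub>add_monoid (free_alg n)\<^esub> x \<in> ?J" if "x \<in> ?J" for x
      proof -
        have "inv\<^bsub>add_monoid (free_alg n)\<^esub> x = - x"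
          using that abelian_group.minus_equality[OF ring.is_abelian_group[OF ring_free_alg[of n]], of "- x" x]
          by (simp add: a_inv_def)
        then show ?thesis
          using that by (simp add: act_uminus)
      qed
    qed (auto simp: act_add)
  next
    fix f g assume "f \<in> ?J" "g \<in> carrier (free_alg n)"
    moreover have "act g (\<lambda>_. 0) c = 0" for c
      using act_scale[of g 0 "\<lambda>_. 0" c] by simp
    moreover have "act f F = (\<lambda>_. 0)" if "f \<in> ?J" for F
      using that by (simp add: fun_eq_iff)
    ultimately show "g \<otimes>\<^bsub>free_alg n\<^esub> f \<in> ?J" "f \<otimes>\<^bsub>free_alg n\<^esub> g \<in> ?J"
      by (simp_all add: act_mult')
  qed
  moreover have "hecke_relators n \<subseteq> ?J"
    using hecke_relators_subset act_hecke_relators by blast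
  ultimately have "hecke_ideal n \<subseteq> ?J"
    unfolding hecke_ideal_def by (rule ring.genideal_minimal[OF ring_free_alg])
  then show ?thesis
    using assms by blast
qed

section \<open>The elements \<open>T\<^sub>w\<close>\<close>

lemma hcoset_mult_left:
  "h \<in> free_carrier n \<Longrightarrow> hcoset n f = hcoset n g \<Longrightarrow> hcoset n (h * f) = hcoset n (h * g)"
  using hecke_ideal_mult_left[of h n "f - g"] by (simp add: hcoset_eq_iff right_diff_distrib)

lemma hcoset_mult_right:
  "h \<in> free_carrier n \<Longrightarrow> hcoset n f = hcoset n g \<Longrightarrow> hcoset n (f * h) = hcoset n (g * h)"
  using hecke_ideal_mult_right[of h n "f - g"] by (simp add: hcoset_eq_iff left_diff_distrib)

lemma hcoset_add_cong:
  "hcoset n f = hcoset n f' \<Longrightarrow> hcoset n g = hcoset n g' \<Longrightarrow> hcoset n (f + g) = hcoset n (f' + g')"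
  using hecke_ideal_add[of "f - f'" n "g - g'"] by (simp add: hcoset_eq_iff algebra_simps)

lemma hcoset_sum_cong:
  "(\<And>x. x \<in> A \<Longrightarrow> hcoset n (f x) = hcoset n (g x)) \<Longrightarrow> hcoset n (sum f A) = hcoset n (sum g A)"
proof (induction A rule: infinite_finite_induct)
  case (insert x A)
  then have "hcoset n (f x + sum f A) = hcoset n (g x + sum g A)"
    by (intro hcoset_add_cong) simp_all
  then show ?case
    using insert.hyps by simp
qed simp_all

lemma act_hcoset_cong: "hcoset n f = hcoset n g \<Longrightarrow> act f F = act g F"
  using act_hecke_ideal[of "f - g" n F] by (auto simp: hcoset_eq_iff act_diff fun_eq_iff)

lemma hcoset_quadratic:
  "1 \<le> i \<Longrightarrow> i < n \<Longrightarrow> hcoset n (gen i * gen i) = hcoset n (scalar (qh 2 - 1) * gen i + scalar (qh 2))"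
  by (rule hcoset_eqI, rule hecke_ideal_relator) (auto simp: hecke_relators_def)

lemma hcoset_braid:
  assumes "1 \<le> i" "Suc i < n"
  shows "hcoset n (gen i * gen (Suc i) * gen i) = hcoset n (gen (Suc i) * gen i * gen (Suc i))"
proof (rule hcoset_eqI, rule hecke_ideal_relator)
  have "i \<in> {1..<n} \<and> Suc i \<in> {1..<n} \<and> \<bar>int i - int (Suc i)\<bar> = 1"
    using assms by auto
  then show "gen i * gen (Suc i) * gen i - gen (Suc i) * gen i * gen (Suc i) \<in> hecke_relators n"
    unfolding hecke_relators_def by blast
qed

lemma hcoset_commute:
  assumes "1 \<le> i" "i < n" "1 \<le> j" "j < n" "2 \<le> \<bar>int i - int j\<bar>"
  shows "hcoset n (gen i * gen j) = hcoset n (gen j * gen i)"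
proof (rule hcoset_eqI, rule hecke_ideal_relator)
  have "i \<in> {1..<n} \<and> j \<in> {1..<n} \<and> 2 \<le> \<bar>int i - int j\<bar>"
    using assms by auto
  then show "gen i * gen j - gen j * gen i \<in> hecke_relators n"
    unfolding hecke_relators_def by blast
qed

text \<open>For an injective word this is a basis element T_w. For a word with repeated letters it
  is T_x with x of minimal length in its coset of the stabiliser of the sorted word.\<close>

definition word_elem :: "nat \<Rightarrow> (nat \<Rightarrow> nat) \<Rightarrow> free_elem" where
  "word_elem n c = word (sorting_word n c)"

lemma word_elem_closed [simp]: "word_elem n c \<in> free_carrier n"
  unfolding word_elem_def by (rule free_carrier_word[OF set_sorting_word])

lemma word_elem_sorted: "ninv 1 n c = 0 \<Longrightarrow> word_elem n c = 1"
  unfolding word_elem_def by (simp only: sorting_word_sorted word_Nil)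

lemma word_elem_least_descent:
  "ninv 1 n c \<noteq> 0 \<Longrightarrow> word_elem n c = gen (least_descent n c) * word_elem n (c \<circ> adj (least_descent n c))"
  unfolding word_elem_def using sorting_word_Cons word_Cons by metis

lemma descent_ninv_nonzero: "1 \<le> i \<Longrightarrow> i < n \<Longrightarrow> c (Suc i) < c i \<Longrightarrow> ninv 1 n c \<noteq> 0"
  using ninv_descent[of 1 i n c] by simp

text \<open>A form of Matsumoto's theorem: the first letter sorted may be any descent.\<close>

lemma word_elem_descent:
  assumes "1 \<le> i" "i < n" "c (Suc i) < c i"
  shows "hcoset n (word_elem n c) = hcoset n (gen i * word_elem n (c \<circ> adj i))"
  using assms
proof (induction "ninv 1 n c" arbitrary: c i rule: less_induct)
  case less
  have IH: "hcoset n (word_elem n c') = hcoset n (gen k * word_elem n (c' \<circ> adj k))"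
    if "ninv 1 n c' < ninv 1 n c" "1 \<le> k" "k < n" "c' (Suc k) < c' k" for c' k
    using less.hyps that by blast
  have decr: "ninv 1 n (c' \<circ> adj k) < ninv 1 n c'" if "1 \<le> k" "k < n" "c' (Suc k) < c' k" for c' k
    using ninv_descent[of 1 k n c'] that by simp
  \<comment> \<open>Neighbouring descents: three decreasing letters can be sorted in two ways that
    end in the same word. The induction hypothesis opens either way, and the braid relation joins
    them.\<close>
  have braid: "hcoset n (gen k * word_elem n (c \<circ> adj k)) = hcoset n (gen (Suc k) * word_elem n (c \<circ> adj (Suc k)))"
    if k: "1 \<le> k" "Suc k < n" "c (Suc k) < c k" "c (Suc (Suc k)) < c (Suc k)" for k
  proof -
    have v: "adj k k = Suc k" "adj k (Suc k) = k" "adj k (Suc (Suc k)) = Suc (Suc k)"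
      "adj (Suc k) k = k" "adj (Suc k) (Suc k) = Suc (Suc k)" "adj (Suc k) (Suc (Suc k)) = Suc k"
      by (auto simp: Transposition.transpose_def)
    let ?w = "word_elem n (c \<circ> adj k \<circ> adj (Suc k) \<circ> adj k)"
    have "hcoset n (gen k * word_elem n (c \<circ> adj k)) = hcoset n (gen k * (gen (Suc k) * word_elem n (c \<circ> adj k \<circ> adj (Suc k))))"
      using k decr[of k c] by (intro hcoset_mult_left IH) (auto simp: v)
    also have "\<dots> = hcoset n (gen k * (gen (Suc k) * (gen k * ?w)))"
      using k decr[of k c] decr[of "Suc k" "c \<circ> adj k"] by (intro hcoset_mult_left IH) (auto simp: v)
    also have "\<dots> = hcoset n (gen k * gen (Suc k) * gen k * ?w)"
      by (simp add: mult.assoc)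
    also have "\<dots> = hcoset n (gen (Suc k) * gen k * gen (Suc k) * ?w)"
      using k by (intro hcoset_mult_right hcoset_braid) auto
    also have "\<dots> = hcoset n (gen (Suc k) * (gen k * (gen (Suc k) * word_elem n (c \<circ> adj (Suc k) \<circ> adj k \<circ> adj (Suc k)))))"
      by (simp only: mult.assoc adj_braid)
    also have "\<dots> = hcoset n (gen (Suc k) * (gen k * word_elem n (c \<circ> adj (Suc k) \<circ> adj k)))"
      using k decr[of "Suc k" c] decr[of k "c \<circ> adj (Suc k)"]
      by (intro hcoset_mult_left IH[symmetric]) (auto simp: v)
    also have "\<dots> = hcoset n (gen (Suc k) * word_elem n (c \<circ> adj (Suc k)))"
      using k decr[of "Suc k" c] by (intro hcoset_mult_left IH[symmetric]) (auto simp: v)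
    finally show ?thesis .
  qed
  have nz: "ninv 1 n c \<noteq> 0"
    using descent_ninv_nonzero less.prems by blast
  define j where "j = least_descent n c"
  have j: "1 \<le> j" "j < n" "c (Suc j) < c j" and c: "word_elem n c = gen j * word_elem n (c \<circ> adj j)"
    using least_descent[OF nz] word_elem_least_descent[OF nz] by (auto simp: j_def)
  consider "i = j" | "i = Suc j" | "j = Suc i" | (far) "2 \<le> \<bar>int i - int j\<bar>"
    by linarith
  then show ?case
  proof cases
    case far
    then have v: "adj i j = j" "adj i (Suc j) = Suc j" "adj j i = i" "adj j (Suc i) = Suc i"
      by (auto simp: Transposition.transpose_def)
    let ?w = "word_elem n (c \<circ> adj j \<circ> adj i)"
    have "hcoset n (gen j * word_elem n (c \<circ> adj j)) = hcoset n (gen j * (gen i * ?w))"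
      using j less.prems decr[of j c] by (intro hcoset_mult_left IH) (auto simp: v)
    also have "\<dots> = hcoset n (gen j * gen i * ?w)"
      by (simp add: mult.assoc)
    also have "\<dots> = hcoset n (gen i * gen j * ?w)"
      using j less.prems far by (intro hcoset_mult_right hcoset_commute) auto
    also have "\<dots> = hcoset n (gen i * (gen j * word_elem n (c \<circ> adj i \<circ> adj j)))"
      by (simp only: mult.assoc adj_commute[OF far, of c])
    also have "\<dots> = hcoset n (gen i * word_elem n (c \<circ> adj i))"
      using j less.prems decr[of i c] by (intro hcoset_mult_left IH[symmetric]) (auto simp: v)
    finally show ?thesis
      unfolding c .
  qed (use c braid j less.prems in auto)
qed

text \<open>Multiplying w by s_i on the left swaps positions i and i+1 of its inverse, so the
  descents sorted away are the left descents of w.\<close>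

definition T_elem :: "nat \<Rightarrow> (nat \<Rightarrow> nat) \<Rightarrow> free_elem" where
  "T_elem n w = word_elem n (pinv w)"

lemma T_elem_closed [simp]: "T_elem n w \<in> free_carrier n"
  by (simp add: T_elem_def)

lemma T_elem_id: "T_elem n id = 1"
  unfolding T_elem_def inv_id by (simp only: word_elem_sorted ninv_id)

lemma T_elem_ascent:
  assumes "bij w" "1 \<le> i" "i < n" "pinv w i < pinv w (Suc i)"
  shows "hcoset n (gen i * T_elem n w) = hcoset n (T_elem n (adj i \<circ> w))"
  using word_elem_descent[of i n "pinv w \<circ> adj i"] assms
  unfolding T_elem_def inv_adj_comp[OF assms(1)] by simp

lemma T_elem_descent:
  assumes "bij w" "1 \<le> i" "i < n" "pinv w (Suc i) < pinv w i"
  shows "hcoset n (gen i * T_elem n w) =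
    hcoset n (scalar (qh 2 - 1) * T_elem n w + scalar (qh 2) * T_elem n (adj i \<circ> w))"
proof -
  let ?v = "T_elem n (adj i \<circ> w)"
  have *: "hcoset n (T_elem n w) = hcoset n (gen i * ?v)"
    using word_elem_descent[of i n "pinv w"] assms
    unfolding T_elem_def inv_adj_comp[OF assms(1)] by simp
  have "hcoset n (gen i * T_elem n w) = hcoset n (gen i * (gen i * ?v))"
    using assms by (intro hcoset_mult_left *) auto
  also have "\<dots> = hcoset n (gen i * gen i * ?v)"
    by (simp add: mult.assoc)
  also have "\<dots> = hcoset n ((scalar (qh 2 - 1) * gen i + scalar (qh 2)) * ?v)"
    using assms by (intro hcoset_mult_right hcoset_quadratic) auto
  also have "\<dots> = hcoset n (scalar (qh 2 - 1) * (gen i * ?v) + scalar (qh 2) * ?v)"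
    by (simp add: distrib_right mult.assoc)
  also have "\<dots> = hcoset n (scalar (qh 2 - 1) * T_elem n w + scalar (qh 2) * ?v)"
    by (intro hcoset_add_cong hcoset_mult_left *[symmetric]) auto
  finally show ?thesis .
qed

text \<open>Read from the right, each letter of a reduced word must be an ascent, as the number of
  inversions could not reach the number of letters otherwise; each is then an instance of
  \<open>T_elem_ascent\<close>. This frees \<open>T_basis\<close> from the choice of its reduced
  word.\<close>

lemma hcoset_word_reduced:
  assumes "set is \<subseteq> {1..<n}" "length is = ninv 1 n (pinv (apply_adj_transps is))"
  shows "hcoset n (word is) = hcoset n (T_elem n (apply_adj_transps is))"
  using assms
proof (induction "is")
  case Nil
  show ?case
    unfolding T_elem_def apply_adj_transps_Nil word_Nil inv_id by (simp add: word_elem_sorted)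
next
  case (Cons i "is")
  let ?w = "apply_adj_transps is" and ?c = "pinv (apply_adj_transps is)"
  have i: "1 \<le> i" "i < n" "set is \<subseteq> {1..<n}"
    using Cons.prems(1) by auto
  then have w: "?w permutes {1..n}" "bij ?w"
    using apply_adj_transps_permutes permutes_bij by blast+
  have e: "apply_adj_transps (i # is) = adj i \<circ> ?w"
    by (simp add: fun_eq_iff)
  have l: "Suc (length is) = ninv 1 n (?c \<circ> adj i)"
    using Cons.prems(2) unfolding e inv_adj_comp[OF w(2)] by (simp only: list.size add_Suc_right add.right_neutral)
  have le: "ninv 1 n ?c \<le> length is"
    using ninv_apply_adj_transps_le[OF i(3)] .
  have asc: "?c i < ?c (Suc i)"
  proof (rule ccontr)
    assume "\<not> ?thesis"
    then have "ninv 1 n (?c \<circ> adj i) \<le> ninv 1 n ?c"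
      using ninv_descent[of 1 i n ?c] comp_adj_eq[of ?c i] i by (metis Suc_leD linorder_neqE_nat order_refl)
    then show False
      using l le by linarith
  qed
  then have "length is = ninv 1 n ?c"
    using l ninv_ascent[of 1 i n ?c] i by (metis nat.inject)
  then have "hcoset n (word is) = hcoset n (T_elem n ?w)"
    using Cons.IH i by blast
  then have "hcoset n (word (i # is)) = hcoset n (gen i * T_elem n ?w)"
    unfolding word_Cons using i by (intro hcoset_mult_left) auto
  also have "\<dots> = hcoset n (T_elem n (adj i \<circ> ?w))"
    using T_elem_ascent[OF w(2) i(1,2) asc] .
  finally show ?case
    unfolding e .
qed

lemma T_basis_eq:
  assumes "w permutes {1..n}"
  shows "T_basis n w = hcoset n (T_elem n w)"
proof -
  define "is" where "is = (SOME is. reduced_word n w is)"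
  have "reduced_word n w is"
    unfolding is_def using reduced_word_exists[OF assms] by (rule someI_ex)
  then have "set is \<subseteq> {1..<n}" "apply_adj_transps is = w" "length is = ninv 1 n (pinv w)"
    using perm_length_eq_ninv_inv[OF assms] by (auto simp: reduced_word_def)
  then show ?thesis
    unfolding T_basis_def is_def[symmetric] using hcoset_word_reduced hecke_prod_T_gen by metis
qed

section \<open>Products of basis elements with additive lengths\<close>

definition plen :: "nat \<Rightarrow> (nat \<Rightarrow> nat) \<Rightarrow> nat" where
  "plen n w = ninv 1 n (pinv w)"

lemma plen_eq: "w permutes {1..n} \<Longrightarrow> plen n w = ninv 1 n w"
  by (simp only: plen_def ninv_inv)

lemma plen_descent:
  "bij w \<Longrightarrow> 1 \<le> i \<Longrightarrow> i < n \<Longrightarrow> pinv w (Suc i) < pinv w i \<Longrightarrow> plen n w = Suc (plen n (adj i \<circ> w))"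
  unfolding plen_def by (simp only: inv_adj_comp ninv_descent)

lemma plen_adj_le: "bij w \<Longrightarrow> 1 \<le> i \<Longrightarrow> i < n \<Longrightarrow> plen n (adj i \<circ> w) \<le> Suc (plen n w)"
  unfolding plen_def by (simp only: inv_adj_comp ninv_adj_le)

lemma plen_nonzero_descent:
  assumes "plen n w \<noteq> 0"
  obtains i where "1 \<le> i" "i < n" "pinv w (Suc i) < pinv w i"
  using least_descent[of n "pinv w"] assms unfolding plen_def by auto

lemma plen_0_id:
  assumes "w permutes {1..n}" "plen n w = 0"
  shows "w = id"
  using apply_sorting_word[OF assms(1)] sorting_word_sorted assms(2) unfolding plen_def by (metis apply_adj_transps_Nil)

lemma adj_comp_permutes: "w permutes {1..n} \<Longrightarrow> 1 \<le> i \<Longrightarrow> i < n \<Longrightarrow> (adj i \<circ> w) permutes {1..n}"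
  by (intro permutes_compose adj_permutes) auto

lemma adj_adj_comp [simp]: "adj i \<circ> (adj i \<circ> w) = w"
  by (simp add: fun_eq_iff)

lemma plen_comp_le:
  "x permutes {1..n} \<Longrightarrow> y permutes {1..n} \<Longrightarrow> plen n (x \<circ> y) \<le> plen n x + plen n y"
proof (induction "plen n x" arbitrary: x)
  case 0
  then have "x = id"
    using plen_0_id by metis
  then show ?case
    by simp
next
  case (Suc k)
  have "plen n x \<noteq> 0"
    using Suc.hyps(2) by simp
  then obtain i where i: "1 \<le> i" "i < n" "pinv x (Suc i) < pinv x i"
    by (rule plen_nonzero_descent)
  let ?x = "adj i \<circ> x"
  have p: "?x permutes {1..n}" and x: "plen n x = Suc (plen n ?x)"
    using Suc.prems i adj_comp_permutes plen_descent permutes_bij by blast+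
  have b: "bij (?x \<circ> y)"
    using p Suc.prems(2) permutes_bij bij_comp by blast
  have "plen n (adj i \<circ> (?x \<circ> y)) \<le> Suc (plen n (?x \<circ> y))"
    using b i by (intro plen_adj_le) auto
  moreover have xy: "adj i \<circ> (?x \<circ> y) = x \<circ> y"
    by (simp add: fun_eq_iff)
  moreover have "plen n (?x \<circ> y) \<le> plen n ?x + plen n y"
    using Suc.hyps x p Suc.prems(2) by simp
  ultimately show ?case
    using x unfolding xy by linarith
qed

text \<open>A left descent i is split off from x. Additivity of lengths passes to the shorter
  factor, so i is an ascent both of this factor and of its product with y, and T_i multiplies onto
  both in the same way.\<close>

lemma T_elem_mult:
  "x permutes {1..n} \<Longrightarrow> y permutes {1..n} \<Longrightarrow> plen n (x \<circ> y) = plen n x + plen n y \<Longrightarrow>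
    hcoset n (T_elem n x * T_elem n y) = hcoset n (T_elem n (x \<circ> y))"
proof (induction "plen n x" arbitrary: x)
  case 0
  then have "x = id"
    using plen_0_id by metis
  then show ?case
    by (simp only: T_elem_id mult_1 id_comp)
next
  case (Suc k)
  have "plen n x \<noteq> 0"
    using Suc.hyps(2) by simp
  then obtain i where i: "1 \<le> i" "i < n" "pinv x (Suc i) < pinv x i"
    by (rule plen_nonzero_descent)
  let ?x = "adj i \<circ> x"
  have p: "?x permutes {1..n}" and x: "plen n x = Suc (plen n ?x)"
    using Suc.prems i adj_comp_permutes plen_descent permutes_bij by blast+
  have b: "bij (?x \<circ> y)" "bij ?x"
    using p Suc.prems(2) permutes_bij bij_comp by blast+
  have xy: "adj i \<circ> (?x \<circ> y) = x \<circ> y"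
    by (simp add: fun_eq_iff)
  have "plen n (x \<circ> y) \<le> Suc (plen n (?x \<circ> y))"
    using plen_adj_le[OF b(1) i(1,2)] unfolding xy .
  moreover have "plen n (?x \<circ> y) \<le> plen n ?x + plen n y"
    using plen_comp_le p Suc.prems(2) by blast
  \<comment> \<open>Both estimates must be equalities, because the lengths of x and y add up
    exactly.\<close>
  ultimately have l: "plen n (?x \<circ> y) = plen n ?x + plen n y" "plen n (x \<circ> y) = Suc (plen n (?x \<circ> y))"
    using x Suc.prems(3) by linarith+
  have inj: "pinv (?x \<circ> y) i \<noteq> pinv (?x \<circ> y) (Suc i)" "pinv ?x i \<noteq> pinv ?x (Suc i)"
    using b bij_imp_bij_inv bij_is_inj by (metis inj_eq n_not_Suc_n)+
  have asc: "pinv (?x \<circ> y) i < pinv (?x \<circ> y) (Suc i)"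
  proof (rule ccontr)
    assume "\<not> ?thesis"
    then have "pinv (?x \<circ> y) (Suc i) < pinv (?x \<circ> y) i"
      using inj(1) by linarith
    from plen_descent[OF b(1) i(1,2) this] show False
      using l unfolding xy by simp
  qed
  have asc': "pinv ?x i < pinv ?x (Suc i)"
  proof (rule ccontr)
    assume "\<not> ?thesis"
    then have "pinv ?x (Suc i) < pinv ?x i"
      using inj(2) by linarith
    from plen_descent[OF b(2) i(1,2) this] show False
      using x by simp
  qed
  have "hcoset n (T_elem n x * T_elem n y) = hcoset n (gen i * T_elem n ?x * T_elem n y)"
    using T_elem_ascent[OF b(2) i(1,2) asc'] by (intro hcoset_mult_right) auto
  also have "\<dots> = hcoset n (gen i * (T_elem n ?x * T_elem n y))"
    by (simp add: mult.assoc)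
  also have "\<dots> = hcoset n (gen i * T_elem n (?x \<circ> y))"
    using i p Suc.prems(2) l x Suc.hyps by (intro hcoset_mult_left Suc.hyps(1)) auto
  also have "\<dots> = hcoset n (T_elem n (x \<circ> y))"
    using T_elem_ascent[OF b(1) i(1,2) asc] unfolding xy .
  finally show ?case .
qed

section \<open>Reversals\<close>

lemma permutes_interval_mono: "v permutes {a..b} \<Longrightarrow> 1 \<le> a \<Longrightarrow> b \<le> n \<Longrightarrow> v permutes {1..n::nat}"
  by (rule permutes_subset[where S = "{a..b}"]) auto

lemma reversal_permutes: "reversal (a, b) permutes {a..b}"
proof (rule bij_imp_permutes)
  show "bij_betw (reversal (a, b)) {a..b} {a..b}"
    by (rule bij_betw_byWitness[where f' = "reversal (a, b)"]) (auto simp: reversal_def)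
qed (auto simp: reversal_def)

lemma reversal_reversal [simp]: "reversal (a, b) \<circ> reversal (a, b) = id"
  by (auto simp: reversal_def fun_eq_iff)

lemma reversal_comp_cancel: "reversal (a, b) \<circ> v = u \<longleftrightarrow> v = reversal (a, b) \<circ> u"
  by (metis comp_assoc id_comp reversal_reversal)

lemma permutes_interval_bounds:
  assumes "v permutes {a..b}" "a \<le> i" "i \<le> b"
  shows "a \<le> v i" "v i \<le> b"
  using permutes_in_image[OF assms(1), of i] assms(2,3) by auto

text \<open>Positions outside a..b are fixed and the values inside stay inside, so no inversion can
  involve an outside position.\<close>

lemma inversions_interval:
  assumes "v permutes {a..b}" "1 \<le> a" "b \<le> n"
  shows "inversions 1 n v = inversions a b v"
proof -
  have "a \<le> i \<and> j \<le> b" if "i < j" "v j < v i" for i j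
  proof -
    have o: "k \<notin> {a..b} \<Longrightarrow> v k = k" for k
      using permutes_not_in[OF assms(1)] .
    show ?thesis
      using permutes_interval_bounds[OF assms(1), of i] permutes_interval_bounds[OF assms(1), of j] o[of i] o[of j] that
      by (cases "i \<in> {a..b}"; cases "j \<in> {a..b}") auto
  qed
  then show ?thesis
    using assms(2,3) by (fastforce simp: inversions_def)
qed

lemma plen_interval: "v permutes {a..b} \<Longrightarrow> 1 \<le> a \<Longrightarrow> b \<le> n \<Longrightarrow> plen n v = ninv a b v"
  by (metis inversions_interval ninv_def permutes_interval_mono plen_eq)

text \<open>Reversing the values turns inversions into non-inversions and conversely, so the two
  words share out all pairs of positions between them.\<close>

lemma ninv_reversal_comp:
  assumes "v permutes {a..b}"
  shows "ninv a b (reversal (a, b) \<circ> v) + ninv a b v = ninv a b (reversal (a, b))"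
proof -
  let ?r = "reversal (a, b)"
  have r: "?r x < ?r y \<longleftrightarrow> y < x" if "a \<le> x" "x \<le> b" "a \<le> y" "y \<le> b" for x y
    using that by (auto simp: reversal_def)
  have b: "a \<le> v i \<and> v i \<le> b" if "a \<le> i" "i \<le> b" for i
    using permutes_interval_bounds[OF assms] that by blast
  have inj: "v i = v j \<longleftrightarrow> i = j" for i j
    using permutes_inj[OF assms] by (simp add: inj_eq)
  have 1: "inversions a b (?r \<circ> v) = {(i, j). a \<le> i \<and> i < j \<and> j \<le> b \<and> v i < v j}"
    using b r by (auto simp: inversions_def)
  have 2: "inversions a b ?r = {(i, j). a \<le> i \<and> i < j \<and> j \<le> b}"
    using r by (auto simp: inversions_def)
  have "inversions a b ?r = inversions a b (?r \<circ> v) \<union> inversions a b v"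
  proof (intro equalityI subrelI)
    fix i j
    show "(i, j) \<in> inversions a b (?r \<circ> v) \<union> inversions a b v" if "(i, j) \<in> inversions a b ?r"
      using that unfolding 1 2 using inj[of i j] by (auto simp: inversions_def)
    show "(i, j) \<in> inversions a b ?r" if "(i, j) \<in> inversions a b (?r \<circ> v) \<union> inversions a b v"
      using that unfolding 1 2 by (auto simp: inversions_def)
  qed
  moreover have "inversions a b (?r \<circ> v) \<inter> inversions a b v = {}"
    unfolding 1 by (auto simp: inversions_def)
  ultimately show ?thesis
    unfolding ninv_def by (metis card_Un_disjoint finite_inversions)
qed

text \<open>Downwards, a Bruhat step undoes an inversion; the inversions of a permutation of a..b
  lie in a..b, so the step stays in the subgroup. Upwards, a permutation of a..b other than the
  reversal has an ascent there, and swapping it is a Bruhat step towards the reversal.\<close>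

lemma bruhat_below_reversal:
  assumes "1 \<le> a" "b \<le> n"
  shows "bruhat_below n (reversal (a, b)) = {v. v permutes {a..b}}"
proof -
  let ?r = "reversal (a, b)"
  have len: "perm_length n v = ninv a b v" if "v permutes {a..b}" for v
    using perm_length_eq_ninv[OF permutes_interval_mono[OF that assms]] inversions_interval[OF that assms]
    unfolding ninv_def by metis
  have "v permutes {a..b}" if "bruhat_le n v u" "u permutes {a..b}" for v u
    using that unfolding bruhat_le_def
  proof (induction rule: converse_rtranclp_induct)
    case (step v u')
    then have u': "u' permutes {a..b}"
      by blast
    obtain i j where ij: "1 \<le> i" "i < j" "j \<le> n" "u' = v \<circ> Transposition.transpose i j"
      and l: "perm_length n v < perm_length n u'"
      using step.hyps(1) unfolding bruhat_step_def by blast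
    let ?t = "Transposition.transpose i j"
    have v: "v = u' \<circ> ?t"
      unfolding ij(4) by (simp add: comp_assoc)
    have p: "u' permutes {1..n}" "?t permutes {1..n}"
      using permutes_interval_mono[OF u' assms] ij by (auto intro: permutes_swap_id)
    then have "v permutes {1..n}"
      unfolding v using permutes_compose by blast
    then have "ninv 1 n v < ninv 1 n u'"
      using l p perm_length_eq_ninv by metis
    then have "\<not> u' i < u' j"
      using ninv_transpose_le[of 1 i j n u'] ij(1-3) unfolding v by linarith
    moreover have "u' i \<noteq> u' j"
      using permutes_inj[OF u'] ij(2) by (simp add: inj_eq)
    ultimately have "(i, j) \<in> inversions 1 n u'"
      using ij by (auto simp: inversions_def)
    then have "i \<in> {a..b}" "j \<in> {a..b}"
      unfolding inversions_interval[OF u' assms] by (auto simp: inversions_def)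
    then have "?t permutes {a..b}"
      by (rule permutes_swap_id)
    then show ?case
      unfolding v using u' permutes_compose by blast
  qed
  moreover have "bruhat_le n v ?r" if "v permutes {a..b}" for v
    using that
  proof (induction "ninv a b (?r \<circ> v)" arbitrary: v rule: less_induct)
    case less
    show ?case
    proof (cases "\<exists>i. a \<le> i \<and> i < b \<and> v i < v (Suc i)")
      case True
      then obtain i where i: "a \<le> i" "i < b" "v i < v (Suc i)"
        by blast
      let ?u = "v \<circ> adj i"
      have u: "?u permutes {a..b}"
        using less.prems i by (intro permutes_compose adj_permutes)
      have l: "ninv a b ?u = Suc (ninv a b v)"
        using i by (rule ninv_ascent)
      then have "ninv a b (?r \<circ> ?u) < ninv a b (?r \<circ> v)"
        using ninv_reversal_comp[OF u] ninv_reversal_comp[OF less.prems] by linarith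
      then have "bruhat_le n ?u ?r"
        using less.hyps u by blast
      moreover have "bruhat_step n v ?u"
        unfolding bruhat_step_def using i assms l len[OF u] len[OF less.prems]
        by (intro conjI exI[of _ i] exI[of _ "Suc i"]) auto
      ultimately show ?thesis
        unfolding bruhat_le_def by (meson converse_rtranclp_into_rtranclp)
    next
      case False
      have rv: "(?r \<circ> v) permutes {a..b}"
        using less.prems reversal_permutes by (rule permutes_compose)
      have "id \<circ> (?r \<circ> v) = id"
      proof (rule no_descent_unique[where a = a and b = b])
        fix i assume i: "a \<le> i" "i < b"
        have "v (Suc i) \<le> v i"
          using False i by (metis not_le)
        then show "id ((?r \<circ> v) i) \<le> id ((?r \<circ> v) (Suc i))"
          using permutes_interval_bounds[OF less.prems, of i] permutes_interval_bounds[OF less.prems, of "Suc i"] i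
          by (auto simp: reversal_def)
      qed (use rv in auto)
      then have "v = ?r"
        by (metis comp_id id_comp reversal_comp_cancel)
      then show ?thesis
        unfolding bruhat_le_def by simp
    qed
  qed
  ultimately show ?thesis
    unfolding bruhat_below_def using permutes_interval_mono[OF _ assms] reversal_permutes by blast
qed


section \<open>The sum over a parabolic subgroup\<close>

definition parabolic_sum :: "nat \<Rightarrow> nat \<times> nat \<Rightarrow> free_elem" where
  "parabolic_sum n J = (\<Sum>v | v permutes {fst J..snd J}. T_elem n v)"

lemma parabolic_sum_closed [simp]: "parabolic_sum n J \<in> free_carrier n"
  by (auto simp: parabolic_sum_def)

text \<open>The subgroup splits into pairs v, s_i v with i an ascent of the inverse of v. T_i sends
  T_v to the other member of the pair, and the other member to q - 1 times itself plus q T_v; so the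
  sum over the pair is multiplied by q.\<close>

lemma gen_parabolic_sum:
  assumes "1 \<le> a" "b \<le> n" "a \<le> i" "i < b"
  shows "hcoset n (gen i * parabolic_sum n (a, b)) = hcoset n (scalar (qh 2) * parabolic_sum n (a, b))"
proof -
  define S where "S = {v. v permutes {a..b}}"
  define U where "U = {v \<in> S. pinv v i < pinv v (Suc i)}"
  define D where "D = {v \<in> S. pinv v (Suc i) < pinv v i}"
  have i: "1 \<le> i" "i < n"
    using assms by auto
  have fin: "finite S" "finite U" "finite D"
    by (auto simp: S_def U_def D_def finite_permutations)
  have bij: "bij v" if "v \<in> S" for v
    using that permutes_bij by (auto simp: S_def)
  have "pinv v i \<noteq> pinv v (Suc i)" if "v \<in> S" for v
    using bij_imp_bij_inv[OF bij[OF that]] bij_is_inj by (metis inj_eq n_not_Suc_n)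
  then have S: "S = U \<union> D" "U \<inter> D = {}"
    by (auto simp: U_def D_def) (meson linorder_neqE_nat)
  have adjS: "adj i \<circ> v \<in> S" if "v \<in> S" for v
    using that assms unfolding S_def by (auto intro: permutes_compose adj_permutes)
  have v: "adj i i = Suc i" "adj i (Suc i) = i"
    by auto
  have inv: "pinv (adj i \<circ> v) i = pinv v (Suc i)" "pinv (adj i \<circ> v) (Suc i) = pinv v i" if "v \<in> S" for v
    unfolding inv_adj_comp[OF bij[OF that]] comp_apply v by (rule refl)+
  have bijUD: "bij_betw (\<lambda>v. adj i \<circ> v) U D"
  proof (rule bij_betw_byWitness[where f' = "\<lambda>v. adj i \<circ> v"])
    show "(\<lambda>v. adj i \<circ> v) ` U \<subseteq> D" "(\<lambda>v. adj i \<circ> v) ` D \<subseteq> U"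
      unfolding U_def D_def using adjS inv by auto
  qed simp_all
  have bijDU: "bij_betw (\<lambda>v. adj i \<circ> v) D U"
  proof (rule bij_betw_byWitness[where f' = "\<lambda>v. adj i \<circ> v"])
    show "(\<lambda>v. adj i \<circ> v) ` U \<subseteq> D" "(\<lambda>v. adj i \<circ> v) ` D \<subseteq> U"
      unfolding U_def D_def using adjS inv by auto
  qed simp_all
  have "hcoset n (gen i * parabolic_sum n (a, b)) = hcoset n ((\<Sum>v\<in>U. gen i * T_elem n v) + (\<Sum>v\<in>D. gen i * T_elem n v))"
    unfolding parabolic_sum_def S_def[symmetric] fst_conv snd_conv
    using fin S by (simp add: sum.union_disjoint sum_distrib_left distrib_left)
  also have "\<dots> = hcoset n ((\<Sum>v\<in>U. T_elem n (adj i \<circ> v)) +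
      (\<Sum>v\<in>D. scalar (qh 2 - 1) * T_elem n v + scalar (qh 2) * T_elem n (adj i \<circ> v)))"
    using i bij unfolding U_def D_def
    by (intro hcoset_add_cong hcoset_sum_cong T_elem_ascent T_elem_descent) auto
  also have "(\<Sum>v\<in>U. T_elem n (adj i \<circ> v)) = (\<Sum>v\<in>D. T_elem n v)"
    by (rule sum.reindex_bij_betw[OF bijUD])
  also have "(\<Sum>v\<in>D. scalar (qh 2 - 1) * T_elem n v + scalar (qh 2) * T_elem n (adj i \<circ> v)) =
      scalar (qh 2 - 1) * (\<Sum>v\<in>D. T_elem n v) + scalar (qh 2) * (\<Sum>v\<in>U. T_elem n v)"
    unfolding sum.distrib sum_distrib_left[symmetric]
    using sum.reindex_bij_betw[OF bijDU, of "T_elem n"] by metis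
  also have "(\<Sum>v\<in>D. T_elem n v) + (scalar (qh 2 - 1) * (\<Sum>v\<in>D. T_elem n v) + scalar (qh 2) * (\<Sum>v\<in>U. T_elem n v))
      = scalar (qh 2) * ((\<Sum>v\<in>U. T_elem n v) + (\<Sum>v\<in>D. T_elem n v))"
    by (simp add: scalar_diff algebra_simps)
  also have "(\<Sum>v\<in>U. T_elem n v) + (\<Sum>v\<in>D. T_elem n v) = parabolic_sum n (a, b)"
    unfolding parabolic_sum_def S_def[symmetric] fst_conv snd_conv
    using fin S by (simp add: sum.union_disjoint)
  finally show ?thesis .
qed

lemma word_parabolic_sum:
  assumes "1 \<le> a" "b \<le> n" "set is \<subseteq> {a..<b}"
  shows "hcoset n (word is * parabolic_sum n (a, b)) =
    hcoset n (scalar (qh (2 * int (length is))) * parabolic_sum n (a, b))"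
  using assms(3)
proof (induction "is")
  case (Cons i "is")
  let ?X = "parabolic_sum n (a, b)" and ?s = "scalar (qh (2 * int (length is)))"
  have i: "a \<le> i" "i < b" "gen i \<in> free_carrier n"
    using Cons.prems assms by auto
  have "hcoset n (word (i # is) * ?X) = hcoset n (gen i * (word is * ?X))"
    by (simp add: word_Cons mult.assoc)
  also have "\<dots> = hcoset n (gen i * (?s * ?X))"
    using Cons by (intro hcoset_mult_left i) auto
  also have "\<dots> = hcoset n (?s * (gen i * ?X))"
    by (simp add: scalar_left_commute)
  also have "\<dots> = hcoset n (?s * (scalar (qh 2) * ?X))"
    using assms i by (intro hcoset_mult_left gen_parabolic_sum) auto
  also have "\<dots> = hcoset n (scalar (qh (2 * int (length (i # is)))) * ?X)"
    unfolding mult.assoc[symmetric] scalar_mult[symmetric] qh_mult by (simp add: algebra_simps)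
  finally show ?case .
qed (simp add: word_Nil)

text \<open>A permutation of a..b has its descents in a..b, and so do all words met while sorting
  it. Hence the reduced word of the reversal consists of letters to which
  \<open>word_parabolic_sum\<close> applies.\<close>

lemma set_sorting_word_interval:
  "c permutes {a..b} \<Longrightarrow> set (sorting_word n c) \<subseteq> {a..<b}"
proof (induction n c rule: sorting_word.induct)
  case (1 n c)
  show ?case
  proof (cases "ninv 1 n c = 0")
    case True
    show ?thesis
      unfolding sorting_word_sorted[OF True] by simp
  next
    case False
    define i where "i = least_descent n c"
    have d: "c (Suc i) < c i"
      using least_descent[OF False] by (simp add: i_def)
    have o: "k \<notin> {a..b} \<Longrightarrow> c k = k" for k
      using permutes_not_in[OF "1.prems"] .
    have i: "a \<le> i" "i < b"
      using d o[of i] o[of "Suc i"] permutes_interval_bounds[OF "1.prems", of i]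
        permutes_interval_bounds[OF "1.prems", of "Suc i"]
      by (cases "i \<in> {a..b}"; cases "Suc i \<in> {a..b}"; auto)+
    then have "(c \<circ> adj i) permutes {a..b}"
      using "1.prems" adj_permutes permutes_compose by blast
    then have "set (sorting_word n (c \<circ> adj i)) \<subseteq> {a..<b}"
      using "1.IH"[OF False] unfolding i_def by blast
    then show ?thesis
      unfolding sorting_word_Cons[OF False] i_def[symmetric] using i by simp
  qed
qed

section \<open>The Kazhdan--Lusztig basis element of a reversal\<close>

definition delta :: "(nat \<Rightarrow> nat) \<Rightarrow> wfun" where
  "delta d c = (if c = d then 1 else 0)"

lemma opr_delta_ascent:
  assumes "d i < d (Suc i)"
  shows "opr i (delta d) = (\<lambda>c. qh 1 * delta (d \<circ> adj i) c)"
proof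
  fix c
  have "c \<circ> adj i = d \<longleftrightarrow> c = d \<circ> adj i"
    by auto
  then show "opr i (delta d) c = qh 1 * delta (d \<circ> adj i) c"
    using assms by (auto simp: opr_def delta_def)
qed

text \<open>Read from the right and starting at the sorted word, every letter of the sorting word
  meets an ascent, where T_i sends a basis vector to q^(1/2) times a single other one.\<close>

lemma act_word_elem_delta:
  assumes mono: "\<And>i. 1 \<le> i \<Longrightarrow> i < n \<Longrightarrow> c0 i \<le> c0 (Suc i)"
    and "c = c0 \<circ> u" "u permutes {1..n}"
  shows "act (word_elem n c) (delta c0) = (\<lambda>d. qh (int (ninv 1 n c)) * delta c d)"
  using assms(2,3)
proof (induction "ninv 1 n c" arbitrary: c u)
  case 0
  have "c0 \<circ> u = c0"
  proof (rule no_descent_unique[where a = 1 and b = n])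
    show "c0 (u i) \<le> c0 (u (Suc i))" if "1 \<le> i" "i < n" for i
      using ninv_eq_0_no_descent[of 1 n c i] that 0 by simp
  qed (use mono 0 in auto)
  then show ?case
    using 0 by (simp add: word_elem_sorted)
next
  case (Suc k)
  have nz: "ninv 1 n c \<noteq> 0"
    using Suc.hyps(2) by simp
  define i where "i = least_descent n c"
  have i: "1 \<le> i" "i < n" "c (Suc i) < c i"
    using least_descent[OF nz] by (auto simp: i_def)
  have l: "ninv 1 n c = Suc (ninv 1 n (c \<circ> adj i))"
    using i by (rule ninv_descent)
  have p: "(u \<circ> adj i) permutes {1..n}"
    using Suc.prems i by (intro permutes_compose adj_permutes)
  have "act (word_elem n (c \<circ> adj i)) (delta c0) =
      (\<lambda>d. qh (int (ninv 1 n (c \<circ> adj i))) * delta (c \<circ> adj i) d)"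
    by (rule Suc.hyps(1)[OF _ _ p]) (use Suc l in \<open>auto simp: comp_assoc\<close>)
  moreover have "opr i (\<lambda>d. a * F d) = (\<lambda>d. a * opr i F d)" for a F
    using act_scale[of "gen i" a F] by (simp add: act_gen fun_eq_iff)
  moreover have "opr i (delta (c \<circ> adj i)) = (\<lambda>d. qh 1 * delta c d)"
    using opr_delta_ascent[of "c \<circ> adj i" i] i by simp
  ultimately have "act (word_elem n c) (delta c0) = (\<lambda>d. qh (int (ninv 1 n (c \<circ> adj i))) * (qh 1 * delta c d))"
    unfolding word_elem_least_descent[OF nz] i_def[symmetric] act_mult' act_gen by simp
  then show ?case
    unfolding l mult.assoc[symmetric] qh_mult by (simp add: add.commute)
qed

lemma act_T_elem_delta_id:
  assumes "w permutes {1..n}"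
  shows "act (T_elem n w) (delta id) = (\<lambda>d. qh (int (plen n w)) * delta (pinv w) d)"
  unfolding T_elem_def plen_def
  by (rule act_word_elem_delta[OF _ _ permutes_inv[OF assms]]) auto

section \<open>Inverses of the basis elements and their leading terms\<close>

definition gen_inv :: "nat \<Rightarrow> free_elem" where
  "gen_inv i = scalar (qh (- 2)) * (gen i - scalar (qh 2 - 1))"

definition word_inv :: "nat list \<Rightarrow> free_elem" where
  "word_inv is = prod_list (map gen_inv (rev is))"

lemma gen_inv_closed [simp]: "1 \<le> i \<Longrightarrow> i < n \<Longrightarrow> gen_inv i \<in> free_carrier n"
  by (simp add: gen_inv_def)

lemma prod_gen_inv_closed: "set is \<subseteq> {1..<n} \<Longrightarrow> prod_list (map gen_inv is) \<in> free_carrier n"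
  by (induction "is") auto

lemma word_inv_closed [simp]: "set is \<subseteq> {1..<n} \<Longrightarrow> word_inv is \<in> free_carrier n"
  by (simp add: word_inv_def prod_gen_inv_closed)

text \<open>The quadratic relation reads T_i (T_i - (q - 1)) = q.\<close>

lemma hcoset_gen_inv:
  assumes "1 \<le> i" "i < n"
  shows "hcoset n (gen i * gen_inv i) = hcoset n 1" "hcoset n (gen_inv i * gen i) = hcoset n 1"
proof -
  have "hcoset n (gen i * (gen i - scalar (qh 2 - 1))) = hcoset n (scalar (qh 2))"
    using hcoset_quadratic[OF assms]
    by (simp add: hcoset_eq_iff right_diff_distrib scalar_commute[of "gen i"] algebra_simps)
  from hcoset_mult_left[OF free_carrier_scalar[of "qh (- 2)"] this]
  have *: "hcoset n (scalar (qh (- 2)) * (gen i * (gen i - scalar (qh 2 - 1)))) = hcoset n 1"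
    by (simp add: scalar_mult[symmetric] qh_mult)
  then show "hcoset n (gen i * gen_inv i) = hcoset n 1"
    by (simp add: gen_inv_def scalar_left_commute)
  have "gen_inv i * gen i = scalar (qh (- 2)) * (gen i * (gen i - scalar (qh 2 - 1)))"
    by (simp add: gen_inv_def mult.assoc left_diff_distrib right_diff_distrib scalar_commute[of "gen i"])
  then show "hcoset n (gen_inv i * gen i) = hcoset n 1"
    using * by simp
qed

lemma hcoset_word_inv:
  "set is \<subseteq> {1..<n} \<Longrightarrow> hcoset n (word is * word_inv is) = hcoset n 1 \<and> hcoset n (word_inv is * word is) = hcoset n 1"
proof (induction "is")
  case Nil
  then show ?case
    by (simp add: word_Nil word_inv_def)
next
  case (Cons i "is")
  then have i: "1 \<le> i" "i < n" and "is": "set is \<subseteq> {1..<n}"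
    by auto
  have e: "word_inv (i # is) = word_inv is * gen_inv i"
    by (simp add: word_inv_def)
  have "hcoset n (gen i * (word is * word_inv is * gen_inv i)) = hcoset n (gen i * (1 * gen_inv i))"
    using Cons.IH i "is" by (intro hcoset_mult_left hcoset_mult_right) auto
  moreover have "hcoset n (word_inv is * (gen_inv i * gen i * word is)) = hcoset n (word_inv is * (1 * word is))"
    using i "is" by (intro hcoset_mult_left hcoset_mult_right hcoset_gen_inv) auto
  ultimately show ?case
    unfolding e word_Cons using hcoset_gen_inv[OF i] Cons.IH "is" by (simp add: mult.assoc)
qed

lemma m_inv_hcoset_word:
  assumes "set is \<subseteq> {1..<n}"
  shows "m_inv (hecke n) (hcoset n (word is)) = hcoset n (word_inv is)"
proof -
  have "monoid (hecke n)"
    using ring_hecke ring.is_monoid by blast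
  from monoid.inv_unique'[OF this, of "hcoset n (word is)" "hcoset n (word_inv is)"]
  show ?thesis
    using assms hcoset_word_inv[OF assms] by (simp add: hcoset_mult hcoset_one)
qed

definition T_inv_elem :: "nat \<Rightarrow> (nat \<Rightarrow> nat) \<Rightarrow> free_elem" where
  "T_inv_elem n w = word_inv (sorting_word n (pinv w))"

lemma T_inv_elem_closed [simp]: "T_inv_elem n w \<in> free_carrier n"
  unfolding T_inv_elem_def by (rule word_inv_closed[OF set_sorting_word])

lemma hcoset_T_inv_elem:
  "hcoset n (T_elem n w * T_inv_elem n w) = hcoset n 1" "hcoset n (T_inv_elem n w * T_elem n w) = hcoset n 1"
  unfolding T_elem_def T_inv_elem_def word_elem_def using hcoset_word_inv[OF set_sorting_word] by blast+

lemma m_inv_T_basis: "w permutes {1..n} \<Longrightarrow> m_inv (hecke n) (T_basis n w) = hcoset n (T_inv_elem n w)"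
  unfolding T_basis_eq T_elem_def T_inv_elem_def word_elem_def by (rule m_inv_hcoset_word[OF set_sorting_word])

lemma apply_adj_transps_rev: "set is \<subseteq> {1..<n} \<Longrightarrow> apply_adj_transps (rev is) = pinv (apply_adj_transps is)"
proof (induction "is")
  case Nil
  show ?case
    unfolding rev.simps apply_adj_transps_Nil inv_id ..
next
  case (Cons i "is")
  then have "bij (apply_adj_transps is)"
    using apply_adj_transps_permutes permutes_bij by auto
  from inv_adj_comp[OF this] show ?case
    using Cons unfolding rev.simps apply_adj_transps_Cons apply_adj_transps_snoc Suc_eq_plus1[symmetric]
    by (metis set_subset_Cons subset_trans)
qed

text \<open>This triangularity for the length is what makes Kazhdan--Lusztig families unique.\<close>

lemma act_prod_gen_inv_delta_id:
  assumes "set js \<subseteq> {1..<n}"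
  defines "G \<equiv> act (prod_list (map gen_inv js)) (delta id)"
  shows "(\<forall>c. G c \<noteq> 0 \<longrightarrow> c permutes {1..n} \<and> ninv 1 n c \<le> length js) \<and>
    (\<forall>c. ninv 1 n c = length js \<longrightarrow>
      G c = (if c = pinv (apply_adj_transps js) then qh (- int (length js)) else 0))"
  using assms(1) unfolding G_def
proof (induction js)
  case Nil
  have "pinv (apply_adj_transps []) = id"
    unfolding apply_adj_transps_Nil by (rule inv_id)
  then show ?case
    using permutes_id[of "{1..n}"] by (simp only: list.map prod_list.Nil act_1) (auto simp: delta_def id_def)
next
  case (Cons i js)
  let ?G = "act (prod_list (map gen_inv js)) (delta id)"
  let ?H = "act (prod_list (map gen_inv (i # js))) (delta id)"
  have i: "1 \<le> i" "i < n" and js: "set js \<subseteq> {1..<n}"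
    using Cons.prems by auto
  have supp: "c permutes {1..n}" "ninv 1 n c \<le> length js" if "?G c \<noteq> 0" for c
    using Cons.IH[OF js] that by blast+
  have top: "?G c = (if c = pinv (apply_adj_transps js) then qh (- int (length js)) else 0)"
    if "ninv 1 n c = length js" for c
    using Cons.IH[OF js] that by blast
  have H: "?H c = qh (- 2) * (opr i ?G c - (qh 2 - 1) * ?G c)" for c
    by (simp add: gen_inv_def act_mult' act_diff act_gen act_scalar)
  have H1: "?H c \<noteq> 0 \<longrightarrow> ?G c \<noteq> 0 \<or> ?G (c \<circ> adj i) \<noteq> 0" for c
    unfolding H by (auto simp: opr_def)
  have "c permutes {1..n} \<and> ninv 1 n c \<le> length (i # js)" if "?H c \<noteq> 0" for c
  proof (cases "?G c \<noteq> 0")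
    case True
    then show ?thesis
      using supp[OF True] by simp
  next
    case False
    then have G: "?G (c \<circ> adj i) \<noteq> 0"
      using H1 that by blast
    have "c = c \<circ> adj i \<circ> adj i"
      by simp
    then show ?thesis
      using supp[OF G] permutes_compose[OF adj_permutes[OF i] supp(1)[OF G]] ninv_adj_le[OF i, of "c \<circ> adj i"]
      by (metis Suc_le_mono le_trans length_Cons)
  qed
  moreover have "?H c = (if c = pinv (apply_adj_transps (i # js)) then qh (- int (length (i # js))) else 0)"
    if l: "ninv 1 n c = length (i # js)" for c
  proof -
    let ?p = "pinv (apply_adj_transps js)"
    have perm: "apply_adj_transps js permutes {1..n}"
      using js apply_adj_transps_permutes by blast
    have e: "pinv (apply_adj_transps (i # js)) = ?p \<circ> adj i"
      using inv_adj_comp[of "apply_adj_transps js" i] permutes_bij[OF perm]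
      unfolding apply_adj_transps_Cons by simp
    have ce: "c = ?p \<circ> adj i \<longleftrightarrow> c \<circ> adj i = ?p"
      by (metis comp_adj_adj)
    have p: "?p permutes {1..n}" "ninv 1 n ?p \<le> length js"
      using permutes_inv[OF perm] ninv_apply_adj_transps_le[OF js] by auto
    have G0: "?G c = 0"
      using supp(2)[of c] l by force
    show ?thesis
    proof (cases "c i" "c (Suc i)" rule: linorder_cases)
      case less
      then have l2: "ninv 1 n (c \<circ> adj i) = Suc (Suc (length js))"
        using ninv_ascent[of 1 i n c] i l by simp
      then have "?G (c \<circ> adj i) = 0"
        using supp(2)[of "c \<circ> adj i"] by force
      then have "?H c = 0"
        using H1 G0 by blast
      moreover have "c \<circ> adj i \<noteq> ?p"
        using l2 p(2) by auto
      ultimately show ?thesis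
        unfolding e ce by simp
    next
      case equal
      then have cc: "c \<circ> adj i = c"
        by (intro comp_adj_eq) simp
      have "?H c = 0"
        using H1[of c] G0 unfolding cc by blast
      moreover have "c \<circ> adj i \<noteq> ?p"
        using l p(2) unfolding cc by auto
      ultimately show ?thesis
        unfolding e ce by simp
    next
      case greater
      then have "ninv 1 n (c \<circ> adj i) = length js"
        using ninv_descent[of 1 i n c] i l by simp
      note t = top[OF this]
      \<comment> \<open>The factor q^(-1) of \<open>gen_inv\<close> and the entry q^(1/2) of
        \<open>opr\<close> leave q^(-1/2) for every letter.\<close>
      have "?H c = qh (- 2) * (qh 1 * ?G (c \<circ> adj i))"
        unfolding H using greater G0 by (simp add: opr_def)
      also have "\<dots> = qh (- 1) * ?G (c \<circ> adj i)"
        unfolding mult.assoc[symmetric] qh_mult by simp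
      finally show ?thesis
        unfolding e ce t by (simp add: qh_mult)
    qed
  qed
  ultimately show ?case
    by blast
qed

text \<open>Evaluation at \<open>pinv u\<close> reads off the coefficient of T_u up to a power of
  q^(1/2). This is the triangularity in the form in which both sides of the bar invariance are
  compared.\<close>

lemma act_T_inv_elem_delta_id:
  assumes v: "v permutes {1..n}" and u: "u permutes {1..n}" and "plen n v \<le> plen n u"
  shows "act (T_inv_elem n (pinv v)) (delta id) (pinv u) = (if u = v then qh (- int (plen n u)) else 0)"
proof -
  define js where "js = rev (sorting_word n v)"
  have vv: "pinv (pinv v) = v"
    using permutes_bij[OF v] by (rule inv_inv_eq)
  have js: "set js \<subseteq> {1..<n}"
    using set_sorting_word by (simp add: js_def)
  have len: "length js = plen n v"
    unfolding js_def length_rev length_sorting_word plen_eq[OF v] ..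
  have "apply_adj_transps (sorting_word n v) = pinv v"
    using apply_sorting_word[OF permutes_inv[OF v]] unfolding vv .
  then have app: "apply_adj_transps js = v"
    unfolding js_def using apply_adj_transps_rev[OF set_sorting_word, of n v] vv by metis
  have G: "T_inv_elem n (pinv v) = prod_list (map gen_inv js)"
    unfolding T_inv_elem_def word_inv_def vv js_def ..
  note * = act_prod_gen_inv_delta_id[OF js, folded G]
  have inj: "pinv u = pinv v \<longleftrightarrow> u = v"
    using permutes_bij[OF u] permutes_bij[OF v] by (metis inv_inv_eq)
  show ?thesis
  proof (cases "plen n v = plen n u")
    case True
    then have "ninv 1 n (pinv u) = length js"
      unfolding len plen_def by simp
    with * have "act (T_inv_elem n (pinv v)) (delta id) (pinv u) =
        (if pinv u = pinv v then qh (- int (length js)) else 0)"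
      unfolding app by blast
    then show ?thesis
      unfolding inj len True .
  next
    case False
    then have "\<not> ninv 1 n (pinv u) \<le> length js"
      using assms(3) unfolding len plen_def by linarith
    with * have "act (T_inv_elem n (pinv v)) (delta id) (pinv u) = 0"
      by blast
    then show ?thesis
      using False by auto
  qed
qed

section \<open>Coefficients of Laurent polynomials\<close>

lemma laurent_expand: "f = (\<Sum>u\<in>Poly_Mapping.keys f. Poly_Mapping.single u (Poly_Mapping.lookup f u))"
  by (rule poly_mapping_eqI)
    (auto simp: lookup_sum lookup_single when_def in_keys_iff sum.delta' split: if_splits)

lemma lookup_qh_mult: "Poly_Mapping.lookup (qh j * f) k = Poly_Mapping.lookup f (k - j)"
proof -
  have "qh j * f = (\<Sum>u\<in>Poly_Mapping.keys f. Poly_Mapping.single (j + u) (Poly_Mapping.lookup f u))"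
    by (subst laurent_expand[of f]) (simp add: sum_distrib_left mult_single)
  then have "Poly_Mapping.lookup (qh j * f) k = (\<Sum>u\<in>Poly_Mapping.keys f. if u = k - j then Poly_Mapping.lookup f u else 0)"
  proof -
    have "j + u = k \<longleftrightarrow> u = k - j" for u
      by auto
    with \<open>qh j * f = _\<close> show ?thesis
      by (simp only: lookup_sum lookup_single when_def)
  qed
  also have "\<dots> = Poly_Mapping.lookup f (k - j)"
    by (auto simp: sum.delta in_keys_iff)
  finally show ?thesis .
qed

lemma at_q_0 [simp]: "at_q 0 = 0"
  by (simp add: at_q_def)

lemma at_q_pCons: "at_q (pCons a p) = Poly_Mapping.single 0 a + qh 2 * at_q p"
  by (cases "a = 0 \<and> p = 0") (auto simp: at_q_def map_poly_pCons single_of_int[symmetric])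

lemma at_q_1 [simp]: "at_q 1 = 1"
  by (simp add: one_pCons at_q_pCons)

lemma lookup_at_q:
  "Poly_Mapping.lookup (at_q p) k = (if 0 \<le> k \<and> even k then poly.coeff p (nat (k div 2)) else 0)"
proof (induction p arbitrary: k)
  case (pCons a p)
  consider "k < 0" | "k = 0" | "k = 1" | "2 \<le> k"
    by linarith
  then show ?case
  proof cases
    case 4
    then have "nat (k div 2) = Suc (nat ((k - 2) div 2))"
      by auto
    with 4 show ?thesis
      by (simp add: at_q_pCons lookup_add lookup_qh_mult lookup_single when_def pCons.IH)
  qed (auto simp: at_q_pCons lookup_add lookup_qh_mult lookup_single when_def pCons.IH)
qed simp

lemma at_q_eq_0_imp: "at_q p = 0 \<Longrightarrow> p = 0"
proof (rule poly_eqI)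
  fix j
  assume "at_q p = 0"
  then have "Poly_Mapping.lookup (at_q p) (2 * int j) = 0"
    by simp
  then show "poly.coeff p j = poly.coeff 0 j"
    by (simp add: lookup_at_q)
qed

lemma at_q_diff: "at_q (p - p') = at_q p - at_q p'"
  by (rule poly_mapping_eqI) (simp add: lookup_at_q lookup_minus)

lemma lookup_bar: "Poly_Mapping.lookup (bar c) k = Poly_Mapping.lookup c (- k)"
  unfolding bar_def by (subst map_key.rep_eq) auto

lemma bar_diff: "bar (c - d) = bar c - bar d"
  by (rule poly_mapping_eqI) (simp add: lookup_bar lookup_minus)

lemma bar_qh: "bar (qh k) = qh (- k)"
  by (rule poly_mapping_eqI) (auto simp: lookup_bar lookup_single when_def)

section \<open>Kazhdan-Lusztig families: uniqueness, and the family of a reversal\<close>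

lemma finsum_hecke:
  assumes "\<And>x. x \<in> A \<Longrightarrow> g x = hcoset n (f x)" "\<And>x. x \<in> A \<Longrightarrow> f x \<in> free_carrier n" "finite A"
  shows "finsum (hecke n) g A = hcoset n (sum f A)"
proof -
  have "abelian_monoid (hecke n)"
    using ring_hecke ring.is_abelian_group abelian_group.axioms(1) by blast
  then have "finsum (hecke n) g A = finsum (hecke n) (\<lambda>x. hcoset n (f x)) A"
    by (rule abelian_monoid.finsum_cong') (use assms in auto)
  then show ?thesis
    using hcoset_finsum[of A f n] assms by simp
qed

lemma finite_bruhat_below [simp]: "finite (bruhat_below n w)"
  by (rule finite_subset[OF _ finite_permutations[of "{1..n}"]]) (auto simp: bruhat_below_def)

lemma kl_basis_hcoset:
  "kl_basis n w = hcoset n (\<Sum>v\<in>bruhat_below n w. scalar (at_q (kl_poly n v w)) * T_elem n v)"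
  unfolding kl_basis_def
proof (rule finsum_hecke)
  fix v assume "v \<in> bruhat_below n w"
  then have "v permutes {1..n}"
    by (simp add: bruhat_below_def)
  then show "at_q (kl_poly n v w) \<odot>\<^bsub>hecke n\<^esub> T_basis n v = hcoset n (scalar (at_q (kl_poly n v w)) * T_elem n v)"
    by (simp only: T_basis_eq hcoset_smult T_elem_closed)
qed auto

lemma kl_family_iff:
  fixes n w
  defines "c \<equiv> (\<lambda>P v. qh (- int (perm_length n w)) * at_q (P v))"
  shows "is_kl_family n w P \<longleftrightarrow>
     P w = 1 \<and>
     (\<forall>v. v \<notin> bruhat_below n w \<longrightarrow> P v = 0) \<and>
     (\<forall>v \<in> bruhat_below n w. v \<noteq> w \<longrightarrow>
        2 * Polynomial.degree (P v) + perm_length n v + 1 \<le> perm_length n w) \<and>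
     hcoset n (\<Sum>v\<in>bruhat_below n w. scalar (c P v) * T_elem n v) =
     hcoset n (\<Sum>v\<in>bruhat_below n w. scalar (bar (c P v)) * T_inv_elem n (pinv v))"
proof -
  have below: "v permutes {1..n}" if "v \<in> bruhat_below n w" for v
    using that by (simp add: bruhat_below_def)
  have 1: "(\<Oplus>\<^bsub>hecke n\<^esub>v\<in>bruhat_below n w. c P v \<odot>\<^bsub>hecke n\<^esub> T_basis n v) =
      hcoset n (\<Sum>v\<in>bruhat_below n w. scalar (c P v) * T_elem n v)"
    by (rule finsum_hecke) (simp_all only: below T_basis_eq hcoset_smult T_elem_closed finite_bruhat_below free_carrier_mult free_carrier_scalar)
  have 2: "(\<Oplus>\<^bsub>hecke n\<^esub>v\<in>bruhat_below n w. bar (c P v) \<odot>\<^bsub>hecke n\<^esub> m_inv (hecke n) (T_basis n (pinv v))) =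
      hcoset n (\<Sum>v\<in>bruhat_below n w. scalar (bar (c P v)) * T_inv_elem n (pinv v))"
  proof (rule finsum_hecke)
    fix v assume "v \<in> bruhat_below n w"
    from permutes_inv[OF below[OF this]]
    show "bar (c P v) \<odot>\<^bsub>hecke n\<^esub> m_inv (hecke n) (T_basis n (pinv v)) =
        hcoset n (scalar (bar (c P v)) * T_inv_elem n (pinv v))"
      by (simp only: m_inv_T_basis hcoset_smult T_inv_elem_closed)
  qed auto
  show ?thesis
    unfolding is_kl_family_def Let_def 1[unfolded c_def] 2[unfolded c_def] c_def ..
qed

text \<open>Descending induction on the length of u. By triangularity, bar invariance at u involves
  only u and longer elements, on which both families already agree. What remains says that
  q^(l(u)/2) times the difference of the two coefficients equals its own bar image. The degree bound
  leaves only negative exponents on one side, hence only positive ones on the other.\<close>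

lemma kl_family_unique:
  assumes w: "w permutes {1..n}" and P: "is_kl_family n w P" and Q: "is_kl_family n w Q"
  shows "P = Q"
proof -
  let ?B = "bruhat_below n w"
  have below: "v permutes {1..n}" if "v \<in> ?B" for v
    using that by (simp add: bruhat_below_def)
  define c where "c P v = qh (- int (perm_length n w)) * at_q (P v)" for P :: "(nat \<Rightarrow> nat) \<Rightarrow> int poly" and v
  note Pf = P[unfolded kl_family_iff] and Qf = Q[unfolded kl_family_iff]
  have len: "perm_length n v \<le> perm_length n w" if "v \<in> ?B" for v
    using Pf that by force
  have pl: "perm_length n v = plen n v" if "v \<in> ?B" for v
    using perm_length_eq_ninv_inv[OF below[OF that]] unfolding plen_def .
  have expand: "c R u * qh (int (plen n u)) =
      (\<Sum>v\<in>?B. bar (c R v) * act (T_inv_elem n (pinv v)) (delta id) (pinv u))"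
    if R: "is_kl_family n w R" and u: "u \<in> ?B" for R u
  proof -
    have "act (\<Sum>v\<in>?B. scalar (c R v) * T_elem n v) (delta id) =
        act (\<Sum>v\<in>?B. scalar (bar (c R v)) * T_inv_elem n (pinv v)) (delta id)"
      using R[unfolded kl_family_iff] unfolding c_def by (intro act_hcoset_cong[where n = n]) blast
    then have "(\<Sum>v\<in>?B. c R v * act (T_elem n v) (delta id) (pinv u)) =
        (\<Sum>v\<in>?B. bar (c R v) * act (T_inv_elem n (pinv v)) (delta id) (pinv u))"
      by (simp add: act_sum act_mult' act_scalar fun_eq_iff)
    moreover have "(\<Sum>v\<in>?B. c R v * act (T_elem n v) (delta id) (pinv u)) =
        (\<Sum>v\<in>?B. if v = u then c R u * qh (int (plen n u)) else 0)"
    proof (rule sum.cong[OF refl])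
      fix v assume v: "v \<in> ?B"
      have "pinv u = pinv v \<longleftrightarrow> u = v"
        using permutes_bij[OF below[OF u]] permutes_bij[OF below[OF v]] by (metis inv_inv_eq)
      then show "c R v * act (T_elem n v) (delta id) (pinv u) = (if v = u then c R u * qh (int (plen n u)) else 0)"
        unfolding act_T_elem_delta_id[OF below[OF v]] delta_def by auto
    qed
    ultimately show ?thesis
      using u by (simp add: sum.delta)
  qed
  have "P u = Q u" if "u \<in> ?B" for u
    using that
  proof (induction "perm_length n w - perm_length n u" arbitrary: u rule: less_induct)
    case less
    show ?case
    proof (cases "u = w")
      case False
      let ?d = "c P u - c Q u" and ?l = "int (plen n u)"
      have "c P u * qh ?l - c Q u * qh ?l =
          (\<Sum>v\<in>?B. (bar (c P v) - bar (c Q v)) * act (T_inv_elem n (pinv v)) (delta id) (pinv u))"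
        unfolding expand[OF P less.prems] expand[OF Q less.prems]
        by (simp add: sum_subtractf left_diff_distrib)
      \<comment> \<open>Longer v drop out by the induction hypothesis, all other v except u by
        triangularity.\<close>
      also have "\<dots> = (\<Sum>v\<in>?B. if v = u then (bar (c P u) - bar (c Q u)) * qh (- ?l) else 0)"
      proof (rule sum.cong[OF refl])
        fix v assume v: "v \<in> ?B"
        show "(bar (c P v) - bar (c Q v)) * act (T_inv_elem n (pinv v)) (delta id) (pinv u) =
            (if v = u then (bar (c P u) - bar (c Q u)) * qh (- ?l) else 0)"
        proof (cases "plen n v \<le> plen n u")
          case True
          show ?thesis
            unfolding act_T_inv_elem_delta_id[OF below[OF v] below[OF less.prems] True] by auto
        next
          case F: False
          then have "perm_length n w - perm_length n v < perm_length n w - perm_length n u"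
            using pl[OF v] pl[OF less.prems] len[OF v] by linarith
          then have "P v = Q v"
            using less.hyps v by blast
          then show ?thesis
            using F by (auto simp: c_def)
        qed
      qed
      also have "\<dots> = bar ?d * qh (- ?l)"
        using less.prems by (simp add: sum.delta bar_diff)
      finally have "?d * qh ?l = bar ?d * qh (- ?l)"
        by (simp add: left_diff_distrib)
      then have eq: "qh ?l * ?d = qh (- ?l) * bar ?d"
        by (simp add: mult.commute)
      have d: "?d = qh (- int (perm_length n w)) * at_q (P u - Q u)"
        by (simp add: c_def at_q_diff right_diff_distrib)
      \<comment> \<open>The degree bound in terms of exponents: \<open>qh ?l * ?d\<close> has no
        coefficient at an exponent k that is at least 0. The 1 in the bound is what excludes k =
        0.\<close>
      have z: "Poly_Mapping.lookup ?d (k - ?l) = 0" if "0 \<le> k" for k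
      proof (rule ccontr)
        assume "Poly_Mapping.lookup ?d (k - ?l) \<noteq> 0"
        then have "Poly_Mapping.lookup (at_q (P u - Q u)) (k - ?l + int (perm_length n w)) \<noteq> 0"
          unfolding d lookup_qh_mult by simp
        then have m: "0 \<le> k - ?l + int (perm_length n w)" "even (k - ?l + int (perm_length n w))"
          "poly.coeff (P u - Q u) (nat ((k - ?l + int (perm_length n w)) div 2)) \<noteq> 0"
          unfolding lookup_at_q by (simp_all split: if_splits)
        define j where "j = nat ((k - ?l + int (perm_length n w)) div 2)"
        have j: "k - ?l + int (perm_length n w) = 2 * int j" "poly.coeff (P u - Q u) j \<noteq> 0"
          using m by (simp_all add: j_def)
        then have "j \<le> Polynomial.degree (P u) \<or> j \<le> Polynomial.degree (Q u)"
          by (metis coeff_diff coeff_eq_0 diff_self not_le)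
        moreover have "2 * Polynomial.degree (P u) + perm_length n u + 1 \<le> perm_length n w"
          "2 * Polynomial.degree (Q u) + perm_length n u + 1 \<le> perm_length n w"
          using Pf Qf less.prems False by blast+
        ultimately show False
          using j(1) pl[OF less.prems] that by linarith
      qed
      have "Poly_Mapping.lookup (qh ?l * ?d) k = 0" for k
      proof (cases "0 \<le> k")
        case True
        then show ?thesis
          unfolding lookup_qh_mult by (rule z)
      next
        case False
        then have "Poly_Mapping.lookup ?d (- k - ?l) = 0"
          by (intro z) simp
        then show ?thesis
          unfolding eq lookup_qh_mult lookup_bar by (simp add: algebra_simps)
      qed
      then have "Poly_Mapping.lookup ?d (k - ?l) = 0" for k
        unfolding lookup_qh_mult .
      from this[of "k + ?l" for k] have "Poly_Mapping.lookup ?d k = 0" for k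
        by simp
      then have "Poly_Mapping.lookup (at_q (P u - Q u)) (k + int (perm_length n w)) = 0" for k
        unfolding d lookup_qh_mult by simp
      from this[of "k - int (perm_length n w)" for k] have "at_q (P u - Q u) = 0"
        by (intro poly_mapping_eqI) simp
      then show ?thesis
        using at_q_eq_0_imp by fastforce
    qed (use Pf Qf in simp)
  qed
  then show ?thesis
    using Pf Qf by (metis ext)
qed

text \<open>Let r be the reversal and X the sum over its subgroup. The lengths of r v and of the
  inverse of v add up to that of r, so the inverse of T at \<open>pinv v\<close> is the inverse of
  T_r times T at r v. Summing over v turns the bar image into the inverse of T_r applied to X, and
  T_r X = q^(l(r)) X since each letter of r contributes q. The prefactors q^(-l(r)/2) and q^(l(r)/2)
  make both sides agree.\<close>

lemma kl_family_reversal: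
  assumes "1 \<le> a" "b \<le> n"
  shows "is_kl_family n (reversal (a, b)) (\<lambda>v. if v permutes {a..b} then 1 else 0)"
    (is "is_kl_family n ?r ?P")
proof -
  have B: "bruhat_below n ?r = {v. v permutes {a..b}}"
    by (rule bruhat_below_reversal[OF assms])
  have pn: "v permutes {1..n}" if "v permutes {a..b}" for v
    using permutes_interval_mono[OF that assms] .
  have len: "perm_length n v = ninv a b v" "plen n v = ninv a b v" "plen n (pinv v) = ninv a b v" if "v permutes {a..b}" for v
  proof -
    show "perm_length n v = ninv a b v" "plen n v = ninv a b v"
      using perm_length_eq_ninv_inv[OF pn[OF that]] plen_interval[OF that assms] unfolding plen_def by simp_all
    show "plen n (pinv v) = ninv a b v"
      using plen_interval[OF permutes_inv[OF that] assms] ninv_inv[OF that] by simp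
  qed
  note rp = reversal_permutes[of a b]
  let ?l = "int (ninv a b ?r)" and ?X = "parabolic_sum n (a, b)" and ?S = "{v. v permutes {a..b}}"
  \<comment> \<open>For the constant polynomial 1 the degree bound only says that the reversal alone
    has maximal length.\<close>
  have deg: "ninv a b v + 1 \<le> ninv a b ?r" if "v permutes {a..b}" "v \<noteq> ?r" for v
  proof (rule ccontr)
    assume "\<not> ?thesis"
    then have "ninv a b (?r \<circ> v) = 0"
      using ninv_reversal_comp[OF that(1)] by linarith
    moreover have rv: "(?r \<circ> v) permutes {a..b}"
      using that(1) rp by (rule permutes_compose)
    ultimately have "?r \<circ> v = id"
      using plen_0_id[OF pn[OF rv]] len(2)[OF rv] by simp
    then show False
      using that(2) by (metis comp_id reversal_comp_cancel)
  qed
  have inv: "hcoset n (T_inv_elem n (pinv v)) = hcoset n (T_inv_elem n ?r * T_elem n (?r \<circ> v))" if v: "v permutes {a..b}" for v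
  proof -
    have rv: "(?r \<circ> v) permutes {a..b}"
      using v rp by (rule permutes_compose)
    have e: "(?r \<circ> v) \<circ> pinv v = ?r"
      using permutes_inv_o(1)[OF v] by (simp add: comp_assoc)
    have "plen n ((?r \<circ> v) \<circ> pinv v) = plen n (?r \<circ> v) + plen n (pinv v)"
      unfolding e using len(2)[OF rv] len(2)[OF rp] len(3)[OF v] ninv_reversal_comp[OF v] by simp
    from T_elem_mult[OF pn[OF rv] permutes_inv[OF pn[OF v]] this]
    have m: "hcoset n (T_elem n (?r \<circ> v) * T_elem n (pinv v)) = hcoset n (T_elem n ?r)"
      unfolding e .
    let ?y = "T_inv_elem n (pinv v)"
    have "hcoset n ?y = hcoset n (1 * ?y)"
      by simp
    also have "\<dots> = hcoset n (T_inv_elem n ?r * T_elem n ?r * ?y)"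
      using hcoset_T_inv_elem(2)[of n ?r] by (intro hcoset_mult_right) auto
    also have "\<dots> = hcoset n (T_inv_elem n ?r * (T_elem n (?r \<circ> v) * T_elem n (pinv v)) * ?y)"
      using m by (intro hcoset_mult_right hcoset_mult_left) auto
    also have "\<dots> = hcoset n (T_inv_elem n ?r * T_elem n (?r \<circ> v) * (T_elem n (pinv v) * ?y))"
      by (simp add: mult.assoc)
    also have "\<dots> = hcoset n (T_inv_elem n ?r * T_elem n (?r \<circ> v) * 1)"
      using hcoset_T_inv_elem(1)[of n "pinv v"] by (intro hcoset_mult_left) auto
    finally show ?thesis
      by simp
  qed
  have bij: "bij_betw (\<lambda>v. ?r \<circ> v) ?S ?S"
    by (rule bij_betw_byWitness[where f' = "\<lambda>v. ?r \<circ> v"])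
      (use rp in \<open>auto simp: comp_assoc[symmetric] intro: permutes_compose\<close>)
  have "hcoset n (\<Sum>v\<in>?S. T_inv_elem n (pinv v)) = hcoset n (\<Sum>v\<in>?S. T_inv_elem n ?r * T_elem n (?r \<circ> v))"
    by (intro hcoset_sum_cong inv) auto
  also have "(\<Sum>v\<in>?S. T_inv_elem n ?r * T_elem n (?r \<circ> v)) = T_inv_elem n ?r * ?X"
    unfolding sum_distrib_left[symmetric] parabolic_sum_def fst_conv snd_conv
    using sum.reindex_bij_betw[OF bij, of "T_elem n"] by metis
  also have "hcoset n (T_inv_elem n ?r * ?X) = hcoset n (scalar (qh (- 2 * ?l)) * ?X)"
  proof -
    have pr: "pinv ?r = ?r"
      using inv_unique_comp[OF reversal_reversal reversal_reversal] .
    have "hcoset n (T_elem n ?r * ?X) = hcoset n (scalar (qh (2 * int (length (sorting_word n ?r)))) * ?X)"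
      unfolding T_elem_def word_elem_def pr
      by (rule word_parabolic_sum[OF assms set_sorting_word_interval[OF rp]])
    also have "length (sorting_word n ?r) = ninv a b ?r"
      unfolding length_sorting_word using inversions_interval[OF rp assms] by (simp add: ninv_def)
    finally have *: "hcoset n (T_elem n ?r * ?X) = hcoset n (scalar (qh (2 * ?l)) * ?X)" .
    \<comment> \<open>Inserted powers of q cancel; the positive one is then absorbed as T_r X, where
      T_r meets its inverse.\<close>
    have "hcoset n (T_inv_elem n ?r * ?X) = hcoset n (T_inv_elem n ?r * (scalar (qh (- 2 * ?l)) * (scalar (qh (2 * ?l)) * ?X)))"
      unfolding mult.assoc[of "scalar (qh (- 2 * ?l))" "scalar (qh (2 * ?l))", symmetric] scalar_mult[symmetric] qh_mult by simp
    also have "\<dots> = hcoset n (T_inv_elem n ?r * (scalar (qh (- 2 * ?l)) * (T_elem n ?r * ?X)))"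
      using * by (intro hcoset_mult_left) auto
    also have "\<dots> = hcoset n (scalar (qh (- 2 * ?l)) * (T_inv_elem n ?r * T_elem n ?r * ?X))"
      by (simp add: scalar_left_commute mult.assoc)
    also have "\<dots> = hcoset n (scalar (qh (- 2 * ?l)) * (1 * ?X))"
      using hcoset_T_inv_elem(2)[of n ?r] by (intro hcoset_mult_left hcoset_mult_right) auto
    finally show ?thesis
      by simp
  qed
  finally have main: "hcoset n (\<Sum>v\<in>?S. T_inv_elem n (pinv v)) = hcoset n (scalar (qh (- 2 * ?l)) * ?X)" .
  have "hcoset n (\<Sum>v\<in>?S. scalar (qh (- ?l)) * T_elem n v) = hcoset n (\<Sum>v\<in>?S. scalar (qh ?l) * T_inv_elem n (pinv v))"
  proof -
    have "hcoset n (scalar (qh ?l) * (\<Sum>v\<in>?S. T_inv_elem n (pinv v))) = hcoset n (scalar (qh ?l) * (scalar (qh (- 2 * ?l)) * ?X))"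
      using main by (intro hcoset_mult_left) auto
    then show ?thesis
      unfolding mult.assoc[symmetric] scalar_mult[symmetric] qh_mult
      by (simp add: sum_distrib_left parabolic_sum_def)
  qed
  then have "hcoset n (\<Sum>v\<in>?S. scalar (qh (- int (perm_length n ?r)) * at_q (?P v)) * T_elem n v) =
     hcoset n (\<Sum>v\<in>?S. scalar (bar (qh (- int (perm_length n ?r)) * at_q (?P v))) * T_inv_elem n (pinv v))"
  proof -
    have "(\<Sum>v\<in>?S. scalar (qh (- int (perm_length n ?r)) * at_q (?P v)) * T_elem n v) =
        (\<Sum>v\<in>?S. scalar (qh (- ?l)) * T_elem n v)"
      "(\<Sum>v\<in>?S. scalar (bar (qh (- int (perm_length n ?r)) * at_q (?P v))) * T_inv_elem n (pinv v)) =
        (\<Sum>v\<in>?S. scalar (qh ?l) * T_inv_elem n (pinv v))"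
      unfolding len(1)[OF rp] by (auto intro!: sum.cong simp: bar_qh)
    with \<open>hcoset n (\<Sum>v\<in>?S. scalar (qh (- ?l)) * T_elem n v) = _\<close> show ?thesis
      by (simp only:)
  qed
  then show ?thesis
    using rp deg by (subst kl_family_iff) (simp_all add: B len(1) del: One_nat_def)
qed

lemma kl_basis_reversal:
  assumes "1 \<le> a" "b \<le> n"
  shows "kl_basis n (reversal (a, b)) = hcoset n (parabolic_sum n (a, b))"
proof -
  let ?r = "reversal (a, b)"
  have "?r permutes {1..n}"
    using permutes_interval_mono[OF reversal_permutes assms] .
  then have "(THE P. is_kl_family n ?r P) = (\<lambda>v. if v permutes {a..b} then 1 else 0)"
    using kl_family_reversal[OF assms] kl_family_unique by (intro the_equality) blast+
  then have "kl_poly n v ?r = (if v permutes {a..b} then 1 else 0)" for v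
    unfolding kl_poly_def by simp
  then show ?thesis
    unfolding kl_basis_hcoset bruhat_below_reversal[OF assms] parabolic_sum_def
    by (intro arg_cong[of _ _ "hcoset n"] sum.cong) auto
qed

section \<open>The action of a product of parabolic sums\<close>

text \<open>Here the argument c rather than the function meets only ascents: when c increases along
  every inversion of d, each operator in the sorting word of d is evaluated in its off-diagonal
  branch, which consists of one term.\<close>

lemma act_word_elem_row:
  assumes "u permutes {1..n}" "d = pinv u" "\<And>i j. 1 \<le> i \<Longrightarrow> i < j \<Longrightarrow> j \<le> n \<Longrightarrow> d j < d i \<Longrightarrow> c i < c j"
  shows "act (word_elem n d) F c = qh (int (ninv 1 n d)) * F (c \<circ> u)"
  using assms
proof (induction "ninv 1 n d" arbitrary: c d u)
  case 0
  then have "u = id"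
    using plen_0_id[of u n] unfolding plen_def by metis
  then have d: "d = id"
    using "0.prems"(2) inv_id by metis
  show ?case
    unfolding \<open>u = id\<close> d by (simp only: ninv_id word_elem_sorted act_1 comp_id) simp
next
  case (Suc k)
  have nz: "ninv 1 n d \<noteq> 0"
    using Suc.hyps(2) by simp
  define i where "i = least_descent n d"
  have i: "1 \<le> i" "i < n" "d (Suc i) < d i"
    using least_descent[OF nz] by (auto simp: i_def)
  have l: "ninv 1 n d = Suc (ninv 1 n (d \<circ> adj i))"
    using i by (rule ninv_descent)
  have p: "(adj i \<circ> u) permutes {1..n}"
    using Suc.prems(1) i by (intro adj_comp_permutes)
  have e: "d \<circ> adj i = pinv (adj i \<circ> u)"
    unfolding Suc.prems(2) using inv_adj_comp[OF permutes_bij[OF Suc.prems(1)]] by metis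
  have "act (word_elem n (d \<circ> adj i)) F (c \<circ> adj i) = qh (int (ninv 1 n (d \<circ> adj i))) * F ((c \<circ> adj i) \<circ> (adj i \<circ> u))"
  proof (rule Suc.hyps(1)[OF _ p e])
    show "k = ninv 1 n (d \<circ> adj i)"
      using Suc.hyps(2) l by simp
    fix x y assume xy: "1 \<le> x" "x < y" "y \<le> n" "(d \<circ> adj i) y < (d \<circ> adj i) x"
    have "\<not> (x = i \<and> y = Suc i)"
      using xy(4) i(3) by auto
    then have "adj i x < adj i y" "1 \<le> adj i x" "adj i y \<le> n"
      using xy i by (auto simp: Transposition.transpose_def)
    then show "(c \<circ> adj i) x < (c \<circ> adj i) y"
      using Suc.prems(3) xy(4) by simp
  qed
  moreover have "(c \<circ> adj i) \<circ> (adj i \<circ> u) = c \<circ> u"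
    by (simp add: fun_eq_iff)
  moreover have "c i < c (Suc i)"
    using Suc.prems(3)[of i "Suc i"] i by simp
  ultimately have "act (word_elem n d) F c = qh 1 * (qh (int (ninv 1 n (d \<circ> adj i))) * F (c \<circ> u))"
    unfolding word_elem_least_descent[OF nz] i_def[symmetric] act_mult' act_gen opr_def by simp
  then show ?case
    unfolding l mult.assoc[symmetric] qh_mult by (simp add: add.commute)
qed

lemma act_parabolic_sum_increasing:
  assumes "1 \<le> a" "b \<le> n" and incr: "\<And>i j. a \<le> i \<Longrightarrow> i < j \<Longrightarrow> j \<le> b \<Longrightarrow> c i < c j"
  shows "act (parabolic_sum n (a, b)) F c = (\<Sum>v | v permutes {a..b}. qh (int (ninv a b (c \<circ> v))) * F (c \<circ> v))"
  unfolding parabolic_sum_def act_sum fst_conv snd_conv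
proof (rule sum.cong[OF refl])
  fix v assume "v \<in> {v. v permutes {a..b}}"
  then have v: "v permutes {a..b}"
    by simp
  note vn = permutes_interval_mono[OF v assms(1,2)] and iv = permutes_inv[OF v]
  have "act (T_elem n v) F c = qh (int (ninv 1 n (pinv v))) * F (c \<circ> v)"
    unfolding T_elem_def
  proof (rule act_word_elem_row[OF vn refl])
    fix i j assume "1 \<le> i" "i < j" "j \<le> n" "pinv v j < pinv v i"
    then have "(i, j) \<in> inversions 1 n (pinv v)"
      by (simp add: inversions_def)
    then show "c i < c j"
      unfolding inversions_interval[OF iv assms(1,2)] using incr by (auto simp: inversions_def)
  qed
  moreover have "ninv 1 n (pinv v) = ninv a b v"
    using plen_interval[OF v assms(1,2)] unfolding plen_def .
  moreover have "ninv a b (c \<circ> v) = ninv a b v"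
  proof -
    have "(c \<circ> v) j < (c \<circ> v) i \<longleftrightarrow> v j < v i" if "a \<le> i" "i < j" "j \<le> b" for i j
      using incr[of "v i" "v j"] incr[of "v j" "v i"] permutes_interval_bounds[OF v, of i]
        permutes_interval_bounds[OF v, of j] that
      by (cases "v i" "v j" rule: linorder_cases) auto
    then have "inversions a b (c \<circ> v) = inversions a b v"
      by (auto simp: inversions_def)
    then show ?thesis
      by (simp add: ninv_def)
  qed
  ultimately show "act (T_elem n v) F c = qh (int (ninv a b (c \<circ> v))) * F (c \<circ> v)"
    by simp
qed

text \<open>By \<open>gen_parabolic_sum\<close> the function obtained is an eigenvector of T_i for
  q. Comparing with the definition of \<open>opr\<close> gives -G c = q G c at equal neighbours, and
  a proportionality between G at c and at its swap for distinct ones.\<close>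

lemma
  assumes "1 \<le> a" "b \<le> n" "a \<le> i" "i < b"
  shows act_parabolic_sum_equal: "c i = c (Suc i) \<Longrightarrow> act (parabolic_sum n (a, b)) F c = 0"
    and act_parabolic_sum_descent: "c (Suc i) < c i \<Longrightarrow>
      act (parabolic_sum n (a, b)) F c = qh 1 * act (parabolic_sum n (a, b)) F (c \<circ> adj i)"
proof -
  let ?G = "act (parabolic_sum n (a, b)) F"
  have eig: "opr i ?G d = qh 2 * ?G d" for d
    using act_hcoset_cong[OF gen_parabolic_sum[OF assms], of F] by (simp add: act_mult' act_gen act_scalar fun_eq_iff)
  show "?G c = 0" if "c i = c (Suc i)"
  proof -
    have "(1 + qh 2) * ?G c = 0"
      using eig[of c] that by (simp add: opr_def distrib_right) (metis add.right_inverse)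
    moreover have "Poly_Mapping.lookup (1 + qh 2) 0 \<noteq> 0"
      by (simp add: lookup_add lookup_single)
    then have "1 + qh 2 \<noteq> 0"
      by (metis lookup_zero)
    ultimately show ?thesis
      by (metis mult_eq_0_iff)
  qed
  show "?G c = qh 1 * ?G (c \<circ> adj i)" if "c (Suc i) < c i"
  proof -
    have "qh 1 * ?G c = qh 2 * ?G (c \<circ> adj i)"
      using eig[of "c \<circ> adj i"] that by (simp add: opr_def)
    then have "qh (- 1) * (qh 1 * ?G c) = qh (- 1) * (qh 2 * ?G (c \<circ> adj i))"
      by simp
    then show ?thesis
      unfolding mult.assoc[symmetric] qh_mult by simp
  qed
qed

text \<open>Descents of c inside a..b are removed one by one, each for a factor q^(1/2), until c
  increases on a..b, where the row is known, or shows two equal neighbours, where it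
  vanishes.\<close>

lemma act_parabolic_sum:
  assumes "1 \<le> a" "b \<le> n"
  shows "act (parabolic_sum n (a, b)) F c = (if inj_on c {a..b}
    then \<Sum>v | v permutes {a..b}. qh (int (ninv a b c + ninv a b (c \<circ> v))) * F (c \<circ> v) else 0)"
proof (induction "ninv a b c" arbitrary: c rule: less_induct)
  case less
  let ?G = "act (parabolic_sum n (a, b)) F"
  show ?case
  proof (cases "\<exists>i. a \<le> i \<and> i < b \<and> c (Suc i) < c i")
    case True
    then obtain i where i: "a \<le> i" "i < b" "c (Suc i) < c i"
      by blast
    let ?d = "c \<circ> adj i"
    have l: "ninv a b c = Suc (ninv a b ?d)"
      using i by (rule ninv_descent)
    have adj: "adj i permutes {a..b}"
      using i by (intro adj_permutes)
    have inj: "inj_on ?d {a..b} \<longleftrightarrow> inj_on c {a..b}"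
      using inj_on_imageI2 comp_inj_on permutes_inj_on[OF adj] permutes_image[OF adj]
      by (metis comp_adj_adj)
    have "(\<Sum>v | v permutes {a..b}. qh 1 * (qh (int (ninv a b ?d + ninv a b (?d \<circ> v))) * F (?d \<circ> v))) =
        (\<Sum>v | v permutes {a..b}. qh (int (ninv a b c + ninv a b (c \<circ> v))) * F (c \<circ> v))"
    proof (rule sum.reindex_bij_witness[where i = "\<lambda>v. adj i \<circ> v" and j = "\<lambda>v. adj i \<circ> v"])
      fix v :: "nat \<Rightarrow> nat"
      have "?d \<circ> v = c \<circ> (adj i \<circ> v)"
        by (simp add: comp_assoc)
      then show "qh (int (ninv a b c + ninv a b (c \<circ> (adj i \<circ> v)))) * F (c \<circ> (adj i \<circ> v)) =
          qh 1 * (qh (int (ninv a b ?d + ninv a b (?d \<circ> v))) * F (?d \<circ> v))"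
        unfolding mult.assoc[symmetric] qh_mult l by (simp add: algebra_simps)
    qed (use adj in \<open>auto intro: permutes_compose\<close>)
    then show ?thesis
      using act_parabolic_sum_descent[OF assms i, of F] less[of ?d] l inj
      by (simp add: sum_distrib_left)
  next
    case False
    then have mono: "c i \<le> c (Suc i)" if "a \<le> i" "i < b" for i
      using that by (metis not_le)
    show ?thesis
    proof (cases "inj_on c {a..b}")
      case True
      have incr: "c i < c j" if "a \<le> i" "i < j" "j \<le> b" for i j
        using no_descent_mono[of a b c i j] mono inj_onD[OF True, of i j] that by force
      have "?G c = (\<Sum>v | v permutes {a..b}. qh (int (ninv a b (c \<circ> v))) * F (c \<circ> v))"
        by (rule act_parabolic_sum_increasing[OF assms]) (rule incr)
      moreover have "ninv a b c = 0"
        by (rule no_descent_ninv_0) (rule mono)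
      ultimately show ?thesis
        using True by simp
    next
      case F: False
      then obtain i j where ij: "a \<le> i" "i < j" "j \<le> b" "c i = c j"
        unfolding inj_on_def by (metis atLeastAtMost_iff linorder_neqE_nat)
      then have "c i \<le> c (Suc i)" "c (Suc i) \<le> c j"
        using no_descent_mono[of a b c "Suc i" j] mono[of i] mono by auto
      then have "c i = c (Suc i)"
        using ij(4) by linarith
      from act_parabolic_sum_equal[OF assms _ _ this] show ?thesis
        using F ij by simp
    qed
  qed
qed

section \<open>Chains of words and the expansion of a product of parabolic sums\<close>

definition star_step :: "nat \<times> nat \<Rightarrow> (nat \<Rightarrow> nat) \<Rightarrow> (nat \<Rightarrow> nat) \<Rightarrow> bool" where
  "star_step J c c' \<longleftrightarrow> inj_on c {fst J..snd J} \<and> (\<exists>v. v permutes {fst J..snd J} \<and> c' = c \<circ> v)"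

definition step_weight :: "nat \<times> nat \<Rightarrow> (nat \<Rightarrow> nat) \<Rightarrow> (nat \<Rightarrow> nat) \<Rightarrow> nat" where
  "step_weight J c c' = ninv (fst J) (snd J) c + ninv (fst J) (snd J) c'"

fun star_chains :: "(nat \<times> nat) list \<Rightarrow> (nat \<Rightarrow> nat) \<Rightarrow> (nat \<Rightarrow> nat) list set" where
  "star_chains [] c = {[c]}"
| "star_chains (J # Js) c = (\<Union>c'\<in>{c'. star_step J c c'}. (#) c ` star_chains Js c')"

fun chain_weight :: "(nat \<times> nat) list \<Rightarrow> (nat \<Rightarrow> nat) list \<Rightarrow> nat" where
  "chain_weight (J # Js) (c # c' # cs) = step_weight J c c' + chain_weight Js (c' # cs)"
| "chain_weight _ _ = 0"

lemma chains_hd: "cs \<in> star_chains Js c \<Longrightarrow> \<exists>cs'. cs = c # cs'"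
  by (cases Js) auto

lemma finite_star_step: "finite {c'. star_step J c c'}"
proof (rule finite_subset)
  show "{c'. star_step J c c'} \<subseteq> (\<lambda>v. c \<circ> v) ` {v. v permutes {fst J..snd J}}"
    by (auto simp: star_step_def)
  show "finite ((\<lambda>v. c \<circ> v) ` {v. v permutes {fst J..snd J}})"
    by (simp add: finite_permutations)
qed

lemma finite_chains [simp]: "finite (star_chains Js c)"
  by (induction Js arbitrary: c) (simp_all add: finite_star_step)

text \<open>The letters of c on J are distinct, so different permutations of J give different words,
  and the sum over permutations becomes a sum over words.\<close>

lemma act_parabolic_sum_star_step:
  assumes "1 \<le> fst J" "snd J \<le> n"
  shows "act (parabolic_sum n J) F c = (\<Sum>c' | star_step J c c'. qh (int (step_weight J c c')) * F c')"
proof (cases "inj_on c {fst J..snd J}")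
  case True
  let ?S = "{v. v permutes {fst J..snd J}}"
  have img: "{c'. star_step J c c'} = (\<lambda>v. c \<circ> v) ` ?S"
    using True by (auto simp: star_step_def)
  have "inj_on (\<lambda>v. c \<circ> v) ?S"
  proof (rule inj_onI)
    fix v v' assume v: "v \<in> ?S" "v' \<in> ?S" "c \<circ> v = c \<circ> v'"
    show "v = v'"
    proof
      fix x
      show "v x = v' x"
      proof (cases "x \<in> {fst J..snd J}")
        case x: True
        have "v x \<in> {fst J..snd J}" "v' x \<in> {fst J..snd J}"
          using v(1,2) x permutes_in_image by fastforce+
        moreover have "c (v x) = c (v' x)"
          using v(3) by (simp add: fun_eq_iff)
        ultimately show ?thesis
          using inj_onD[OF True] by blast
      next
        case False
        then show ?thesis
          using v(1,2) by (metis mem_Collect_eq permutes_not_in)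
      qed
    qed
  qed
  then show ?thesis
    unfolding img using act_parabolic_sum[of "fst J" "snd J" n F c] True assms
    by (simp add: sum.reindex step_weight_def)
next
  case False
  then have "{c'. star_step J c c'} = {}"
    by (auto simp: star_step_def)
  then show ?thesis
    using act_parabolic_sum[of "fst J" "snd J" n F c] False assms by simp
qed

lemma act_prod_parabolic_sum:
  assumes "\<forall>J\<in>set Js. 1 \<le> fst J \<and> snd J \<le> n"
  shows "act (prod_list (map (parabolic_sum n) Js)) F c = (\<Sum>cs\<in>star_chains Js c. qh (int (chain_weight Js cs)) * F (last cs))"
  using assms
proof (induction Js arbitrary: c)
  case (Cons J Js)
  have ch: "chain_weight (J # Js) (c # cs) = step_weight J c c' + chain_weight Js cs" "last (c # cs) = last cs"
    if "cs \<in> star_chains Js c'" for cs c'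
    using chains_hd[OF that] by auto
  have "act (prod_list (map (parabolic_sum n) (J # Js))) F c =
      (\<Sum>c' | star_step J c c'. qh (int (step_weight J c c')) * act (prod_list (map (parabolic_sum n) Js)) F c')"
    using Cons.prems by (simp add: act_mult' act_parabolic_sum_star_step)
  also have "\<dots> = (\<Sum>c' | star_step J c c'. \<Sum>cs\<in>star_chains Js c'. qh (int (chain_weight (J # Js) (c # cs))) * F (last (c # cs)))"
  proof (rule sum.cong[OF refl])
    fix c' assume "c' \<in> {c'. star_step J c c'}"
    have "qh (int (step_weight J c c')) * (\<Sum>cs\<in>star_chains Js c'. qh (int (chain_weight Js cs)) * F (last cs)) =
        (\<Sum>cs\<in>star_chains Js c'. qh (int (chain_weight (J # Js) (c # cs))) * F (last (c # cs)))"
      unfolding sum_distrib_left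
    proof (rule sum.cong[OF refl])
      fix cs assume "cs \<in> star_chains Js c'"
      note h = ch[OF this]
      show "qh (int (step_weight J c c')) * (qh (int (chain_weight Js cs)) * F (last cs)) =
          qh (int (chain_weight (J # Js) (c # cs))) * F (last (c # cs))"
        unfolding h mult.assoc[symmetric] qh_mult by simp
    qed
    then show "qh (int (step_weight J c c')) * act (prod_list (map (parabolic_sum n) Js)) F c' =
        (\<Sum>cs\<in>star_chains Js c'. qh (int (chain_weight (J # Js) (c # cs))) * F (last (c # cs)))"
      using Cons by simp
  qed
  also have "\<dots> = (\<Sum>c' | star_step J c c'. \<Sum>cs\<in>(#) c ` star_chains Js c'. qh (int (chain_weight (J # Js) cs)) * F (last cs))"
    by (simp add: sum.reindex)
  also have "\<dots> = (\<Sum>cs\<in>star_chains (J # Js) c. qh (int (chain_weight (J # Js) cs)) * F (last cs))"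
    unfolding star_chains.simps
    by (rule sum.UNION_disjoint[symmetric]) (auto simp: finite_star_step dest!: chains_hd)
  finally show ?case .
qed simp

lemma star_step_refl: "inj c \<Longrightarrow> star_step J c c"
  unfolding star_step_def by (auto intro: inj_on_subset exI[of _ id] simp: permutes_id)

lemma constant_chain: "inj c \<Longrightarrow> replicate (Suc (length Js)) c \<in> star_chains Js c"
proof (induction Js)
  case (Cons J Js)
  then show ?case
    using star_step_refl[OF Cons.prems, of J] by (auto intro!: exI[of _ c])
qed simp

text \<open>All coefficients are non-negative, and the one at \<open>k x0\<close> is positive:
  nothing can cancel.\<close>

lemma sum_qh_nonzero:
  assumes "finite A" "A \<noteq> {}"
  shows "(\<Sum>x\<in>A. qh (k x)) \<noteq> 0"
proof
  assume "(\<Sum>x\<in>A. qh (k x)) = 0"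
  obtain x0 where "x0 \<in> A"
    using assms(2) by blast
  have "Poly_Mapping.lookup (\<Sum>x\<in>A. qh (k x)) (k x0) = (\<Sum>x\<in>A. if k x = k x0 then 1 else 0)"
    by (auto simp: lookup_sum lookup_single when_def intro!: sum.cong)
  also have "\<dots> > 0"
    using assms(1) \<open>x0 \<in> A\<close> by (intro sum_pos2[of _ x0]) auto
  finally show False
    using \<open>(\<Sum>x\<in>A. qh (k x)) = 0\<close> by simp
qed

text \<open>The diagonal matrix entry at the word \<open>id\<close> is a sum of powers of q^(1/2)
  over chains from \<open>id\<close> to \<open>id\<close>, and the constant chain is one of
  them.\<close>

lemma prod_parabolic_sum_nonzero:
  assumes "\<forall>J\<in>set Js. 1 \<le> fst J \<and> snd J \<le> n"
  shows "hcoset n (prod_list (map (parabolic_sum n) Js)) \<noteq> hcoset n 0"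
proof
  assume "hcoset n (prod_list (map (parabolic_sum n) Js)) = hcoset n 0"
  from act_hcoset_cong[OF this, of "delta id"]
  have "act (prod_list (map (parabolic_sum n) Js)) (delta id) id = 0"
    by simp
  then have "(\<Sum>cs\<in>star_chains Js id. if last cs = id then qh (int (chain_weight Js cs)) else 0) = 0"
    unfolding act_prod_parabolic_sum[OF assms] delta_def by (simp add: if_distrib cong: if_cong)
  then have "(\<Sum>cs\<in>{cs \<in> star_chains Js id. last cs = id}. qh (int (chain_weight Js cs))) = 0"
    by (simp add: sum.inter_filter)
  moreover have "replicate (Suc (length Js)) id \<in> {cs \<in> star_chains Js id. last cs = id}"
    using constant_chain[of id Js] inj_on_id by (simp add: last_replicate del: replicate_Suc)
  then have "{cs \<in> star_chains Js id. last cs = id} \<noteq> {}"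
    by blast
  ultimately show False
    using sum_qh_nonzero[of "{cs \<in> star_chains Js id. last cs = id}" "\<lambda>cs. int (chain_weight Js cs)"] by simp
qed

section \<open>The induced sign module\<close>

text \<open>The sign character as the action on the function values at a constant word.\<close>

definition sgn_val :: "free_elem \<Rightarrow> laurent" where
  "sgn_val f = act f (\<lambda>_. 1) (\<lambda>_. 0)"

lemma act_diff_fun: "act (f - g) F = (\<lambda>c. act f F c - act g F c)"
  and act_uminus_fun: "act (- f) F = (\<lambda>c. - act f F c)"
  by (simp_all add: fun_eq_iff act_diff act_uminus)

text \<open>A swap does not change a constant word, so every operator only multiplies the value
  there by -1 and evaluation makes the action scalar.\<close>

lemma act_constant_word: "act f F (\<lambda>_. 0) = sgn_val f * F (\<lambda>_. 0)"
proof -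
  have "foldr opr is F (\<lambda>_. 0) = (- 1) ^ length is * F (\<lambda>_. 0)" for "is" F
    by (induction "is") (simp_all add: opr_def)
  then show ?thesis
    by (simp add: sgn_val_def act_def sum_distrib_right mult.assoc)
qed

lemma sgn_val_mult: "sgn_val (f * g) = sgn_val f * sgn_val g"
  unfolding sgn_val_def act_mult by (simp add: act_constant_word flip: sgn_val_def)

lemma sgn_val_add: "sgn_val (f + g) = sgn_val f + sgn_val g"
  by (simp add: sgn_val_def act_add)

lemma sgn_val_uminus: "sgn_val (- f) = - sgn_val f"
  by (simp add: sgn_val_def act_uminus)

lemma sgn_val_scalar: "sgn_val (scalar c) = c"
  by (simp add: sgn_val_def act_scalar)

lemma sgn_val_1: "sgn_val 1 = 1"
  by (simp add: sgn_val_def)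

lemma sgn_val_gen: "sgn_val (gen i) = - 1"
  by (simp add: sgn_val_def act_gen opr_def)

lemma sgn_val_cong: "hcoset n f = hcoset n g \<Longrightarrow> sgn_val f = sgn_val g"
  using act_hcoset_cong[of n f g "\<lambda>_. 1"] unfolding sgn_val_def by simp

section \<open>The parabolic subalgebra and its sign character\<close>

lemma parabolic_generators_subset:
  "T_gen n ` parabolic_indices n lam \<union> range (\<lambda>c. c \<odot>\<^bsub>hecke n\<^esub> \<one>\<^bsub>hecke n\<^esub>) \<subseteq> carrier (hecke n)"
  by (auto simp: T_gen_eq parabolic_indices_def hcoset_one hcoset_smult)

lemma parabolic_subalgebra_subset: "parabolic_subalgebra n lam \<subseteq> carrier (hecke n)"
  unfolding parabolic_subalgebra_def
  by (rule ring.generate_ring_incl[OF ring_hecke parabolic_generators_subset])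

lemma parabolic_subalgebra_gen: "i \<in> parabolic_indices n lam \<Longrightarrow> hcoset n (gen i) \<in> parabolic_subalgebra n lam"
  unfolding parabolic_subalgebra_def by (auto intro: generate_ring.incl simp: T_gen_eq)

lemma parabolic_subalgebra_scalar: "hcoset n (scalar c) \<in> parabolic_subalgebra n lam"
proof -
  have "hcoset n (scalar c) = c \<odot>\<^bsub>hecke n\<^esub> \<one>\<^bsub>hecke n\<^esub>"
    by (simp add: hcoset_one hcoset_smult)
  then show ?thesis
    unfolding parabolic_subalgebra_def by (auto intro: generate_ring.incl)
qed

text \<open>\<open>generate_ring\<close> is an induction over cosets. It is transferred to
  representatives, and the case \<open>cong\<close> accounts for the change of
  representative.\<close>

lemma parabolic_subalgebra_induct [consumes 2, case_names one scalar gen uminus add mult cong]: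
  assumes "hcoset n f \<in> parabolic_subalgebra n lam" "f \<in> free_carrier n"
    and one: "P 1" and scalar: "\<And>c. P (scalar c)"
    and gen: "\<And>i. i \<in> parabolic_indices n lam \<Longrightarrow> P (gen i)"
    and uminus: "\<And>f. f \<in> free_carrier n \<Longrightarrow> hcoset n f \<in> parabolic_subalgebra n lam \<Longrightarrow> P f \<Longrightarrow> P (- f)"
    and add: "\<And>f g. f \<in> free_carrier n \<Longrightarrow> g \<in> free_carrier n \<Longrightarrow> hcoset n f \<in> parabolic_subalgebra n lam \<Longrightarrow>
      hcoset n g \<in> parabolic_subalgebra n lam \<Longrightarrow> P f \<Longrightarrow> P g \<Longrightarrow> P (f + g)"
    and mult: "\<And>f g. f \<in> free_carrier n \<Longrightarrow> g \<in> free_carrier n \<Longrightarrow> hcoset n f \<in> parabolic_subalgebra n lam \<Longrightarrow>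
      hcoset n g \<in> parabolic_subalgebra n lam \<Longrightarrow> P f \<Longrightarrow> P g \<Longrightarrow> P (f * g)"
    and cong: "\<And>f g. hcoset n f = hcoset n g \<Longrightarrow> P f \<Longrightarrow> P g"
  shows "P f"
proof -
  let ?H = "T_gen n ` parabolic_indices n lam \<union> range (\<lambda>c. c \<odot>\<^bsub>hecke n\<^esub> \<one>\<^bsub>hecke n\<^esub>)"
  have "\<exists>f\<in>free_carrier n. x = hcoset n f \<and> P f" if "x \<in> generate_ring (hecke n) ?H" for x
    using that
  proof (induction rule: generate_ring.induct)
    case one
    show ?case
      using assms(3) by (intro bexI[of _ 1]) (auto simp: hcoset_one)
  next
    case (incl h)
    then consider i where "i \<in> parabolic_indices n lam" "h = hcoset n (gen i)" | c where "h = hcoset n (scalar c)"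
      by (auto simp: T_gen_eq hcoset_one hcoset_smult)
    then show ?case
      by cases (use gen scalar in \<open>auto simp: parabolic_indices_def\<close>)
  next
    case (a_inv h)
    then obtain f where "f \<in> free_carrier n" "h = hcoset n f" "P f"
      by blast
    with a_inv show ?case
      by (intro bexI[of _ "- f"]) (auto simp: hcoset_a_inv parabolic_subalgebra_def intro: uminus)
  next
    case (eng_add h1 h2)
    then obtain f g where "f \<in> free_carrier n" "h1 = hcoset n f" "P f" "g \<in> free_carrier n" "h2 = hcoset n g" "P g"
      by blast
    with eng_add show ?case
      by (intro bexI[of _ "f + g"]) (auto simp: hcoset_add parabolic_subalgebra_def intro: add)
  next
    case (eng_mult h1 h2)
    then obtain f g where "f \<in> free_carrier n" "h1 = hcoset n f" "P f" "g \<in> free_carrier n" "h2 = hcoset n g" "P g"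
      by blast
    with eng_mult show ?case
      by (intro bexI[of _ "f * g"]) (auto simp: hcoset_mult parabolic_subalgebra_def intro: mult)
  qed
  then obtain g where "g \<in> free_carrier n" "hcoset n f = hcoset n g" "P g"
    using assms(1) unfolding parabolic_subalgebra_def by blast
  then show ?thesis
    using cong by metis
qed

lemma laurent_ring_sel [simp]:
  "carrier laurent_ring = UNIV" "x \<otimes>\<^bsub>laurent_ring\<^esub> y = x * y" "x \<oplus>\<^bsub>laurent_ring\<^esub> y = x + y"
  "\<one>\<^bsub>laurent_ring\<^esub> = 1" "\<zero>\<^bsub>laurent_ring\<^esub> = 0"
  by (auto simp: ring_of_type_algebra_def)

lemma parabolic_subalgebra_closed:
  assumes "x \<in> parabolic_subalgebra n lam" "y \<in> parabolic_subalgebra n lam"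
  shows "x \<oplus>\<^bsub>hecke n\<^esub> y \<in> parabolic_subalgebra n lam" "x \<otimes>\<^bsub>hecke n\<^esub> y \<in> parabolic_subalgebra n lam"
    "\<one>\<^bsub>hecke n\<^esub> \<in> parabolic_subalgebra n lam"
  using assms unfolding parabolic_subalgebra_def by (auto intro: generate_ring.intros)

text \<open>\<open>sgn_val\<close> is constant on cosets and multiplicative, so it descends to a
  character of the subalgebra. Any other candidate agrees with it by induction over the generators,
  which settles the definite description.\<close>

lemma sgn_char_eq:
  assumes f: "f \<in> free_carrier n" "hcoset n f \<in> parabolic_subalgebra n lam"
  shows "sgn_char n lam (hcoset n f) = sgn_val f"
proof -
  let ?A = "parabolic_subalgebra n lam"
  let ?R = "(hecke n)\<lparr>carrier := ?A\<rparr>"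
  define P where "P = (\<lambda>\<chi>. \<chi> \<in> ring_hom ?R laurent_ring \<and> \<chi> \<in> extensional ?A \<and>
     (\<forall>c. \<chi> (c \<odot>\<^bsub>hecke n\<^esub> \<one>\<^bsub>hecke n\<^esub>) = c) \<and> (\<forall>i\<in>parabolic_indices n lam. \<chi> (T_gen n i) = -1))"
  define \<chi> where "\<chi> = restrict (\<lambda>x. sgn_val (SOME f. f \<in> free_carrier n \<and> hcoset n f = x)) ?A"
  have \<chi>: "\<chi> (hcoset n f) = sgn_val f" if "f \<in> free_carrier n" "hcoset n f \<in> ?A" for f
  proof -
    have "hcoset n (SOME g. g \<in> free_carrier n \<and> hcoset n g = hcoset n f) = hcoset n f"
      using that(1) by (metis (mono_tags, lifting) someI)
    from sgn_val_cong[OF this] show ?thesis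
      using that(2) by (simp add: \<chi>_def)
  qed
  have rep: "\<exists>f\<in>free_carrier n. x = hcoset n f" if "x \<in> ?A" for x
    using that parabolic_subalgebra_subset by (blast elim: hecke_elemE)
  have "P \<chi>"
    unfolding P_def
  proof (intro conjI allI ballI)
    show "\<chi> \<in> ring_hom ?R laurent_ring"
    proof (rule ring_hom_memI)
      fix x y assume xy: "x \<in> carrier ?R" "y \<in> carrier ?R"
      then obtain f g where fg: "f \<in> free_carrier n" "x = hcoset n f" "g \<in> free_carrier n" "y = hcoset n g"
        using rep by auto metis
      then show "\<chi> (x \<otimes>\<^bsub>?R\<^esub> y) = \<chi> x \<otimes>\<^bsub>laurent_ring\<^esub> \<chi> y" "\<chi> (x \<oplus>\<^bsub>?R\<^esub> y) = \<chi> x \<oplus>\<^bsub>laurent_ring\<^esub> \<chi> y"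
        using xy parabolic_subalgebra_closed[of x n lam y]
        by (simp_all add: hcoset_mult hcoset_add \<chi> sgn_val_mult sgn_val_add)
    next
      show "\<chi> \<one>\<^bsub>?R\<^esub> = \<one>\<^bsub>laurent_ring\<^esub>"
        using \<chi>[of 1] parabolic_subalgebra_scalar[of n 1 lam] by (simp add: hcoset_one sgn_val_1)
    qed simp
    show "\<chi> \<in> extensional ?A"
      by (simp add: \<chi>_def)
    show "\<chi> (c \<odot>\<^bsub>hecke n\<^esub> \<one>\<^bsub>hecke n\<^esub>) = c" for c
      using \<chi>[OF free_carrier_scalar parabolic_subalgebra_scalar, of c] by (simp add: hcoset_one hcoset_smult sgn_val_scalar)
    show "\<chi> (T_gen n i) = - 1" if "i \<in> parabolic_indices n lam" for i
      using \<chi>[OF _ parabolic_subalgebra_gen[OF that]] that by (simp add: T_gen_eq sgn_val_gen parabolic_indices_def)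
  qed
  moreover have "\<chi>' = \<chi>" if "P \<chi>'" for \<chi>'
  proof (rule extensionalityI[of _ ?A])
    note \<chi>' = that[unfolded P_def]
    have hom: "\<chi>' \<in> ring_hom ?R laurent_ring" and sc: "\<chi>' (hcoset n (scalar c)) = c"
      and ge: "i \<in> parabolic_indices n lam \<Longrightarrow> \<chi>' (hcoset n (gen i)) = - 1" for c i
      using \<chi>' by (auto simp: hcoset_one hcoset_smult T_gen_eq)
    have val: "\<chi>' (hcoset n f) = sgn_val f" if "hcoset n f \<in> ?A" "f \<in> free_carrier n" for f
      using that
    proof (induction rule: parabolic_subalgebra_induct)
      case one
      show ?case
        using sc[of 1] by (simp add: sgn_val_1)
    next
      case (uminus f)
      have "- f = scalar (- 1) * f"
        by (simp add: scalar_uminus)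
      then show ?case
        using uminus ring_hom_mult[OF hom, of "hcoset n (scalar (- 1))" "hcoset n f"] sc[of "- 1"] parabolic_subalgebra_scalar
        by (simp add: hcoset_mult sgn_val_mult sgn_val_scalar)
    next
      case (add f g)
      then show ?case
        using ring_hom_add[OF hom, of "hcoset n f" "hcoset n g"] by (simp add: hcoset_add sgn_val_add)
    next
      case (mult f g)
      then show ?case
        using ring_hom_mult[OF hom, of "hcoset n f" "hcoset n g"] by (simp add: hcoset_mult sgn_val_mult)
    next
      case (cong f g)
      then show ?case
        using sgn_val_cong by metis
    qed (use sc ge in \<open>auto simp: sgn_val_scalar sgn_val_gen\<close>)
    show "\<chi>' x = \<chi> x" if "x \<in> ?A" for x
      using rep[OF that] val \<chi> that by metis
  qed (use that in \<open>auto simp: P_def \<chi>_def\<close>)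
  ultimately have "(THE \<chi>. P \<chi>) = \<chi>"
    by (rule the_equality)
  then have "sgn_char n lam = \<chi>"
    unfolding sgn_char_def P_def .
  then show ?thesis
    using \<chi>[OF f] by simp
qed

lemma induced_generator:
  assumes "f \<in> free_carrier n" "g \<in> free_carrier n" "hcoset n g \<in> parabolic_subalgebra n lam"
  shows "(hcoset n f \<otimes>\<^bsub>hecke n\<^esub> hcoset n g) \<ominus>\<^bsub>hecke n\<^esub> (sgn_char n lam (hcoset n g) \<odot>\<^bsub>hecke n\<^esub> hcoset n f) =
    hcoset n (f * g - scalar (sgn_val g) * f)"
  using assms by (simp add: sgn_char_eq hcoset_mult hcoset_smult hcoset_minus)

section \<open>The balancing relations\<close>

definition induced_kernel :: "nat \<Rightarrow> nat list \<Rightarrow> free_elem set" where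
  "induced_kernel n lam = {f \<in> free_carrier n. hcoset n f \<in> induced_relations n lam}"

lemma induced_relations_induct [consumes 1, case_names zero rel uminus add]:
  assumes "x \<in> induced_relations n lam"
    and "P \<zero>\<^bsub>hecke n\<^esub>"
    and "\<And>f g. f \<in> free_carrier n \<Longrightarrow> g \<in> free_carrier n \<Longrightarrow> hcoset n g \<in> parabolic_subalgebra n lam \<Longrightarrow>
      P (hcoset n (f * g - scalar (sgn_val g) * f))"
    and "\<And>f g. f \<in> free_carrier n \<Longrightarrow> g \<in> free_carrier n \<Longrightarrow> hcoset n g \<in> parabolic_subalgebra n lam \<Longrightarrow>
      P (hcoset n (- (f * g - scalar (sgn_val g) * f)))"
    and "\<And>x y. x \<in> induced_relations n lam \<Longrightarrow> y \<in> induced_relations n lam \<Longrightarrow> P x \<Longrightarrow> P y \<Longrightarrow> P (x \<oplus>\<^bsub>hecke n\<^esub> y)"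
  shows "P x"
  using assms(1) unfolding induced_relations_def
proof (induction rule: generate.induct)
  case one
  then show ?case
    using assms(2) by simp
next
  case (incl x)
  then obtain h a where ha: "h \<in> carrier (hecke n)" "a \<in> parabolic_subalgebra n lam"
    "x = (h \<otimes>\<^bsub>hecke n\<^esub> a) \<ominus>\<^bsub>hecke n\<^esub> (sgn_char n lam a \<odot>\<^bsub>hecke n\<^esub> h)"
    by blast
  moreover obtain f g where "f \<in> free_carrier n" "h = hcoset n f" "g \<in> free_carrier n" "a = hcoset n g"
    using ha parabolic_subalgebra_subset by (metis hecke_elemE subsetD)
  ultimately show ?case
    using induced_generator assms(3) by metis
next
  case (inv x)
  then obtain h a where ha: "h \<in> carrier (hecke n)" "a \<in> parabolic_subalgebra n lam"
    "x = (h \<otimes>\<^bsub>hecke n\<^esub> a) \<ominus>\<^bsub>hecke n\<^esub> (sgn_char n lam a \<odot>\<^bsub>hecke n\<^esub> h)"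
    by blast
  moreover obtain f g where fg: "f \<in> free_carrier n" "h = hcoset n f" "g \<in> free_carrier n" "a = hcoset n g"
    using ha parabolic_subalgebra_subset by (metis hecke_elemE subsetD)
  ultimately have "x = hcoset n (f * g - scalar (sgn_val g) * f)"
    using induced_generator by metis
  then have "inv\<^bsub>add_monoid (hecke n)\<^esub> x = hcoset n (- (f * g - scalar (sgn_val g) * f))"
    using fg hcoset_a_inv[of "f * g - scalar (sgn_val g) * f" n] by (simp add: a_inv_def)
  then show ?case
    using assms(4) fg ha by metis
next
  case (eng x y)
  then show ?case
    using assms(5) by (simp add: induced_relations_def)
qed

lemma additive_subgroup_induced_relations: "additive_subgroup (induced_relations n lam) (hecke n)"
proof (rule additive_subgroupI)
  have "group (add_monoid (hecke n))"
    using abelian_group.a_group[OF ring.is_abelian_group[OF ring_hecke]] .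
  moreover have "{(h \<otimes>\<^bsub>hecke n\<^esub> a) \<ominus>\<^bsub>hecke n\<^esub> (sgn_char n lam a \<odot>\<^bsub>hecke n\<^esub> h) | h a.
        h \<in> carrier (hecke n) \<and> a \<in> parabolic_subalgebra n lam} \<subseteq> carrier (add_monoid (hecke n))"
  proof clarify
    fix h a assume ha: "h \<in> carrier (hecke n)" "a \<in> parabolic_subalgebra n lam"
    obtain f g where "f \<in> free_carrier n" "h = hcoset n f" "g \<in> free_carrier n" "a = hcoset n g"
      using ha parabolic_subalgebra_subset by (metis hecke_elemE subsetD)
    then show "(h \<otimes>\<^bsub>hecke n\<^esub> a) \<ominus>\<^bsub>hecke n\<^esub> (sgn_char n lam a \<odot>\<^bsub>hecke n\<^esub> h) \<in> carrier (add_monoid (hecke n))"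
      using induced_generator ha by simp
  qed
  ultimately show "subgroup (induced_relations n lam) (add_monoid (hecke n))"
    unfolding induced_relations_def by (rule group.generate_is_subgroup)
qed

lemma abelian_subgroup_induced_relations: "abelian_subgroup (induced_relations n lam) (hecke n)"
  using abelian_subgroupI3[OF additive_subgroup_induced_relations ring.is_abelian_group[OF ring_hecke]] .

lemma induced_kernel_rel:
  assumes "f \<in> free_carrier n" "g \<in> free_carrier n" "hcoset n g \<in> parabolic_subalgebra n lam"
  shows "f * g - scalar (sgn_val g) * f \<in> induced_kernel n lam"
proof -
  have "hcoset n (f * g - scalar (sgn_val g) * f) \<in> induced_relations n lam"
    unfolding induced_relations_def induced_generator[OF assms, symmetric]
    using assms hcoset_closed by (intro generate.incl) blast
  then show ?thesis
    using assms by (simp add: induced_kernel_def)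
qed

text \<open>Left multiplication by h turns the relation for the pair f, g into the relation for h f,
  g. Hence the Hecke algebra acts on the quotient.\<close>

lemma induced_relations_mult:
  assumes "x \<in> induced_relations n lam" "h \<in> free_carrier n"
  shows "hcoset n h \<otimes>\<^bsub>hecke n\<^esub> x \<in> induced_relations n lam"
proof -
  have neg: "hcoset n (- f) \<in> induced_relations n lam" if "f \<in> induced_kernel n lam" for f
    using that additive_subgroup.a_inv_closed[OF additive_subgroup_induced_relations, of "hcoset n f" n lam]
    by (simp add: induced_kernel_def hcoset_a_inv)
  show ?thesis
    using assms(1)
  proof (induction rule: induced_relations_induct)
    case zero
    then show ?case
      using assms(2) additive_subgroup.zero_closed[OF additive_subgroup_induced_relations, of n lam]
      by (simp add: hcoset_zero hcoset_mult)
  next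
    case (rel f g)
    then have "h * f * g - scalar (sgn_val g) * (h * f) \<in> induced_kernel n lam"
      using assms(2) by (intro induced_kernel_rel) auto
    moreover have "h * f * g - scalar (sgn_val g) * (h * f) = h * (f * g - scalar (sgn_val g) * f)"
      by (simp add: right_diff_distrib mult.assoc scalar_left_commute)
    ultimately show ?case
      using rel assms(2) by (simp add: induced_kernel_def hcoset_mult)
  next
    case (uminus f g)
    then have "h * f * g - scalar (sgn_val g) * (h * f) \<in> induced_kernel n lam"
      using assms(2) by (intro induced_kernel_rel) auto
    moreover have "h * f * g - scalar (sgn_val g) * (h * f) = h * (f * g - scalar (sgn_val g) * f)"
      by (simp add: right_diff_distrib mult.assoc scalar_left_commute)
    ultimately have "hcoset n (- (h * (f * g - scalar (sgn_val g) * f))) \<in> induced_relations n lam"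
      using neg by metis
    moreover have "- (h * (f * g - scalar (sgn_val g) * f)) = h * (- (f * g - scalar (sgn_val g) * f))"
      by (rule mult_minus_right[symmetric])
    ultimately show ?case
      using uminus assms(2) hcoset_mult[of h n "- (f * g - scalar (sgn_val g) * f)"] by simp
  next
    case (add x y)
    then have "x \<in> carrier (hecke n)" "y \<in> carrier (hecke n)"
      using additive_subgroup.a_subset[OF additive_subgroup_induced_relations] by blast+
    then show ?case
      using add.IH assms(2) additive_subgroup.a_closed[OF additive_subgroup_induced_relations]
      by (simp add: ring.ring_simprules(23)[OF ring_hecke])
  qed
qed

lemma induced_kernel_mult: "h \<in> free_carrier n \<Longrightarrow> f \<in> induced_kernel n lam \<Longrightarrow> h * f \<in> induced_kernel n lam"
  using induced_relations_mult[of "hcoset n f" n lam h] by (simp add: induced_kernel_def hcoset_mult)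

text \<open>At the indices of the subalgebra c0 has equal neighbours, so each generator acts on
  \<open>delta c0\<close> by -1 and the whole subalgebra acts by its sign. Therefore the map that
  sends f to \<open>act f (delta c0)\<close> kills the balancing relations and is defined on the
  induced module; it will provide the coordinates there.\<close>

lemma induced_kernel_act:
  assumes mem: "f \<in> induced_kernel n lam"
    and inv: "\<And>i. i \<in> parabolic_indices n lam \<Longrightarrow> c0 (Suc i) = c0 i"
  shows "act f (delta c0) = (\<lambda>_. 0)"
proof -
  \<comment> \<open>A word with distinct letters at i and i+1 is not c0, and neither is its swap, so
    both sides vanish there.\<close>
  have gen: "opr i (delta c0) d = - delta c0 d" if "c0 (Suc i) = c0 i" for i d
  proof (cases "d (Suc i) = d i")
    case False
    then have "d \<noteq> c0"
      using that by auto
    moreover have "d \<circ> adj i \<noteq> c0"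
      using \<open>d \<noteq> c0\<close> comp_adj_eq[OF that] comp_adj_adj[of d i] by metis
    ultimately show ?thesis
      using False by (simp add: opr_def delta_def)
  qed (simp add: opr_def)
  have A: "act g (delta c0) = (\<lambda>d. sgn_val g * delta c0 d)"
    if "hcoset n g \<in> parabolic_subalgebra n lam" "g \<in> free_carrier n" for g
    using that
  proof (induction rule: parabolic_subalgebra_induct)
    case (mult f g)
    show ?case
      unfolding act_mult' mult.IH(2) by (rule ext) (simp only: act_scale mult.IH(1) sgn_val_mult mult.left_commute mult.assoc)
  next
    case (cong f g)
    then show ?case
      using act_hcoset_cong[OF cong(1)] sgn_val_cong[OF cong(1)] by simp
  qed (simp_all add: fun_eq_iff act_add act_uminus act_scalar act_gen gen inv sgn_val_1 sgn_val_scalar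
      sgn_val_gen sgn_val_add sgn_val_uminus algebra_simps)
  have "\<exists>f\<in>free_carrier n. x = hcoset n f \<and> act f (delta c0) = (\<lambda>_. 0)" if "x \<in> induced_relations n lam" for x
    using that
  proof (induction rule: induced_relations_induct)
    case zero
    show ?case
      by (intro bexI[of _ 0]) (auto simp: hcoset_zero)
  next
    case (rel f g)
    then have "act (f * g - scalar (sgn_val g) * f) (delta c0) = (\<lambda>_. 0)"
      unfolding act_diff_fun by (simp only: act_mult' A) (simp add: act_scale act_scalar)
    then show ?case
      using rel by (intro bexI[of _ "f * g - scalar (sgn_val g) * f"]) auto
  next
    case (uminus f g)
    then have "act (- (f * g - scalar (sgn_val g) * f)) (delta c0) = (\<lambda>_. 0)"
      unfolding act_uminus_fun act_diff_fun by (simp only: act_mult' A) (simp add: act_scale act_scalar)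
    then show ?case
      using uminus by (intro bexI[of _ "- (f * g - scalar (sgn_val g) * f)"]) auto
  next
    case (add x y)
    then obtain f g where "f \<in> free_carrier n" "x = hcoset n f" "act f (delta c0) = (\<lambda>_. 0)"
      "g \<in> free_carrier n" "y = hcoset n g" "act g (delta c0) = (\<lambda>_. 0)"
      by blast
    then show ?case
      by (intro bexI[of _ "f + g"]) (auto simp: hcoset_add act_add fun_eq_iff)
  qed
  then obtain g where "hcoset n f = hcoset n g" "act g (delta c0) = (\<lambda>_. 0)"
    using mem by (auto simp: induced_kernel_def)
  then show ?thesis
    using act_hcoset_cong by metis
qed

section \<open>The quotient module and its operations\<close>

definition icoset :: "nat \<Rightarrow> nat list \<Rightarrow> free_elem \<Rightarrow> free_elem set set" where
  "icoset n lam f = induced_relations n lam +>\<^bsub>hecke n\<^esub> hcoset n f"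

lemma icoset_eq_iff:
  assumes "f \<in> free_carrier n" "g \<in> free_carrier n"
  shows "icoset n lam f = icoset n lam g \<longleftrightarrow> f - g \<in> induced_kernel n lam"
proof -
  interpret abelian_subgroup "induced_relations n lam" "hecke n"
    by (rule abelian_subgroup_induced_relations)
  have "icoset n lam f = icoset n lam g \<longleftrightarrow> hcoset n f \<in> icoset n lam g"
    unfolding icoset_def using assms a_repr_independence' a_rcos_self by (metis hcoset_closed)
  also have "\<dots> \<longleftrightarrow> hcoset n f \<ominus>\<^bsub>hecke n\<^esub> hcoset n g \<in> induced_relations n lam"
    unfolding icoset_def using assms a_rcos_module_minus[OF ring_hecke] by simp
  finally show ?thesis
    using assms by (simp add: hcoset_minus induced_kernel_def)
qed

lemma icoset_hcoset_cong: "hcoset n f = hcoset n g \<Longrightarrow> icoset n lam f = icoset n lam g"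
  by (simp add: icoset_def)

lemma icoset_add:
  "f \<in> free_carrier n \<Longrightarrow> g \<in> free_carrier n \<Longrightarrow> icoset n lam f <+>\<^bsub>hecke n\<^esub> icoset n lam g = icoset n lam (f + g)"
  using abelian_subgroup.a_rcos_sum[OF abelian_subgroup_induced_relations, of "hcoset n f" n "hcoset n g" lam]
  by (simp add: icoset_def hcoset_add)

lemma icoset_mult_left:
  assumes "h \<in> free_carrier n" "f \<in> free_carrier n" "g \<in> free_carrier n" "icoset n lam f = icoset n lam g"
  shows "icoset n lam (h * f) = icoset n lam (h * g)"
  using assms induced_kernel_mult[of h n "f - g" lam] by (simp add: icoset_eq_iff right_diff_distrib)

lemma icoset_elem:
  assumes "f \<in> free_carrier n" "x \<in> icoset n lam f"
  obtains g where "g \<in> free_carrier n" "x = hcoset n g" "icoset n lam g = icoset n lam f"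
proof -
  interpret abelian_subgroup "induced_relations n lam" "hecke n"
    by (rule abelian_subgroup_induced_relations)
  have "x \<in> carrier (hecke n)"
    using assms a_elemrcos_carrier unfolding icoset_def by (metis hcoset_closed)
  then obtain g where g: "g \<in> free_carrier n" "x = hcoset n g"
    by (rule hecke_elemE)
  moreover have "icoset n lam f = icoset n lam g"
    unfolding icoset_def using assms g a_repr_independence' unfolding icoset_def by (metis hcoset_closed)
  ultimately show ?thesis
    using that by metis
qed

lemma icoset_self: "f \<in> free_carrier n \<Longrightarrow> hcoset n f \<in> icoset n lam f"
  unfolding icoset_def by (rule abelian_subgroup.a_rcos_self[OF abelian_subgroup_induced_relations]) simp

text \<open>Scalar multiplication and action are defined as unions over the members of a coset. Such
  a union collapses once all members yield the same coset.\<close>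

lemma UN_icoset:
  assumes "f \<in> free_carrier n" "\<And>g. g \<in> free_carrier n \<Longrightarrow> icoset n lam g = icoset n lam f \<Longrightarrow> F (hcoset n g) = y"
  shows "(\<Union>x\<in>icoset n lam f. F x) = y"
proof -
  have "F x = y" if "x \<in> icoset n lam f" for x
    using icoset_elem[OF assms(1) that] assms(2) by metis
  moreover have "icoset n lam f \<noteq> {}"
    using icoset_self[OF assms(1)] by blast
  ultimately show ?thesis
    by auto
qed

lemma induced_module_sel:
  "carrier (induced_module n lam) = icoset n lam ` free_carrier n"
  "x \<oplus>\<^bsub>induced_module n lam\<^esub> y = x <+>\<^bsub>hecke n\<^esub> y"
  "\<zero>\<^bsub>induced_module n lam\<^esub> = icoset n lam 0"
proof -
  show "carrier (induced_module n lam) = icoset n lam ` free_carrier n"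
    by (auto simp: induced_module_def A_RCOSETS_def RCOSETS_def icoset_def a_r_coset_def elim!: hecke_elemE
        intro: bexI[OF _ hcoset_closed])
  show "\<zero>\<^bsub>induced_module n lam\<^esub> = icoset n lam 0"
  proof -
    interpret abelian_subgroup "induced_relations n lam" "hecke n"
      by (rule abelian_subgroup_induced_relations)
    show ?thesis
      using a_coset_add_zero[OF a_subset] by (simp add: induced_module_def icoset_def hcoset_zero)
  qed
qed (simp add: induced_module_def)

lemma induced_module_add:
  "f \<in> free_carrier n \<Longrightarrow> g \<in> free_carrier n \<Longrightarrow>
    icoset n lam f \<oplus>\<^bsub>induced_module n lam\<^esub> icoset n lam g = icoset n lam (f + g)"
  by (simp add: induced_module_sel icoset_add)

lemma induced_module_smult:
  assumes "f \<in> free_carrier n"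
  shows "c \<odot>\<^bsub>induced_module n lam\<^esub> icoset n lam f = icoset n lam (scalar c * f)"
proof -
  have "(\<Union>x\<in>icoset n lam f. induced_relations n lam +>\<^bsub>hecke n\<^esub> (c \<odot>\<^bsub>hecke n\<^esub> x)) = icoset n lam (scalar c * f)"
  proof (rule UN_icoset[OF assms])
    fix g assume g: "g \<in> free_carrier n" "icoset n lam g = icoset n lam f"
    then show "induced_relations n lam +>\<^bsub>hecke n\<^esub> (c \<odot>\<^bsub>hecke n\<^esub> hcoset n g) = icoset n lam (scalar c * f)"
      using icoset_mult_left[OF free_carrier_scalar g(1) assms g(2), of c]
      by (simp add: hcoset_smult flip: icoset_def)
  qed
  then show ?thesis
    by (simp add: induced_module_def)
qed

lemma induced_action_icoset:
  assumes "f \<in> free_carrier n" "h \<in> free_carrier n"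
  shows "induced_action n lam (hcoset n h) (icoset n lam f) = icoset n lam (h * f)"
  unfolding induced_action_def
proof (rule UN_icoset[OF assms(1)])
  fix g assume g: "g \<in> free_carrier n" "icoset n lam g = icoset n lam f"
  then show "induced_relations n lam +>\<^bsub>hecke n\<^esub> (hcoset n h \<otimes>\<^bsub>hecke n\<^esub> hcoset n g) = icoset n lam (h * f)"
    using icoset_mult_left[OF assms(2) g(1) assms(1) g(2)] assms
    by (simp add: hcoset_mult flip: icoset_def)
qed

lemma abelian_monoid_induced_module: "abelian_monoid (induced_module n lam)"
  by (rule abelian_monoidI)
    (auto simp: induced_module_sel(1,3) induced_module_add add_ac)

lemma finsum_induced_module:
  assumes "finite A" "\<And>x. x \<in> A \<Longrightarrow> f x \<in> free_carrier n" "\<And>x. x \<in> A \<Longrightarrow> g x = icoset n lam (f x)"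
  shows "finsum (induced_module n lam) g A = icoset n lam (sum f A)"
  using assms
proof (induction A)
  case empty
  show ?case
    by (simp add: abelian_monoid.finsum_empty[OF abelian_monoid_induced_module] induced_module_sel)
next
  case (insert x A)
  then show ?case
    by (subst abelian_monoid.finsum_insert[OF abelian_monoid_induced_module])
      (auto simp: induced_module_sel(1) induced_module_add)
qed

lemma finsum_laurent: "finite A \<Longrightarrow> finsum laurent_ring f A = sum f A"
proof (induction A rule: finite_induct)
  case empty
  show ?case
    by (simp add: finsum_def finprod_def)
next
  case (insert x A)
  have "abelian_monoid laurent_ring"
    using ring_from_type_algebra ring.is_abelian_group abelian_group.axioms(1) by blast
  then show ?case
    using insert by (subst abelian_monoid.finsum_insert) auto
qed

section \<open>A basis of the induced module indexed by words\<close>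

definition rearrangements :: "nat \<Rightarrow> (nat \<Rightarrow> nat) \<Rightarrow> (nat \<Rightarrow> nat) set" where
  "rearrangements n c0 = (\<lambda>u. c0 \<circ> u) ` {u. u permutes {1..n}}"

lemma finite_rearrangements [simp]: "finite (rearrangements n c0)"
  by (auto simp: rearrangements_def finite_permutations)

lemma rearrangements_comp: "c \<in> rearrangements n c0 \<Longrightarrow> u permutes {1..n} \<Longrightarrow> c \<circ> u \<in> rearrangements n c0"
  using permutes_compose unfolding rearrangements_def by (fastforce simp: comp_assoc)

lemma rearrangements_adj: "c \<in> rearrangements n c0 \<Longrightarrow> 1 \<le> i \<Longrightarrow> i < n \<Longrightarrow> c \<circ> adj i \<in> rearrangements n c0"
  by (intro rearrangements_comp adj_permutes) auto

lemma rearrangements_self: "c0 \<in> rearrangements n c0"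
  unfolding rearrangements_def using permutes_id by (auto intro!: image_eqI[of _ _ id])

text \<open>All that is used of the partition: c0 is weakly increasing, and its equal neighbours sit
  exactly at the indices of the parabolic subalgebra.\<close>

locale sorted_word =
  fixes n :: nat and lam :: "nat list" and c0 :: "nat \<Rightarrow> nat"
  assumes mono: "\<And>i. 1 \<le> i \<Longrightarrow> i < n \<Longrightarrow> c0 i \<le> c0 (Suc i)"
    and parab: "parabolic_indices n lam = {i \<in> {1..<n}. c0 (Suc i) = c0 i}"
begin

abbreviation "W \<equiv> rearrangements n c0"

abbreviation "K \<equiv> icoset n lam"

lemma sorted_rearrangement:
  assumes "c \<in> W" "ninv 1 n c = 0"
  shows "c = c0"
proof -
  obtain u where u: "u permutes {1..n}" "c = c0 \<circ> u"
    using assms(1) by (auto simp: rearrangements_def)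
  have "c0 \<circ> u = c0"
  proof (rule no_descent_unique[where a = 1 and b = n])
    show "c0 (u i) \<le> c0 (u (Suc i))" if "1 \<le> i" "i < n" for i
      using ninv_eq_0_no_descent[of 1 n c i] that assms(2) u by simp
  qed (use mono u in auto)
  then show ?thesis
    using u by simp
qed

text \<open>T_i is moved to the right through the sorting word of c. It commutes with a distant
  letter; past two neighbouring letters it goes by the braid relation, which changes its index. The
  pair of equal letters travels along, and at the sorted word the claim is a balancing
  relation.\<close>

lemma gen_word_elem_equal:
  assumes "c \<in> W" "1 \<le> i" "i < n" "c (Suc i) = c i"
  shows "K (gen i * word_elem n c) = K (- word_elem n c)"
  using assms
proof (induction "ninv 1 n c" arbitrary: c i rule: less_induct)
  case less
  have decr: "ninv 1 n (c' \<circ> adj k) < ninv 1 n c'" if "1 \<le> k" "k < n" "c' (Suc k) < c' k" for c' k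
    using ninv_descent[of 1 k n c'] that by simp
  \<comment> \<open>The equal letters sit at k, the descent at the neighbouring index j. Sorting at
    j and then at k carries the equal pair to j, where the induction hypothesis applies to
    \<open>?X\<close>.\<close>
  have braid: "K (gen i * word_elem n c) = K (- word_elem n c)"
    if jk: "{j, k} \<subseteq> {1..<n}" "c (Suc j) < c j"
      and br: "hcoset n (gen k * gen j * gen k) = hcoset n (gen j * gen k * gen j)"
      and d: "(c \<circ> adj j) (Suc k) < (c \<circ> adj j) k" "(c \<circ> adj j \<circ> adj k) (Suc j) = (c \<circ> adj j \<circ> adj k) j"
      and "k = i" for j k
  proof -
    let ?X = "word_elem n (c \<circ> adj j \<circ> adj k)"
    have c: "hcoset n (word_elem n c) = hcoset n (gen j * (gen k * ?X))"
    proof -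
      have "hcoset n (word_elem n c) = hcoset n (gen j * word_elem n (c \<circ> adj j))"
        using jk by (intro word_elem_descent) auto
      also have "\<dots> = hcoset n (gen j * (gen k * ?X))"
        using jk d(1) by (intro hcoset_mult_left word_elem_descent) auto
      finally show ?thesis .
    qed
    have IH: "K (gen j * ?X) = K (- ?X)"
    proof (rule less.hyps)
      show "ninv 1 n (c \<circ> adj j \<circ> adj k) < ninv 1 n c"
        using decr[of j c] decr[of k "c \<circ> adj j"] jk d(1) by simp
      show "c \<circ> adj j \<circ> adj k \<in> W"
        using less.prems(1) jk by (intro rearrangements_adj) auto
    qed (use jk d(2) in auto)
    have "K (gen i * word_elem n c) = K (gen k * (gen j * (gen k * ?X)))"
      unfolding \<open>k = i\<close>[symmetric] using jk c by (intro icoset_hcoset_cong hcoset_mult_left) auto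
    also have "\<dots> = K (gen k * gen j * gen k * ?X)"
      by (simp add: mult.assoc)
    also have "\<dots> = K (gen j * gen k * gen j * ?X)"
      using br by (intro icoset_hcoset_cong hcoset_mult_right) auto
    also have "\<dots> = K (gen j * (gen k * (gen j * ?X)))"
      by (simp add: mult.assoc)
    also have "\<dots> = K (gen j * (gen k * (- ?X)))"
      using jk IH by (intro icoset_mult_left) auto
    also have "\<dots> = K (- 1 * (gen j * (gen k * ?X)))"
      by simp
    also have "\<dots> = K (- 1 * word_elem n c)"
      using c by (intro icoset_hcoset_cong hcoset_mult_left) auto
    finally show ?thesis
      by simp
  qed
  show ?case
  proof (cases "ninv 1 n c = 0")
    case True
    then have c: "c = c0"
      using sorted_rearrangement less.prems by blast
    have X: "word_elem n c = 1"
      using True by (rule word_elem_sorted)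
    have i: "i \<in> parabolic_indices n lam"
      using less.prems unfolding parab c by simp
    \<comment> \<open>The balancing relation for the unit and T_i.\<close>
    have "1 * gen i - scalar (sgn_val (gen i)) * 1 \<in> induced_kernel n lam"
      using less.prems parabolic_subalgebra_gen[OF i] by (intro induced_kernel_rel) auto
    then show ?thesis
      unfolding X using less.prems by (subst icoset_eq_iff) (auto simp: sgn_val_gen scalar_uminus)
  next
    case nz: False
    define j where "j = least_descent n c"
    have j: "1 \<le> j" "j < n" "c (Suc j) < c j"
      using least_descent[OF nz] by (auto simp: j_def)
    have "j \<noteq> i"
      using j(3) less.prems(4) by auto
    then consider "i = Suc j" | "j = Suc i" | (far) "2 \<le> \<bar>int i - int j\<bar>"
      by linarith
    then show ?thesis
    proof cases
      case 1
      have v: "adj j j = Suc j" "adj j (Suc j) = j" "adj j (Suc (Suc j)) = Suc (Suc j)"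
        "adj (Suc j) j = j" "adj (Suc j) (Suc j) = Suc (Suc j)" "adj (Suc j) (Suc (Suc j)) = Suc j"
        by (auto simp: Transposition.transpose_def)
      show ?thesis
      proof (rule braid[of j "Suc j"])
        show "hcoset n (gen (Suc j) * gen j * gen (Suc j)) = hcoset n (gen j * gen (Suc j) * gen j)"
          using 1 j less.prems by (intro hcoset_braid[symmetric]) auto
      qed (use 1 j less.prems in \<open>auto simp: v\<close>)
    next
      case 2
      have v: "adj i i = Suc i" "adj i (Suc i) = i" "adj i (Suc (Suc i)) = Suc (Suc i)"
        "adj (Suc i) i = i" "adj (Suc i) (Suc i) = Suc (Suc i)" "adj (Suc i) (Suc (Suc i)) = Suc i"
        by (auto simp: Transposition.transpose_def)
      show ?thesis
      proof (rule braid[of "Suc i" i])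
        show "hcoset n (gen i * gen (Suc i) * gen i) = hcoset n (gen (Suc i) * gen i * gen (Suc i))"
          using 2 j less.prems by (intro hcoset_braid) auto
      qed (use 2 j less.prems in \<open>auto simp: v\<close>)
    next
      case far
      then have v: "adj j i = i" "adj j (Suc i) = Suc i"
        by (auto simp: Transposition.transpose_def)
      let ?X = "word_elem n (c \<circ> adj j)"
      have c: "hcoset n (word_elem n c) = hcoset n (gen j * ?X)"
        using j by (intro word_elem_descent)
      have IH: "K (gen i * ?X) = K (- ?X)"
        using decr[OF j] less.prems j v by (intro less.hyps rearrangements_adj) auto
      have "K (gen i * word_elem n c) = K (gen i * (gen j * ?X))"
        using less.prems c by (intro icoset_hcoset_cong hcoset_mult_left) auto
      also have "\<dots> = K (gen i * gen j * ?X)"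
        by (simp add: mult.assoc)
      also have "\<dots> = K (gen j * gen i * ?X)"
        using far less.prems j by (intro icoset_hcoset_cong hcoset_mult_right hcoset_commute) auto
      also have "\<dots> = K (gen j * (gen i * ?X))"
        by (simp add: mult.assoc)
      also have "\<dots> = K (gen j * (- ?X))"
        using j less.prems IH by (intro icoset_mult_left) auto
      also have "\<dots> = K (- 1 * (gen j * ?X))"
        by simp
      also have "\<dots> = K (- 1 * word_elem n c)"
        using c by (intro icoset_hcoset_cong hcoset_mult_left) auto
      finally show ?thesis
        by simp
    qed
  qed
qed

lemma icoset_add_cong:
  assumes "f \<in> free_carrier n" "g \<in> free_carrier n" "f' \<in> free_carrier n" "g' \<in> free_carrier n" "K f = K f'" "K g = K g'"
  shows "K (f + g) = K (f' + g')"
  using assms by (metis icoset_add)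

definition spanned :: "free_elem \<Rightarrow> bool" where
  "spanned f \<longleftrightarrow> (\<exists>a. K f = K (\<Sum>c\<in>W. scalar (a c) * word_elem n c))"

lemma spanned_word_elem:
  assumes "c \<in> W"
  shows "spanned (word_elem n c)"
proof -
  have "(\<Sum>d\<in>W. scalar (if d = c then 1 else 0) * word_elem n d) = word_elem n c"
    using assms by (simp add: if_distrib[of scalar] if_distrib[of "\<lambda>x. x * _"] sum.delta' sum.delta cong: if_cong)
  then have "K (word_elem n c) = K (\<Sum>d\<in>W. scalar (if d = c then 1 else 0) * word_elem n d)"
    by (simp only:)
  then show ?thesis
    unfolding spanned_def by (rule exI[of _ "\<lambda>d. if d = c then 1 else 0"])
qed

lemma spanned_add:
  assumes "f \<in> free_carrier n" "g \<in> free_carrier n" "spanned f" "spanned g"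
  shows "spanned (f + g)"
proof -
  obtain a b where "K f = K (\<Sum>c\<in>W. scalar (a c) * word_elem n c)" "K g = K (\<Sum>c\<in>W. scalar (b c) * word_elem n c)"
    using assms unfolding spanned_def by blast
  then have "K (f + g) = K ((\<Sum>c\<in>W. scalar (a c) * word_elem n c) + (\<Sum>c\<in>W. scalar (b c) * word_elem n c))"
    using assms by (intro icoset_add_cong) auto
  then show ?thesis
    unfolding spanned_def by (intro exI[of _ "\<lambda>c. a c + b c"]) (simp add: scalar_add distrib_right sum.distrib)
qed

lemma spanned_scale:
  assumes "f \<in> free_carrier n" "spanned f"
  shows "spanned (scalar k * f)"
proof -
  obtain a where "K f = K (\<Sum>c\<in>W. scalar (a c) * word_elem n c)"
    using assms unfolding spanned_def by blast
  then have "K (scalar k * f) = K (scalar k * (\<Sum>c\<in>W. scalar (a c) * word_elem n c))"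
    using assms by (intro icoset_mult_left) auto
  then show ?thesis
    unfolding spanned_def by (intro exI[of _ "\<lambda>c. k * a c"]) (simp add: scalar_mult sum_distrib_left mult.assoc)
qed

lemma spanned_cong: "K f = K g \<Longrightarrow> spanned g \<Longrightarrow> spanned f"
  by (simp add: spanned_def)

lemma spanned_sum:
  "(\<And>x. x \<in> A \<Longrightarrow> f x \<in> free_carrier n \<and> spanned (f x)) \<Longrightarrow> spanned (sum f A)"
proof (induction A rule: infinite_finite_induct)
  case (insert x A)
  then show ?case
    by (auto intro!: spanned_add)
qed (use spanned_scale[OF _ spanned_word_elem[OF rearrangements_self], of 0] in auto)

text \<open>An ascent of c at i leads to another element of the family, equal letters give the sign
  -1, and a descent is resolved by the quadratic relation: the same three cases as in
  \<open>opr\<close>.\<close>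

lemma spanned_gen:
  assumes "1 \<le> i" "i < n" "f \<in> free_carrier n" "spanned f"
  shows "spanned (gen i * f)"
proof -
  have T: "spanned (gen i * word_elem n c)" if c: "c \<in> W" for c
  proof (cases "c i" "c (Suc i)" rule: linorder_cases)
    case less
    then have "hcoset n (word_elem n (c \<circ> adj i)) = hcoset n (gen i * word_elem n c)"
      using word_elem_descent[of i n "c \<circ> adj i"] assms by simp
    then show ?thesis
      using spanned_word_elem[OF rearrangements_adj[OF c assms(1,2)]] icoset_hcoset_cong spanned_cong by metis
  next
    case equal
    then have "K (gen i * word_elem n c) = K (scalar (- 1) * word_elem n c)"
      using gen_word_elem_equal[OF c assms(1,2)] by (simp add: scalar_uminus)
    then show ?thesis
      using spanned_scale[OF word_elem_closed spanned_word_elem[OF c]] spanned_cong by blast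
  next
    case greater
    let ?X = "word_elem n (c \<circ> adj i)"
    have *: "hcoset n (word_elem n c) = hcoset n (gen i * ?X)"
      using greater assms by (intro word_elem_descent) auto
    have "hcoset n (gen i * word_elem n c) = hcoset n (gen i * (gen i * ?X))"
      using assms by (intro hcoset_mult_left *) auto
    also have "\<dots> = hcoset n (gen i * gen i * ?X)"
      by (simp add: mult.assoc)
    also have "\<dots> = hcoset n ((scalar (qh 2 - 1) * gen i + scalar (qh 2)) * ?X)"
      using assms by (intro hcoset_mult_right hcoset_quadratic) auto
    also have "\<dots> = hcoset n (scalar (qh 2 - 1) * (gen i * ?X) + scalar (qh 2) * ?X)"
      by (simp add: distrib_right mult.assoc)
    also have "\<dots> = hcoset n (scalar (qh 2 - 1) * word_elem n c + scalar (qh 2) * ?X)"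
      by (intro hcoset_add_cong hcoset_mult_left *[symmetric]) auto
    finally have "K (gen i * word_elem n c) = K (scalar (qh 2 - 1) * word_elem n c + scalar (qh 2) * ?X)"
      by (rule icoset_hcoset_cong)
    moreover have "spanned (scalar (qh 2 - 1) * word_elem n c + scalar (qh 2) * ?X)"
      using c rearrangements_adj[OF c assms(1,2)] by (intro spanned_add spanned_scale spanned_word_elem) auto
    ultimately show ?thesis
      by (rule spanned_cong)
  qed
  obtain a where "K f = K (\<Sum>c\<in>W. scalar (a c) * word_elem n c)"
    using assms unfolding spanned_def by blast
  then have "K (gen i * f) = K (gen i * (\<Sum>c\<in>W. scalar (a c) * word_elem n c))"
    using assms by (intro icoset_mult_left) auto
  also have "gen i * (\<Sum>c\<in>W. scalar (a c) * word_elem n c) = (\<Sum>c\<in>W. scalar (a c) * (gen i * word_elem n c))"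
    by (simp add: sum_distrib_left scalar_left_commute)
  finally show ?thesis
    by (rule spanned_cong) (use assms T in \<open>auto intro!: spanned_sum spanned_scale\<close>)
qed

lemma spanned: "f \<in> free_carrier n \<Longrightarrow> spanned f"
proof (induction rule: free_elem_induct)
  case (word "is")
  then show ?case
  proof (induction "is")
    case Nil
    have "ninv 1 n c0 = 0"
      by (rule no_descent_ninv_0) (rule mono)
    then show ?case
      using spanned_word_elem[OF rearrangements_self] word_elem_sorted word_Nil by metis
  next
    case (Cons i "is")
    then show ?case
      unfolding word_Cons by (intro spanned_gen) auto
  qed
qed (auto intro: spanned_add spanned_scale)

text \<open>The factor cancels the power of q^(1/2) in \<open>act_word_elem_delta\<close>. Thus
  basis elements correspond to the functions \<open>delta c\<close>, and the matrix of h on the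
  module is that of \<open>act h\<close>.\<close>

definition basis_elem :: "(nat \<Rightarrow> nat) \<Rightarrow> free_elem" where
  "basis_elem c = scalar (qh (- int (ninv 1 n c))) * word_elem n c"

lemma basis_elem_closed [simp]: "basis_elem c \<in> free_carrier n"
  by (simp add: basis_elem_def)

lemma act_basis_elem:
  assumes "c \<in> W"
  shows "act (basis_elem c) (delta c0) = delta c"
proof -
  obtain u where "u permutes {1..n}" "c = c0 \<circ> u"
    using assms by (auto simp: rearrangements_def)
  then have X: "act (word_elem n c) (delta c0) = (\<lambda>d. qh (int (ninv 1 n c)) * delta c d)"
    using mono by (intro act_word_elem_delta[where u = u]) auto
  show ?thesis
    unfolding basis_elem_def by (rule ext) (simp only: act_mult' X act_scalar mult.assoc[symmetric] qh_mult, simp)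
qed

lemma act_icoset_cong:
  assumes "f \<in> free_carrier n" "g \<in> free_carrier n" "K f = K g"
  shows "act f (delta c0) = act g (delta c0)"
proof -
  have "act (f - g) (delta c0) = (\<lambda>_. 0)"
    using assms parab by (intro induced_kernel_act[of _ n lam]) (auto simp: icoset_eq_iff)
  then show ?thesis
    by (simp add: act_diff fun_eq_iff)
qed

text \<open>Spanning provides some coefficients, and applying both sides to \<open>delta c0\<close>
  reveals what they are. Spanning and independence thus come together.\<close>

lemma icoset_expand:
  assumes "f \<in> free_carrier n"
  shows "K f = K (\<Sum>c\<in>W. scalar (act f (delta c0) c) * basis_elem c)"
    and "c \<notin> W \<Longrightarrow> act f (delta c0) c = 0"
proof -
  obtain a where a: "K f = K (\<Sum>c\<in>W. scalar (a c) * word_elem n c)"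
    using spanned[OF assms] unfolding spanned_def by blast
  define b where "b c = a c * qh (int (ninv 1 n c))" for c
  have "scalar (a c) * word_elem n c = scalar (b c) * basis_elem c" for c
    unfolding b_def basis_elem_def mult.assoc[of "scalar _", symmetric] scalar_mult[symmetric] mult.assoc qh_mult by simp
  then have b: "K f = K (\<Sum>c\<in>W. scalar (b c) * basis_elem c)"
    using a by simp
  have "act f (delta c0) = act (\<Sum>c\<in>W. scalar (b c) * basis_elem c) (delta c0)"
    using assms b by (intro act_icoset_cong) auto
  then have v: "act f (delta c0) d = (\<Sum>c\<in>W. b c * delta c d)" for d
    by (simp add: act_sum act_mult' act_scalar act_basis_elem)
  have v1: "act f (delta c0) d = b d" if "d \<in> W" for d
    unfolding v delta_def using that sum.remove[OF finite_rearrangements that, of "\<lambda>c. b c * (if d = c then 1 else 0)"]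
    by (simp add: sum.neutral)
  show "K f = K (\<Sum>c\<in>W. scalar (act f (delta c0) c) * basis_elem c)"
    using b v1 by (metis (no_types, lifting) sum.cong)
  show "act f (delta c0) c = 0" if "c \<notin> W"
    unfolding v delta_def using that by (intro sum.neutral) auto
qed

lemma icoset_eqI:
  assumes "f \<in> free_carrier n" "g \<in> free_carrier n" "\<And>c. c \<in> W \<Longrightarrow> act f (delta c0) c = act g (delta c0) c"
  shows "K f = K g"
proof -
  have "(\<Sum>c\<in>W. scalar (act f (delta c0) c) * basis_elem c) = (\<Sum>c\<in>W. scalar (act g (delta c0) c) * basis_elem c)"
    using assms(3) by (intro sum.cong) auto
  then show ?thesis
    using icoset_expand(1)[OF assms(1)] icoset_expand(1)[OF assms(2)] by metis
qed

end

section \<open>The trace on the induced module\<close>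

lemma act_sum_scalar:
  "act (\<Sum>x\<in>A. scalar (a x) * f x) F d = (\<Sum>x\<in>A. a x * act (f x) F d)"
  by (simp add: act_sum act_mult' act_scalar)

context sorted_word
begin

abbreviation "coord f c \<equiv> act f (delta c0) c"

lemma coord_mult:
  assumes "h \<in> free_carrier n" "f \<in> free_carrier n"
  shows "coord (h * f) d = (\<Sum>c\<in>W. coord f c * act h (delta c) d)"
proof -
  have "K (h * f) = K (h * (\<Sum>c\<in>W. scalar (coord f c) * basis_elem c))"
    using assms icoset_expand(1)[OF assms(2)] by (intro icoset_mult_left) auto
  then have "coord (h * f) d = coord (h * (\<Sum>c\<in>W. scalar (coord f c) * basis_elem c)) d"
    using assms by (subst act_icoset_cong) auto
  also have "h * (\<Sum>c\<in>W. scalar (coord f c) * basis_elem c) = (\<Sum>c\<in>W. scalar (coord f c) * (h * basis_elem c))"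
    by (simp add: sum_distrib_left scalar_left_commute)
  also have "coord \<dots> d = (\<Sum>c\<in>W. coord f c * act h (delta c) d)"
    unfolding act_sum_scalar by (intro sum.cong) (auto simp: act_mult' act_basis_elem)
  finally show ?thesis .
qed

lemma induced_basis_finsum:
  assumes "finite B" "\<And>b. b \<in> B \<Longrightarrow> r b \<in> free_carrier n" "\<And>b. b \<in> B \<Longrightarrow> b = K (r b)"
  shows "(\<Oplus>\<^bsub>induced_module n lam\<^esub>b\<in>B. a b \<odot>\<^bsub>induced_module n lam\<^esub> b) = K (\<Sum>b\<in>B. scalar (a b) * r b)"
proof (rule finsum_induced_module[OF assms(1)])
  show "a b \<odot>\<^bsub>induced_module n lam\<^esub> b = K (scalar (a b) * r b)" if "b \<in> B" for b
    using induced_module_smult[OF assms(2)[OF that], where c = "a b" and lam = lam] assms(3)[OF that] by simp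
qed (use assms in auto)

text \<open>\<open>module_trace\<close> admits every basis, so invariance under a change of basis
  has to be proved. The coordinates of the representatives \<open>r b\<close> and the coefficients
  \<open>Q\<close> are mutually inverse transition matrices between B and the words, and
  \<open>A\<close> is the matrix of h conjugated by them.\<close>

lemma trace_unique:
  assumes h: "h \<in> free_carrier n"
    and B: "module_basis laurent_ring (induced_module n lam) B"
    and A: "\<And>b. b \<in> B \<Longrightarrow> induced_action n lam (hcoset n h) b =
      (\<Oplus>\<^bsub>induced_module n lam\<^esub>b'\<in>B. A b' b \<odot>\<^bsub>induced_module n lam\<^esub> b')"
  shows "(\<Sum>b\<in>B. A b b) = (\<Sum>c\<in>W. act h (delta c) c)"
proof -
  let ?M = "induced_module n lam"
  have fin: "finite B" and sub: "B \<subseteq> carrier ?M"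
    and ex1: "\<And>x. x \<in> carrier ?M \<Longrightarrow> \<exists>!c. c \<in> B \<rightarrow>\<^sub>E carrier laurent_ring \<and> x = (\<Oplus>\<^bsub>?M\<^esub>b\<in>B. c b \<odot>\<^bsub>?M\<^esub> b)"
    using B unfolding module_basis_def by blast+
  have "\<forall>b\<in>B. \<exists>f. f \<in> free_carrier n \<and> b = K f"
    using sub by (auto simp: induced_module_sel)
  from bchoice[OF this] obtain r where r: "\<And>b. b \<in> B \<Longrightarrow> r b \<in> free_carrier n" "\<And>b. b \<in> B \<Longrightarrow> b = K (r b)"
    by blast
  have fs: "(\<Oplus>\<^bsub>?M\<^esub>b\<in>B. a b \<odot>\<^bsub>?M\<^esub> b) = K (\<Sum>b\<in>B. scalar (a b) * r b)" for a
    by (rule induced_basis_finsum) (use fin r in blast)+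
  have unique: "a b = a' b" if "K (\<Sum>b\<in>B. scalar (a b) * r b) = K (\<Sum>b\<in>B. scalar (a' b) * r b)" "b \<in> B" for a a' b
  proof -
    let ?x = "K (\<Sum>b\<in>B. scalar (a b) * r b)"
    have "?x \<in> carrier ?M"
      using r by (auto simp: induced_module_sel)
    note e = ex1[OF this]
    \<comment> \<open>Uniqueness in \<open>module_basis\<close> concerns extensional coefficient
      functions, so arbitrary ones are restricted to B first.\<close>
    have res: "K (\<Sum>b\<in>B. scalar (restrict a B b) * r b) = K (\<Sum>b\<in>B. scalar (a b) * r b)" for a
      by (intro arg_cong[of _ _ K] sum.cong) auto
    have "restrict a B \<in> B \<rightarrow>\<^sub>E carrier laurent_ring \<and> ?x = (\<Oplus>\<^bsub>?M\<^esub>b\<in>B. restrict a B b \<odot>\<^bsub>?M\<^esub> b)"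
      "restrict a' B \<in> B \<rightarrow>\<^sub>E carrier laurent_ring \<and> ?x = (\<Oplus>\<^bsub>?M\<^esub>b\<in>B. restrict a' B b \<odot>\<^bsub>?M\<^esub> b)"
      unfolding fs res using that(1) by (simp_all only: laurent_ring_sel restrict_PiE_iff UNIV_I simp_thms ball_triv)
    then have "restrict a B = restrict a' B"
      using e by blast
    then show ?thesis
      using that(2) by (metis restrict_apply')
  qed
  have "\<forall>c. \<exists>q. K (basis_elem c) = K (\<Sum>b\<in>B. scalar (q b) * r b)"
  proof
    fix c
    have "K (basis_elem c) \<in> carrier ?M"
      by (auto simp: induced_module_sel)
    then show "\<exists>q. K (basis_elem c) = K (\<Sum>b\<in>B. scalar (q b) * r b)"
      using ex1 unfolding fs by blast
  qed
  from choice[OF this] obtain Q where Q: "\<And>c. K (basis_elem c) = K (\<Sum>b\<in>B. scalar (Q c b) * r b)"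
    by blast
  have PQ: "(\<Sum>b\<in>B. Q c b * coord (r b) d) = delta c d" if "c \<in> W" for c d
  proof -
    have "coord (basis_elem c) d = coord (\<Sum>b\<in>B. scalar (Q c b) * r b) d"
      using Q r by (subst act_icoset_cong[OF _ _ Q]) auto
    then show ?thesis
      unfolding act_sum_scalar act_basis_elem[OF that] by simp
  qed
  have QP: "(\<Sum>c\<in>W. coord (r b) c * Q c b') = (if b' = b then 1 else 0)" if b: "b \<in> B" "b' \<in> B" for b b'
  proof -
    have "K (\<Sum>b'\<in>B. scalar (\<Sum>c\<in>W. coord (r b) c * Q c b') * r b') = K (\<Sum>b'\<in>B. scalar (if b' = b then 1 else 0) * r b')"
    proof (rule icoset_eqI)
      fix d assume "d \<in> W"
      have "coord (\<Sum>b'\<in>B. scalar (\<Sum>c\<in>W. coord (r b) c * Q c b') * r b') d =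
          (\<Sum>b'\<in>B. \<Sum>c\<in>W. coord (r b) c * Q c b' * coord (r b') d)"
        unfolding act_sum_scalar by (simp add: sum_distrib_right)
      also have "\<dots> = (\<Sum>c\<in>W. coord (r b) c * (\<Sum>b'\<in>B. Q c b' * coord (r b') d))"
        by (subst sum.swap) (simp add: sum_distrib_left mult.assoc)
      also have "\<dots> = (\<Sum>c\<in>W. coord (r b) c * delta c d)"
        using PQ by (intro sum.cong) auto
      also have "\<dots> = coord (r b) d"
        using \<open>d \<in> W\<close> sum.remove[OF finite_rearrangements \<open>d \<in> W\<close>, of "\<lambda>c. coord (r b) c * delta c d"]
        by (simp add: delta_def sum.neutral)
      also have "\<dots> = (\<Sum>b'\<in>B. (if b' = b then 1 else 0) * coord (r b') d)"
        using fin b(1) sum.remove[OF fin b(1), of "\<lambda>b'. (if b' = b then 1 else 0) * coord (r b') d"]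
        by (simp add: sum.neutral)
      finally show "coord (\<Sum>b'\<in>B. scalar (\<Sum>c\<in>W. coord (r b) c * Q c b') * r b') d =
          coord (\<Sum>b'\<in>B. scalar (if b' = b then 1 else 0) * r b') d"
        unfolding act_sum_scalar .
    qed (use r in auto)
    from unique[OF this b(2)] show ?thesis .
  qed
  have FP: "(\<Sum>b'\<in>B. A b' b * coord (r b') d) = (\<Sum>c\<in>W. coord (r b) c * act h (delta c) d)" if b: "b \<in> B" for b d
  proof -
    have "K (h * r b) = K (\<Sum>b'\<in>B. scalar (A b' b) * r b')"
      using A[OF b] induced_action_icoset[OF r(1)[OF b] h, of lam] r(2)[OF b] unfolding fs by simp
    then have "coord (h * r b) d = coord (\<Sum>b'\<in>B. scalar (A b' b) * r b') d"
      using r b h by (subst act_icoset_cong) auto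
    then show ?thesis
      unfolding act_sum_scalar coord_mult[OF h r(1)[OF b]] by simp
  qed
  \<comment> \<open>The unit matrix is inserted and factored by \<open>QP\<close>, the action passes
    to the words by \<open>FP\<close>, and \<open>PQ\<close> then removes the transition
    matrices.\<close>
  have "(\<Sum>b\<in>B. A b b) = (\<Sum>b\<in>B. \<Sum>b'\<in>B. A b' b * (if b = b' then 1 else 0))"
  proof (rule sum.cong[OF refl])
    fix b assume "b \<in> B"
    then show "A b b = (\<Sum>b'\<in>B. A b' b * (if b = b' then 1 else 0))"
      using sum.remove[OF fin, of b "\<lambda>b'. A b' b * (if b = b' then 1 else 0)"] by (simp add: sum.neutral)
  qed
  also have "\<dots> = (\<Sum>b\<in>B. \<Sum>b'\<in>B. A b' b * (\<Sum>c\<in>W. coord (r b') c * Q c b))"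
    using QP by (intro sum.cong refl) auto
  also have "\<dots> = (\<Sum>b\<in>B. \<Sum>c\<in>W. Q c b * (\<Sum>b'\<in>B. A b' b * coord (r b') c))"
    unfolding sum_distrib_left by (subst (2) sum.swap) (simp add: mult_ac)
  also have "\<dots> = (\<Sum>b\<in>B. \<Sum>c\<in>W. Q c b * (\<Sum>c'\<in>W. coord (r b) c' * act h (delta c') c))"
    using FP by (intro sum.cong refl) auto
  also have "\<dots> = (\<Sum>c\<in>W. \<Sum>c'\<in>W. act h (delta c') c * (\<Sum>b\<in>B. Q c b * coord (r b) c'))"
    unfolding sum_distrib_left
    by (subst sum.swap, rule sum.cong[OF refl], subst sum.swap) (simp add: mult_ac)
  also have "\<dots> = (\<Sum>c\<in>W. \<Sum>c'\<in>W. act h (delta c') c * delta c c')"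
    using PQ by (intro sum.cong refl) auto
  also have "\<dots> = (\<Sum>c\<in>W. act h (delta c) c)"
  proof (rule sum.cong[OF refl])
    fix c assume "c \<in> W"
    then show "(\<Sum>c'\<in>W. act h (delta c') c * delta c c') = act h (delta c) c"
      using sum.remove[OF finite_rearrangements, of c n c0 "\<lambda>c'. act h (delta c') c * delta c c'"]
      by (simp add: delta_def sum.neutral)
  qed
  finally show ?thesis .
qed

lemma inj_basis_elem: "inj_on (\<lambda>c. K (basis_elem c)) W"
proof (rule inj_onI)
  fix c d assume cd: "c \<in> W" "d \<in> W" "K (basis_elem c) = K (basis_elem d)"
  then have "delta c = delta d"
    using act_icoset_cong[OF basis_elem_closed basis_elem_closed cd(3)] act_basis_elem by simp
  then have "delta c c = delta d c"
    by simp
  then show "c = d"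
    by (auto simp: delta_def split: if_splits)
qed

definition basis_index :: "free_elem set set \<Rightarrow> nat \<Rightarrow> nat" where
  "basis_index = the_inv_into W (\<lambda>c. K (basis_elem c))"

lemma basis_index: "c \<in> W \<Longrightarrow> basis_index (K (basis_elem c)) = c"
  unfolding basis_index_def using inj_basis_elem by (rule the_inv_into_f_f)

definition induced_basis :: "free_elem set set set" where
  "induced_basis = (\<lambda>c. K (basis_elem c)) ` W"

lemma finsum_induced_basis:
  "(\<Oplus>\<^bsub>induced_module n lam\<^esub>b\<in>induced_basis. a b \<odot>\<^bsub>induced_module n lam\<^esub> b) =
    K (\<Sum>c\<in>W. scalar (a (K (basis_elem c))) * basis_elem c)"
proof -
  have "(\<Oplus>\<^bsub>induced_module n lam\<^esub>b\<in>induced_basis. a b \<odot>\<^bsub>induced_module n lam\<^esub> b) =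
      K (\<Sum>b\<in>induced_basis. scalar (a b) * basis_elem (basis_index b))"
    by (rule induced_basis_finsum) (auto simp: induced_basis_def basis_index)
  also have "(\<Sum>b\<in>induced_basis. scalar (a b) * basis_elem (basis_index b)) =
      (\<Sum>c\<in>W. scalar (a (K (basis_elem c))) * basis_elem c)"
    unfolding induced_basis_def using inj_basis_elem by (simp add: sum.reindex basis_index)
  finally show ?thesis .
qed

lemma coord_sum_basis_elem:
  assumes "d \<in> W"
  shows "coord (\<Sum>c\<in>W. scalar (a c) * basis_elem c) d = a d"
proof -
  have "coord (\<Sum>c\<in>W. scalar (a c) * basis_elem c) d = (\<Sum>c\<in>W. a c * delta c d)"
    unfolding act_sum_scalar by (intro sum.cong) (auto simp: act_basis_elem)
  also have "\<dots> = a d"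
    using sum.remove[OF finite_rearrangements assms, of "\<lambda>c. a c * delta c d"]
    by (simp add: delta_def sum.neutral)
  finally show ?thesis .
qed

lemma module_basis_induced_basis: "module_basis laurent_ring (induced_module n lam) induced_basis"
  unfolding module_basis_def
proof (intro conjI ballI)
  show "finite induced_basis" "induced_basis \<subseteq> carrier (induced_module n lam)"
    by (auto simp: induced_basis_def induced_module_sel)
  fix x assume "x \<in> carrier (induced_module n lam)"
  then obtain f where f: "f \<in> free_carrier n" "x = K f"
    by (auto simp: induced_module_sel)
  show "\<exists>!a. a \<in> induced_basis \<rightarrow>\<^sub>E carrier laurent_ring \<and>
      x = (\<Oplus>\<^bsub>induced_module n lam\<^esub>b\<in>induced_basis. a b \<odot>\<^bsub>induced_module n lam\<^esub> b)"
  proof (rule ex1I)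
    let ?a = "\<lambda>b\<in>induced_basis. coord f (basis_index b)"
    have "(\<Sum>c\<in>W. scalar (?a (K (basis_elem c))) * basis_elem c) = (\<Sum>c\<in>W. scalar (coord f c) * basis_elem c)"
      by (intro sum.cong) (auto simp: induced_basis_def basis_index)
    then show "?a \<in> induced_basis \<rightarrow>\<^sub>E carrier laurent_ring \<and>
      x = (\<Oplus>\<^bsub>induced_module n lam\<^esub>b\<in>induced_basis. ?a b \<odot>\<^bsub>induced_module n lam\<^esub> b)"
      unfolding finsum_induced_basis f(2) using icoset_expand(1)[OF f(1)] by auto
    fix a assume a: "a \<in> induced_basis \<rightarrow>\<^sub>E carrier laurent_ring \<and>
      x = (\<Oplus>\<^bsub>induced_module n lam\<^esub>b\<in>induced_basis. a b \<odot>\<^bsub>induced_module n lam\<^esub> b)"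
    show "a = ?a"
    proof (rule extensionalityI[of _ induced_basis])
      fix b assume "b \<in> induced_basis"
      then obtain c where c: "c \<in> W" "b = K (basis_elem c)"
        by (auto simp: induced_basis_def)
      have "K f = K (\<Sum>c\<in>W. scalar (a (K (basis_elem c))) * basis_elem c)"
        using a unfolding finsum_induced_basis f(2) by blast
      then have "coord f c = coord (\<Sum>c\<in>W. scalar (a (K (basis_elem c))) * basis_elem c) c"
        using f(1) by (subst act_icoset_cong) auto
      then have "coord f c = a b"
        unfolding coord_sum_basis_elem[OF c(1)] c(2) .
      then show "a b = ?a b"
        using \<open>b \<in> induced_basis\<close> c basis_index by simp
    qed (use a in \<open>auto simp: PiE_def\<close>)
  qed
qed

theorem induced_sgn_eq:
  assumes h: "h \<in> free_carrier n"
  shows "induced_sgn n lam (hcoset n h) = (\<Sum>c\<in>W. act h (delta c) c)"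
  unfolding induced_sgn_def module_trace_def
proof (rule the_equality)
  let ?A = "\<lambda>b' b. act h (delta (basis_index b)) (basis_index b')"
  have act: "induced_action n lam (hcoset n h) b =
      (\<Oplus>\<^bsub>induced_module n lam\<^esub>b'\<in>induced_basis. ?A b' b \<odot>\<^bsub>induced_module n lam\<^esub> b')" if b: "b \<in> induced_basis" for b
  proof -
    obtain c where c: "c \<in> W" "b = K (basis_elem c)"
      using b by (auto simp: induced_basis_def)
    have "induced_action n lam (hcoset n h) b = K (h * basis_elem c)"
      unfolding c(2) by (rule induced_action_icoset[OF basis_elem_closed h])
    also have "\<dots> = K (\<Sum>d\<in>W. scalar (act h (delta c) d) * basis_elem d)"
      using h by (intro icoset_eqI) (auto simp: coord_sum_basis_elem act_mult' act_basis_elem c(1))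
    also have "(\<Sum>d\<in>W. scalar (act h (delta c) d) * basis_elem d) =
        (\<Sum>d\<in>W. scalar (?A (K (basis_elem d)) b) * basis_elem d)"
      by (intro sum.cong) (auto simp: basis_index c)
    finally show ?thesis
      unfolding finsum_induced_basis .
  qed
  have fin: "finite induced_basis"
    by (simp add: induced_basis_def)
  have tr: "(\<Sum>c\<in>W. act h (delta c) c) = (\<Oplus>\<^bsub>laurent_ring\<^esub>b\<in>induced_basis. ?A b b)"
    unfolding finsum_laurent[OF fin] using trace_unique[OF h module_basis_induced_basis, of ?A] act by simp
  show "\<exists>B A. module_basis laurent_ring (induced_module n lam) B \<and>
     (\<forall>b\<in>B. (\<lambda>b'. A b' b) \<in> B \<rightarrow> carrier laurent_ring \<and>
       induced_action n lam (hcoset n h) b = (\<Oplus>\<^bsub>induced_module n lam\<^esub>b'\<in>B. A b' b \<odot>\<^bsub>induced_module n lam\<^esub> b')) \<and>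
     (\<Sum>c\<in>W. act h (delta c) c) = (\<Oplus>\<^bsub>laurent_ring\<^esub>b\<in>B. A b b)"
    using module_basis_induced_basis act tr
    by (intro exI[of _ induced_basis] exI[of _ ?A] conjI ballI) auto
next
  fix t
  assume "\<exists>B A. module_basis laurent_ring (induced_module n lam) B \<and>
     (\<forall>b\<in>B. (\<lambda>b'. A b' b) \<in> B \<rightarrow> carrier laurent_ring \<and>
       induced_action n lam (hcoset n h) b = (\<Oplus>\<^bsub>induced_module n lam\<^esub>b'\<in>B. A b' b \<odot>\<^bsub>induced_module n lam\<^esub> b')) \<and>
     t = (\<Oplus>\<^bsub>laurent_ring\<^esub>b\<in>B. A b b)"
  then obtain B A where B: "module_basis laurent_ring (induced_module n lam) B"
    and A: "\<And>b. b \<in> B \<Longrightarrow> induced_action n lam (hcoset n h) b =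
      (\<Oplus>\<^bsub>induced_module n lam\<^esub>b'\<in>B. A b' b \<odot>\<^bsub>induced_module n lam\<^esub> b')"
    and t: "t = (\<Oplus>\<^bsub>laurent_ring\<^esub>b\<in>B. A b b)"
    by blast
  have "finite B"
    using B by (simp add: module_basis_def)
  then show "t = (\<Sum>c\<in>W. act h (delta c) c)"
    unfolding t using trace_unique[OF h B A] by (simp add: finsum_laurent)
qed

end

section \<open>Partitions and cells\<close>

text \<open>The sorted word of content \<open>lam\<close>, with letters from 0 and positions from 1.
  Counting the blocks that end before x gives a letter to every number, so the word is weakly
  increasing everywhere.\<close>

definition base_word :: "nat list \<Rightarrow> nat \<Rightarrow> nat" where
  "base_word lam x = card {j \<in> {1..length lam}. sum_list (take j lam) < x}"

text \<open>The diagram of the conjugate of \<open>lam\<close>, as pairs of row and column: column k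
  has height \<open>lam ! k\<close>, the multiplicity of the letter k.\<close>

definition cells :: "nat list \<Rightarrow> (nat \<times> nat) set" where
  "cells lam = {(r, k). k < length lam \<and> r < lam ! k}"

lemma sum_list_take_mono: "i \<le> j \<Longrightarrow> sum_list (take i lam) \<le> sum_list (take j (lam :: nat list))"
  by (metis le_add1 le_iff_add sum_list_append take_add)

lemma base_word_eq:
  assumes "k < length lam" "sum_list (take k lam) < x" "x \<le> sum_list (take (Suc k) lam)"
  shows "base_word lam x = k"
proof -
  have "sum_list (take j lam) < x \<longleftrightarrow> j \<le> k" for j
  proof (cases "j \<le> k")
    case True
    then show ?thesis
      using sum_list_take_mono[OF True, of lam] assms(2) by linarith
  next
    case False
    then have "Suc k \<le> j"
      by simp
    then show ?thesis
      using sum_list_take_mono[of "Suc k" j lam] assms(3) False by linarith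
  qed
  then have "{j \<in> {1..length lam}. sum_list (take j lam) < x} = {j \<in> {1..length lam}. j \<le> k}"
    by blast
  also have "\<dots> = {1..k}"
    using assms(1) by auto
  finally show ?thesis
    by (simp add: base_word_def)
qed

lemma base_word_interval:
  assumes "1 \<le> x" "x \<le> sum_list lam"
  shows "base_word lam x < length lam" "sum_list (take (base_word lam x) lam) < x"
    "x \<le> sum_list (take (Suc (base_word lam x)) lam)"
proof -
  define m where "m = (LEAST j. x \<le> sum_list (take j lam))"
  have ex: "x \<le> sum_list (take (length lam) lam)"
    using assms by simp
  have m: "x \<le> sum_list (take m lam)" "m \<le> length lam"
    unfolding m_def using ex by (rule LeastI, rule Least_le)
  have "m \<noteq> 0"
    using m(1) assms(1) by (cases m) auto
  then obtain k where k: "m = Suc k"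
    by (cases m) auto
  have "\<not> x \<le> sum_list (take k lam)"
    using not_less_Least[of k "\<lambda>j. x \<le> sum_list (take j lam)"] k by (simp add: m_def)
  then have "sum_list (take k lam) < x" "x \<le> sum_list (take (Suc k) lam)" "k < length lam"
    using m k by auto
  moreover from this have "base_word lam x = k"
    by (intro base_word_eq)
  ultimately show "base_word lam x < length lam" "sum_list (take (base_word lam x) lam) < x"
    "x \<le> sum_list (take (Suc (base_word lam x)) lam)"
    by auto
qed

lemma base_word_mono: "x \<le> y \<Longrightarrow> base_word lam x \<le> base_word lam y"
  unfolding base_word_def by (intro card_mono) auto

lemma base_word_content:
  assumes "k < length lam"
  shows "card {x \<in> {1..sum_list lam}. base_word lam x = k} = lam ! k"
proof -
  have "{x \<in> {1..sum_list lam}. base_word lam x = k} = {sum_list (take k lam)<..sum_list (take (Suc k) lam)}"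
  proof (intro equalityI subsetI)
    fix x assume "x \<in> {x \<in> {1..sum_list lam}. base_word lam x = k}"
    then show "x \<in> {sum_list (take k lam)<..sum_list (take (Suc k) lam)}"
      using base_word_interval[of x lam] by auto
  next
    fix x assume x: "x \<in> {sum_list (take k lam)<..sum_list (take (Suc k) lam)}"
    then have "x \<le> sum_list lam"
      using sum_list_take_mono[of "Suc k" "length lam" lam] assms by auto
    then show "x \<in> {x \<in> {1..sum_list lam}. base_word lam x = k}"
      using base_word_eq[OF assms, of x] x by auto
  qed
  then show ?thesis
    using assms by (simp add: take_Suc_conv_app_nth)
qed

lemma parabolic_indices_base_word:
  "parabolic_indices n lam = {i \<in> {1..<n}. base_word lam (Suc i) = base_word lam i}"
proof -
  have "base_word lam (Suc i) = base_word lam i \<longleftrightarrow> i \<notin> {sum_list (take k lam) | k. k \<le> length lam}" if "1 \<le> i" for i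
  proof -
    let ?S = "\<lambda>x. {j \<in> {1..length lam}. sum_list (take j lam) < x}"
    have sub: "?S i \<subseteq> ?S (Suc i)" "finite (?S (Suc i))"
      by auto
    have "base_word lam (Suc i) = base_word lam i \<longleftrightarrow> ?S (Suc i) = ?S i"
      unfolding base_word_def using card_subset_eq[OF sub(2,1)] by auto
    also have "\<dots> \<longleftrightarrow> (\<forall>j\<in>{1..length lam}. sum_list (take j lam) \<noteq> i)"
      unfolding less_Suc_eq by blast
    also have "\<dots> \<longleftrightarrow> i \<notin> {sum_list (take k lam) | k. k \<le> length lam}"
    proof -
      \<comment> \<open>The empty partial sum is 0 and never equals an index i that is at least 1,
        so it makes no difference whether k starts at 0 or 1.\<close>
      have "k \<in> {1..length lam} \<longleftrightarrow> k \<le> length lam" if "i = sum_list (take k lam)" for k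
        using that \<open>1 \<le> i\<close> by (cases k) auto
      then show ?thesis
        by blast
    qed
    finally show ?thesis .
  qed
  then show ?thesis
    unfolding parabolic_indices_def by auto
qed

lemma sorted_word_base_word: "sorted_word n lam (base_word lam)"
  by (unfold_locales) (auto simp: base_word_mono parabolic_indices_base_word)

lemma finite_cells [simp]: "finite (cells lam)"
  by (rule finite_subset[of _ "{..<Max (insert 0 (set lam))} \<times> {..<length lam}"])
    (auto simp: cells_def less_le_trans[OF _ Max_ge])

lemma card_cells: "card (cells lam) = sum_list lam"
proof -
  have "cells lam = prod.swap ` (SIGMA k:{..<length lam}. {..<lam ! k})"
    by (auto simp: cells_def image_iff)
  then have "card (cells lam) = card (SIGMA k:{..<length lam}. {..<lam ! k})"
    by (simp add: card_image)
  also have "\<dots> = (\<Sum>k<length lam. lam ! k)"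
    by (subst card_SigmaI) auto
  finally show ?thesis
    by (simp add: sum_list_sum_nth atLeast0LessThan)
qed

text \<open>In a weakly decreasing list the entries above r form an initial segment.\<close>

lemma length_filter_partition:
  fixes lam :: "nat list"
  assumes "sorted_wrt (\<ge>) lam"
  shows "k < length (filter (\<lambda>x. r < x) lam) \<longleftrightarrow> k < length lam \<and> r < lam ! k"
  using assms
proof (induction lam arbitrary: k)
  case (Cons x lam)
  show ?case
  proof (cases "r < x")
    case True
    then show ?thesis
      using Cons by (cases k) auto
  next
    case False
    have "\<forall>y\<in>set lam. y \<le> x"
      using Cons.prems by simp
    then have "\<forall>y\<in>set lam. \<not> r < y"
      using False by (meson less_le_trans)
    then have "filter (\<lambda>x. r < x) (x # lam) = []" "\<not> r < (x # lam) ! k" if "k < length (x # lam)"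
      using False that by (auto simp: filter_empty_conv nth_Cons split: nat.splits)
    then show ?thesis
      using False \<open>\<forall>y\<in>set lam. \<not> r < y\<close> by (auto simp: filter_empty_conv)
  qed
qed simp

lemma length_conjugate: "length (conjugate lam) = (if lam = [] then 0 else hd lam)"
  by (simp add: conjugate_def)

lemma nth_conjugate: "r < length (conjugate lam) \<Longrightarrow> conjugate lam ! r = length (filter (\<lambda>x. r < x) lam)"
  by (simp add: conjugate_def length_conjugate)

lemma partition_nth_le_hd: "sorted_wrt (\<ge>) lam \<Longrightarrow> k < length lam \<Longrightarrow> lam ! k \<le> (hd lam :: nat)"
  by (cases lam; cases k) auto

lemma cells_conjugate:
  assumes "is_partition n lam"
  shows "(r, k) \<in> cells lam \<longleftrightarrow> r < length (conjugate lam) \<and> k < conjugate lam ! r"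
proof -
  have s: "sorted_wrt (\<ge>) lam"
    using assms by (simp add: is_partition_def)
  show ?thesis
  proof (cases "r < length (conjugate lam)")
    case True
    then show ?thesis
      using length_filter_partition[OF s, of k r] nth_conjugate[OF True] by (auto simp: cells_def)
  next
    case False
    then show ?thesis
      using partition_nth_le_hd[OF s, of k] by (auto simp: cells_def length_conjugate split: if_splits)
  qed
qed

lemma is_partition_conjugate:
  assumes "is_partition n lam"
  shows "is_partition n (conjugate lam)"
proof -
  have s: "sorted_wrt (\<ge>) lam" and sum: "sum_list lam = n"
    using assms by (auto simp: is_partition_def)
  have anti: "length (filter (\<lambda>x. j < x) lam) \<le> length (filter (\<lambda>x. i < x) lam)" if "i \<le> j" for i j :: nat
    using that by (induction lam) auto
  have "sorted_wrt (\<ge>) (conjugate lam)"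
    using anti by (auto simp: sorted_wrt_iff_nth_less nth_conjugate)
  moreover have "\<forall>k\<in>set (conjugate lam). k > 0"
  proof
    fix k assume "k \<in> set (conjugate lam)"
    then obtain r where r: "r < length (conjugate lam)" "k = length (filter (\<lambda>x. r < x) lam)"
      by (metis in_set_conv_nth nth_conjugate)
    then have "hd lam \<in> set (filter (\<lambda>x. r < x) lam)"
      by (auto simp: length_conjugate split: if_splits)
    then show "k > 0"
      unfolding r(2) by (metis length_pos_if_in_set)
  qed
  moreover have "sum_list (conjugate lam) = n"
  proof -
    \<comment> \<open>Double counting of the pairs of an entry x and a number r below it. Any common
      bound h of the entries serves, so that the induction can drop the head.\<close>
    have "(\<Sum>r<h. length (filter (\<lambda>x. r < x) xs)) = sum_list xs" if "\<forall>x\<in>set xs. x \<le> h" for h :: nat and xs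
      using that
    proof (induction xs)
      case (Cons x xs)
      have "(\<Sum>r<h. length (filter (\<lambda>y. r < y) (x # xs))) =
          (\<Sum>r<h. (if r < x then 1 else 0) + length (filter (\<lambda>y. r < y) xs))"
        by (intro sum.cong) auto
      also have "\<dots> = card ({..<h} \<inter> {r. r < x}) + sum_list xs"
        using Cons by (simp add: sum.distrib sum.If_cases)
      also have "{..<h} \<inter> {r. r < x} = {..<x}"
        using Cons.prems by auto
      finally show ?case
        by simp
    qed simp
    moreover have "\<forall>x\<in>set lam. x \<le> length (conjugate lam)"
      using partition_nth_le_hd[OF s] by (auto simp: length_conjugate in_set_conv_nth)
    moreover have "sum_list (conjugate lam) = (\<Sum>r<length (conjugate lam). length (filter (\<lambda>x. r < x) lam))"
      unfolding sum_list_sum_nth atLeast0LessThan by (intro sum.cong) (auto simp: nth_conjugate)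
    ultimately show ?thesis
      using sum by simp
  qed
  ultimately show ?thesis
    by (simp add: is_partition_def)
qed

text \<open>Strands of one colour never meet, so their order from bottom to top is the same at every
  level. The rank in this order is the row and the colour is the column, which labels a strand
  independently of the level.\<close>

definition cell :: "(nat \<Rightarrow> nat) \<Rightarrow> nat \<Rightarrow> nat \<times> nat" where
  "cell c x = (card {y \<in> {1..<x}. c y = c x}, c x)"

lemma snd_cell [simp]: "snd (cell c x) = c x"
  by (simp add: cell_def)

lemma fst_cell_less:
  assumes "1 \<le> x" "x < y" "c x = c y"
  shows "fst (cell c x) < fst (cell c y)"
proof -
  have "{z \<in> {1..<x}. c z = c x} \<subset> {z \<in> {1..<y}. c z = c y}"
    using assms by (intro psubsetI) auto
  then show ?thesis
    unfolding cell_def fst_conv by (intro psubset_card_mono) auto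
qed

lemma fst_cell_less_iff:
  assumes "1 \<le> x" "1 \<le> y" "c x = c y"
  shows "fst (cell c x) < fst (cell c y) \<longleftrightarrow> x < y"
  using fst_cell_less[of x y c] fst_cell_less[of y x c] assms by (metis less_asym' linorder_neqE_nat)

text \<open>Rows increase strictly along a colour, which gives injectivity; the multiplicity of the
  colour bounds the row; and both sets have n elements.\<close>

lemma bij_betw_cell:
  assumes "c \<in> rearrangements n (base_word lam)" "sum_list lam = n"
  shows "bij_betw (cell c) {1..n} (cells lam)"
proof -
  have inj: "inj_on (cell c) {1..n}"
  proof (rule linorder_inj_onI')
    fix x y assume "x \<in> {1..n}" "y \<in> {1..n}" "x < y"
    then show "cell c x \<noteq> cell c y"
      using fst_cell_less[of x y c] by (metis atLeastAtMost_iff nat_neq_iff snd_cell)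
  qed
  obtain u where u: "u permutes {1..n}" "c = base_word lam \<circ> u"
    using assms(1) by (auto simp: rearrangements_def)
  have cell_in: "cell c x \<in> cells lam" if x: "x \<in> {1..n}" for x
  proof -
    have ux: "u x \<in> {1..n}"
      using permutes_in_image[OF u(1)] x by blast
    have k: "c x < length lam"
      using base_word_interval(1)[of "u x" lam] ux u(2) assms(2) by simp
    have "{y \<in> {1..n}. c y = c x} = u -` {z \<in> {1..n}. base_word lam z = c x}"
      using permutes_in_image[OF u(1)] u(2) by auto
    then have "card {y \<in> {1..n}. c y = c x} = card {z \<in> {1..n}. base_word lam z = c x}"
      using card_vimage_inj[OF permutes_inj[OF u(1)]] permutes_surj[OF u(1)] by (metis subset_UNIV)
    also have "\<dots> = lam ! c x"
      using base_word_content[OF k] assms(2) by simp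
    finally have n: "card {y \<in> {1..n}. c y = c x} = lam ! c x" .
    have "{y \<in> {1..<x}. c y = c x} \<subset> {y \<in> {1..n}. c y = c x}"
      using x by (intro psubsetI) auto
    then have "card {y \<in> {1..<x}. c y = c x} < lam ! c x"
      unfolding n[symmetric] by (intro psubset_card_mono) auto
    then show ?thesis
      using k by (simp add: cell_def cells_def)
  qed
  then have "cell c ` {1..n} \<subseteq> cells lam"
    by blast
  moreover have "card (cell c ` {1..n}) = card (cells lam)"
    using inj assms(2) by (simp add: card_image card_cells)
  ultimately have "cell c ` {1..n} = cells lam"
    by (intro card_subset_eq) auto
  then show ?thesis
    using inj by (simp add: bij_betw_def)
qed

section \<open>Path families in star networks\<close>

text \<open>The strict inequality excludes one-point intervals, whose factor has no interior
  vertex.\<close>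

definition passes :: "(nat \<times> nat) list \<Rightarrow> nat \<Rightarrow> nat \<Rightarrow> bool" where
  "passes Js p i \<longleftrightarrow> fst (Js ! p) < snd (Js ! p) \<and> fst (Js ! p) \<le> i \<and> i \<le> snd (Js ! p)"

text \<open>A path is recorded by its heights at the successive columns. By
  \<open>walk_is_path_from\<close> every path from a source to a sink arises in this way.\<close>

definition strand :: "nat \<Rightarrow> (nat \<times> nat) list \<Rightarrow> (nat \<Rightarrow> nat) \<Rightarrow> bool" where
  "strand n Js f \<longleftrightarrow> (\<forall>p\<le>length Js. f p \<in> {1..n}) \<and>
     (\<forall>p<length Js. if passes Js p (f p) then passes Js p (f (Suc p)) else f (Suc p) = f p)"

definition path_node :: "(nat \<times> nat) list \<Rightarrow> (nat \<Rightarrow> nat) \<Rightarrow> nat \<Rightarrow> vertex list" where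
  "path_node Js f p = Col p (f p) # (if passes Js p (f p) then [Centre p] else [])"

definition path_from :: "(nat \<times> nat) list \<Rightarrow> nat \<Rightarrow> (nat \<Rightarrow> nat) \<Rightarrow> vertex list" where
  "path_from Js p f = concat (map (path_node Js f) [p..<length Js]) @ [Col (length Js) (f (length Js))]"

definition path_arcs :: "(nat \<times> nat) list \<Rightarrow> (nat \<Rightarrow> nat) \<Rightarrow> nat \<Rightarrow> (vertex \<times> vertex) list" where
  "path_arcs Js f p = (if passes Js p (f p)
     then [(Col p (f p), Centre p), (Centre p, Col (Suc p) (f (Suc p)))]
     else [(Col p (f p), Col (Suc p) (f (Suc p)))])"

lemma path_from_step: "p < length Js \<Longrightarrow> path_from Js p f = path_node Js f p @ path_from Js (Suc p) f"
  by (simp add: path_from_def upt_conv_Cons)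

lemma path_from_last: "path_from Js (length Js) f = [Col (length Js) (f (length Js))]"
  by (simp add: path_from_def)

lemma path_from_not_Nil [simp]: "path_from Js p f \<noteq> []"
  by (simp add: path_from_def)

lemma hd_path_from: "p \<le> length Js \<Longrightarrow> hd (path_from Js p f) = Col p (f p)"
  by (cases "p = length Js") (simp_all add: path_from_last path_from_step path_node_def)

lemma last_path_from: "last (path_from Js p f) = Col (length Js) (f (length Js))"
  by (simp add: path_from_def)

lemma Col_in_path_from:
  "Col q i \<in> set (path_from Js p f) \<longleftrightarrow> (p \<le> q \<and> q < length Js \<or> q = length Js) \<and> i = f q"
  by (auto simp: path_from_def path_node_def)

lemma Centre_in_path_from:
  "Centre q \<in> set (path_from Js p f) \<longleftrightarrow> p \<le> q \<and> q < length Js \<and> passes Js q (f q)"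
  by (auto simp: path_from_def path_node_def)

lemma path_from_cong:
  assumes "\<And>q. p \<le> q \<Longrightarrow> q \<le> length Js \<Longrightarrow> f q = g q" "p \<le> length Js"
  shows "path_from Js p f = path_from Js p g"
  unfolding path_from_def using assms by (auto simp: path_node_def intro!: arg_cong[of _ _ concat])

lemma distinct_path_from: "p \<le> length Js \<Longrightarrow> distinct (path_from Js p f)"
proof (induction p rule: inc_induct)
  case (step p)
  then show ?case
    by (auto simp: path_from_step path_node_def Col_in_path_from Centre_in_path_from)
qed (simp add: path_from_last)

lemma vwalk_arcs_path_from:
  "p \<le> length Js \<Longrightarrow> vwalk_arcs (path_from Js p f) = concat (map (path_arcs Js f) [p..<length Js])"
proof (induction p rule: inc_induct)
  case (step p)
  obtain t where t: "path_from Js (Suc p) f = Col (Suc p) (f (Suc p)) # t"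
    using hd_path_from[of "Suc p" Js f] step.hyps by (cases "path_from Js (Suc p) f") auto
  have "vwalk_arcs (path_from Js p f) = path_arcs Js f p @ vwalk_arcs (path_from Js (Suc p) f)"
    unfolding path_from_step[OF step.hyps(2)] t by (simp add: path_node_def path_arcs_def)
  then show ?case
    using step by (simp add: upt_conv_Cons)
qed (simp add: path_from_last)

lemma distinct_vwalk_arcs: "distinct xs \<Longrightarrow> distinct (vwalk_arcs xs)"
proof (induction xs rule: vwalk_arcs.induct)
  case (3 x y xs)
  have "fst e \<in> set ys" if "e \<in> set (vwalk_arcs ys)" for e :: "'a \<times> 'a" and ys
    using that by (induction ys rule: vwalk_arcs.induct) auto
  from this[of "(x, y)" "y # xs"] show ?case
    using 3 by auto
qed auto

definition valid_intervals :: "nat \<Rightarrow> (nat \<times> nat) list \<Rightarrow> bool" where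
  "valid_intervals n Js \<longleftrightarrow> (\<forall>(a, b)\<in>set Js. 1 \<le> a \<and> a \<le> b \<and> b \<le> n)"

lemma passes_bounds:
  assumes "valid_intervals n Js" "p < length Js" "passes Js p i"
  shows "i \<in> {1..n}"
proof -
  have "Js ! p \<in> set Js"
    using assms(2) by simp
  then have "1 \<le> fst (Js ! p)" "snd (Js ! p) \<le> n"
    using assms(1) unfolding valid_intervals_def by fastforce+
  then show ?thesis
    using assms(3) by (auto simp: passes_def)
qed

lemma parcs_star_network:
  assumes "valid_intervals n Js"
  shows "e \<in> parcs (star_network n Js) \<longleftrightarrow> (\<exists>p<length Js. \<exists>i\<in>{1..n}.
    (passes Js p i \<and> (e = (Col p i, Centre p) \<or> e = (Centre p, Col (Suc p) i))) \<or>
    (\<not> passes Js p i \<and> e = (Col p i, Col (Suc p) i)))"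
proof -
  have "e \<in> star_arcs n p (Js ! p) \<longleftrightarrow> (\<exists>i\<in>{1..n}.
    (passes Js p i \<and> (e = (Col p i, Centre p) \<or> e = (Centre p, Col (Suc p) i))) \<or>
    (\<not> passes Js p i \<and> e = (Col p i, Col (Suc p) i)))" if p: "p < length Js" for p
  proof -
    obtain a b where J: "Js ! p = (a, b)"
      by (cases "Js ! p")
    then have "(a, b) \<in> set Js"
      using p by (metis nth_mem)
    then have ab: "1 \<le> a" "b \<le> n"
      using assms unfolding valid_intervals_def by auto
    show ?thesis
    proof (cases "a < b")
      case True
      have "i \<in> {a..b} \<longleftrightarrow> i \<in> {1..n} \<and> passes Js p i" "i \<in> {1..n} - {a..b} \<longleftrightarrow> i \<in> {1..n} \<and> \<not> passes Js p i" for i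
        using ab True by (auto simp: passes_def J)
      then show ?thesis
        unfolding J star_arcs.simps using True by auto
    next
      case False
      then show ?thesis
        unfolding J star_arcs.simps by (auto simp: passes_def J)
    qed
  qed
  then show ?thesis
    unfolding star_network_def pair_pre_digraph.select_convs by blast
qed

lemma pverts_star_network:
  assumes "valid_intervals n Js"
  shows "Col p i \<in> pverts (star_network n Js) \<longleftrightarrow> p \<le> length Js \<and> i \<in> {1..n}"
    and "p < length Js \<Longrightarrow> passes Js p i \<Longrightarrow> Centre p \<in> pverts (star_network n Js)"
proof -
  have v: "Col q j \<in> star_verts n p J \<longleftrightarrow> (q = p \<or> q = Suc p) \<and> j \<in> {1..n}" for q j p J
    by (cases J) auto
  have "Col p i \<in> pverts (star_network n Js) \<longleftrightarrow> (p = 0 \<or> (\<exists>q<length Js. p = q \<or> p = Suc q)) \<and> i \<in> {1..n}"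
    unfolding star_network_def pair_pre_digraph.select_convs using v by auto
  moreover have "p = 0 \<or> (\<exists>q<length Js. p = q \<or> p = Suc q) \<longleftrightarrow> p \<le> length Js"
    by (cases p) (auto simp: Suc_le_eq)
  ultimately show "Col p i \<in> pverts (star_network n Js) \<longleftrightarrow> p \<le> length Js \<and> i \<in> {1..n}"
    by blast
  show "Centre p \<in> pverts (star_network n Js)" if "p < length Js" "passes Js p i"
  proof -
    have "Centre p \<in> star_verts n p (Js ! p)"
      using that(2) by (cases "Js ! p") (auto simp: passes_def)
    then show ?thesis
      unfolding star_network_def pair_pre_digraph.select_convs using that(1) by blast
  qed
qed

lemma path_arcs_subset:
  assumes "valid_intervals n Js" "strand n Js f" "p < length Js"
  shows "set (path_arcs Js f p) \<subseteq> parcs (star_network n Js)"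
proof -
  have "f p \<in> {1..n}" "f (Suc p) \<in> {1..n}" "if passes Js p (f p) then passes Js p (f (Suc p)) else f (Suc p) = f p"
    using assms(2,3) unfolding strand_def by (meson Suc_leI less_imp_le)+
  then show ?thesis
    using assms(3) unfolding path_arcs_def by (auto simp: parcs_star_network[OF assms(1)] split: if_splits)
qed

lemma vpath_path_from:
  assumes "valid_intervals n Js" "strand n Js f"
  shows "vpath (path_from Js 0 f) (with_proj (star_network n Js))"
proof -
  have "set (path_from Js 0 f) \<subseteq> pverts (star_network n Js)"
  proof
    fix v assume v: "v \<in> set (path_from Js 0 f)"
    show "v \<in> pverts (star_network n Js)"
    proof (cases v)
      case (Col p i)
      then show ?thesis
        using v assms(2) pverts_star_network(1)[OF assms(1)]
        by (auto simp: Col_in_path_from strand_def)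
    next
      case (Centre p)
      then show ?thesis
        using v pverts_star_network(2)[OF assms(1)] by (auto simp: Centre_in_path_from)
    qed
  qed
  moreover have "set (vwalk_arcs (path_from Js 0 f)) \<subseteq> parcs (star_network n Js)"
    using path_arcs_subset[OF assms] by (fastforce simp: vwalk_arcs_path_from)
  ultimately show ?thesis
    unfolding vpath_def vwalk_def using distinct_path_from[of 0 Js f] by simp
qed

text \<open>The network is layered and acyclic, so the walk can be read off factor by factor. The
  induction is over the length of the list, because a star consumes two vertices and a straight edge
  only one.\<close>

lemma walk_is_path_from:
  assumes V: "valid_intervals n Js"
  shows "set (vwalk_arcs P) \<subseteq> parcs (star_network n Js) \<Longrightarrow> P \<noteq> [] \<Longrightarrow> hd P = Col p i \<Longrightarrow>
    last P = Col (length Js) j \<Longrightarrow> p \<le> length Js \<Longrightarrow> i \<in> {1..n} \<Longrightarrow>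
    \<exists>f. P = path_from Js p f \<and> f p = i \<and> f (length Js) = j \<and> (\<forall>q. p \<le> q \<and> q \<le> length Js \<longrightarrow> f q \<in> {1..n}) \<and>
     (\<forall>q. p \<le> q \<and> q < length Js \<longrightarrow> (if passes Js q (f q) then passes Js q (f (Suc q)) else f (Suc q) = f q))"
proof (induction P arbitrary: p i rule: length_induct)
  case (1 P)
  note IH = "1.IH"[rule_format]
  obtain rest where P: "P = Col p i # rest"
    using "1.prems" by (cases P) auto
  note arc = parcs_star_network[OF V]
  show ?case
  proof (cases rest)
    case Nil
    then have "p = length Js" "i = j"
      using "1.prems"(4) P by auto
    then show ?thesis
      using P Nil "1.prems"(6) by (intro exI[of _ "\<lambda>_. i"]) (auto simp: path_from_last)
  next
    case (Cons v rest')
    have a: "(Col p i, v) \<in> parcs (star_network n Js)"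
      using "1.prems"(1) by (simp add: P Cons)
    then have p: "p < length Js"
      unfolding arc by auto
    \<comment> \<open>The heights of the remaining walk from level p+1 on are extended by the height
      i at level p.\<close>
    have glue: ?thesis
      if g: "rest'' = path_from Js (Suc p) g" "P = path_node Js (g(p := i)) p @ rest''"
        "g (length Js) = j" "\<forall>q. Suc p \<le> q \<and> q \<le> length Js \<longrightarrow> g q \<in> {1..n}"
        "\<forall>q. Suc p \<le> q \<and> q < length Js \<longrightarrow> (if passes Js q (g q) then passes Js q (g (Suc q)) else g (Suc q) = g q)"
        "if passes Js p i then passes Js p (g (Suc p)) else g (Suc p) = i" for g rest''
    proof (intro exI[of _ "g(p := i)"] conjI allI impI)
      have "path_from Js (Suc p) g = path_from Js (Suc p) (g(p := i))"
        using p by (intro path_from_cong) auto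
      then show "P = path_from Js p (g(p := i))"
        using g(1,2) p by (simp add: path_from_step)
      show "(g(p := i)) (length Js) = j"
        using p g(3) by simp
      show "(g(p := i)) q \<in> {1..n}" if "p \<le> q \<and> q \<le> length Js" for q
        using that g(4) "1.prems"(6) by (cases "q = p") auto
      show "if passes Js q ((g(p := i)) q) then passes Js q ((g(p := i)) (Suc q)) else (g(p := i)) (Suc q) = (g(p := i)) q"
        if "p \<le> q \<and> q < length Js" for q
        using that g(5,6) by (cases "q = p") auto
    qed simp
    show ?thesis
    proof (cases "passes Js p i")
      case True
      then have v: "v = Centre p"
        using a unfolding arc by auto
      then obtain u rest'' where r: "rest' = u # rest''"
        using "1.prems"(4) P Cons by (cases rest') auto
      have "(Centre p, u) \<in> parcs (star_network n Js)"
        using "1.prems"(1) by (simp add: P Cons v r)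
      then obtain k where k: "u = Col (Suc p) k" "passes Js p k" "k \<in> {1..n}"
        unfolding arc by auto
      obtain g where "rest' = path_from Js (Suc p) g" "g (Suc p) = k" "g (length Js) = j"
        "\<forall>q. Suc p \<le> q \<and> q \<le> length Js \<longrightarrow> g q \<in> {1..n}"
        "\<forall>q. Suc p \<le> q \<and> q < length Js \<longrightarrow> (if passes Js q (g q) then passes Js q (g (Suc q)) else g (Suc q) = g q)"
        using IH[of rest' "Suc p" k] "1.prems" p k r P Cons v by auto
      then show ?thesis
        using True k P Cons v by (intro glue[of rest' g]) (auto simp: path_node_def)
    next
      case False
      then have v: "v = Col (Suc p) i"
        using a unfolding arc by auto
      obtain g where "rest = path_from Js (Suc p) g" "g (Suc p) = i" "g (length Js) = j"
        "\<forall>q. Suc p \<le> q \<and> q \<le> length Js \<longrightarrow> g q \<in> {1..n}"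
        "\<forall>q. Suc p \<le> q \<and> q < length Js \<longrightarrow> (if passes Js q (g q) then passes Js q (g (Suc q)) else g (Suc q) = g q)"
        using IH[of rest "Suc p" i] "1.prems" p P Cons v by auto
      then show ?thesis
        using False P by (intro glue[of rest g]) (auto simp: path_node_def)
    qed
  qed
qed

lemma path_family_iff:
  assumes V: "valid_intervals n Js"
  shows "path_family n Js w ps \<longleftrightarrow> (\<exists>F. ps = map (\<lambda>i. path_from Js 0 (F i)) [1..<Suc n] \<and>
    (\<forall>i\<in>{1..n}. strand n Js (F i) \<and> F i 0 = i \<and> F i (length Js) = w i))"
proof
  assume pf: "path_family n Js w ps"
  have "\<forall>i\<in>{1..n}. \<exists>f. ps ! (i - 1) = path_from Js 0 f \<and> strand n Js f \<and> f 0 = i \<and> f (length Js) = w i"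
  proof
    fix i assume i: "i \<in> {1..n}"
    let ?P = "ps ! (i - 1)"
    have "vpath ?P (with_proj (star_network n Js))" "hd ?P = Col 0 i" "last ?P = Col (length Js) (w i)"
      using pf i unfolding path_family_def by blast+
    then show "\<exists>f. ?P = path_from Js 0 f \<and> strand n Js f \<and> f 0 = i \<and> f (length Js) = w i"
      using walk_is_path_from[OF V, of ?P 0 i "w i"] i unfolding vpath_def vwalk_def strand_def by auto
  qed
  from bchoice[OF this] obtain F where F: "\<And>i. i \<in> {1..n} \<Longrightarrow> ps ! (i - 1) = path_from Js 0 (F i)"
    "\<forall>i\<in>{1..n}. strand n Js (F i) \<and> F i 0 = i \<and> F i (length Js) = w i"
    by blast
  have "ps = map (\<lambda>i. path_from Js 0 (F i)) [1..<Suc n]"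
  proof (rule nth_equalityI)
    show "length ps = length (map (\<lambda>i. path_from Js 0 (F i)) [1..<Suc n])"
      using pf by (simp add: path_family_def)
    fix i assume "i < length ps"
    then have "i < n"
      using pf by (simp add: path_family_def)
    then show "ps ! i = map (\<lambda>i. path_from Js 0 (F i)) [1..<Suc n] ! i"
      using F(1)[of "Suc i"] by (simp del: upt_Suc)
  qed
  then show "\<exists>F. ps = map (\<lambda>i. path_from Js 0 (F i)) [1..<Suc n] \<and>
    (\<forall>i\<in>{1..n}. strand n Js (F i) \<and> F i 0 = i \<and> F i (length Js) = w i)"
    using F(2) by blast
next
  assume "\<exists>F. ps = map (\<lambda>i. path_from Js 0 (F i)) [1..<Suc n] \<and>
    (\<forall>i\<in>{1..n}. strand n Js (F i) \<and> F i 0 = i \<and> F i (length Js) = w i)"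
  then obtain F where ps: "ps = map (\<lambda>i. path_from Js 0 (F i)) [1..<Suc n]"
    and F: "\<forall>i\<in>{1..n}. strand n Js (F i) \<and> F i 0 = i \<and> F i (length Js) = w i"
    by blast
  show "path_family n Js w ps"
    unfolding path_family_def
  proof (intro conjI ballI)
    fix i assume i: "i \<in> {1..n}"
    then have "ps ! (i - 1) = path_from Js 0 (F i)"
      unfolding ps using nth_map_upt[of "i - 1" "Suc n" 1 "\<lambda>i. path_from Js 0 (F i)"]
      by (auto simp del: upt_Suc)
    then show "vpath (ps ! (i - 1)) (with_proj (star_network n Js))" "hd (ps ! (i - 1)) = Col 0 i"
      "last (ps ! (i - 1)) = Col (length Js) (w i)"
      using F i vpath_path_from[OF V] by (auto simp: hd_path_from last_path_from)
  qed (simp add: ps)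
qed

lemma count_list_concat: "count_list (concat xss) e = (\<Sum>xs\<leftarrow>xss. count_list xs e)"
  by (induction xss) auto

lemma count_list_distinct: "distinct xs \<Longrightarrow> count_list xs e = (if e \<in> set xs then 1 else 0)"
  by (induction xs) auto

lemma count_arcs:
  assumes "\<And>i. i \<in> {1..n} \<Longrightarrow> e \<in> set (vwalk_arcs (path_from Js 0 (F i))) \<longleftrightarrow> Q i"
  shows "count_list (concat (map vwalk_arcs (map (\<lambda>i. path_from Js 0 (F i)) [1..<Suc n]))) e = card {i \<in> {1..n}. Q i}"
proof -
  have d: "distinct (vwalk_arcs (path_from Js 0 f))" for f
    using distinct_vwalk_arcs distinct_path_from by blast
  have "count_list (concat (map vwalk_arcs (map (\<lambda>i. path_from Js 0 (F i)) [1..<Suc n]))) e =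
      (\<Sum>i\<leftarrow>[1..<Suc n]. if e \<in> set (vwalk_arcs (path_from Js 0 (F i))) then 1 else 0)"
    unfolding count_list_concat map_map o_def count_list_distinct[OF d] ..
  also have "\<dots> = (\<Sum>i\<in>{1..n}. if Q i then 1 else 0)"
    unfolding interv_sum_list_conv_sum_set_nat using assms
    by (auto simp: atLeastLessThanSuc_atLeastAtMost simp del: upt_Suc intro!: sum.cong)
  also have "\<dots> = card {i \<in> {1..n}. Q i}"
    by (simp add: sum.If_cases Int_def)
  finally show ?thesis .
qed

lemma arc_in_path_from:
  "e \<in> set (vwalk_arcs (path_from Js 0 f)) \<longleftrightarrow> (\<exists>p<length Js. e \<in> set (path_arcs Js f p))"
  by (auto simp: vwalk_arcs_path_from)

text \<open>An edge that leaves a column is used by exactly the strands at its height there, so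
  covering says that each height is taken once at every level with outgoing edges. For the last
  level this comes from the injectivity assumed of the end points. Conversely, an edge from a centre
  is counted at the column that it enters.\<close>

lemma covers_iff:
  assumes V: "valid_intervals n Js" and F: "\<And>i. i \<in> {1..n} \<Longrightarrow> strand n Js (F i)"
    and last: "inj_on (\<lambda>i. F i (length Js)) {1..n}"
  shows "covers n Js (map (\<lambda>i. path_from Js 0 (F i)) [1..<Suc n]) \<longleftrightarrow>
    (\<forall>p\<le>length Js. bij_betw (\<lambda>i. F i p) {1..n} {1..n})"
proof -
  let ?C = "\<lambda>e. count_list (concat (map vwalk_arcs (map (\<lambda>i. path_from Js 0 (F i)) [1..<Suc n]))) e"
  have st: "F i p \<in> {1..n}" "if passes Js q (F i q) then passes Js q (F i (Suc q)) else F i (Suc q) = F i q"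
    if "i \<in> {1..n}" "p \<le> length Js" "q < length Js" for i p q
    using F[OF that(1)] that(2,3) unfolding strand_def by blast+
  have out1: "?C (Col p x, Centre p) = card {i \<in> {1..n}. F i p = x}" if "p < length Js" "passes Js p x" for p x
    by (rule count_arcs) (use that in \<open>auto simp: arc_in_path_from path_arcs_def split: if_splits\<close>)
  have out2: "?C (Col p x, Col (Suc p) x) = card {i \<in> {1..n}. F i p = x}" if "p < length Js" "\<not> passes Js p x" for p x
  proof (rule count_arcs)
    fix i assume "i \<in> {1..n}"
    from st(2)[OF this le_refl that(1)]
    show "(Col p x, Col (Suc p) x) \<in> set (vwalk_arcs (path_from Js 0 (F i))) \<longleftrightarrow> F i p = x"
      using that by (auto simp: arc_in_path_from path_arcs_def split: if_splits)
  qed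
  have in1: "?C (Centre p, Col (Suc p) x) = card {i \<in> {1..n}. F i (Suc p) = x}" if "p < length Js" "passes Js p x" for p x
  proof (rule count_arcs)
    fix i assume "i \<in> {1..n}"
    from st(2)[OF this le_refl that(1)]
    show "(Centre p, Col (Suc p) x) \<in> set (vwalk_arcs (path_from Js 0 (F i))) \<longleftrightarrow> F i (Suc p) = x"
      using that by (auto simp: arc_in_path_from path_arcs_def split: if_splits)
  qed
  have one: "(\<forall>x\<in>{1..n}. card {i \<in> {1..n}. F i p = x} = 1) \<longleftrightarrow> bij_betw (\<lambda>i. F i p) {1..n} {1..n}" if p: "p \<le> length Js" for p
  proof
    assume *: "\<forall>x\<in>{1..n}. card {i \<in> {1..n}. F i p = x} = 1"
    have "x \<in> (\<lambda>i. F i p) ` {1..n}" if "x \<in> {1..n}" for x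
    proof -
      have "{i \<in> {1..n}. F i p = x} \<noteq> {}"
        using * that by (metis card.empty zero_neq_one)
      then show ?thesis
        by blast
    qed
    moreover have "F i p \<in> {1..n}" if "i \<in> {1..n}" for i
      using F[OF that] p unfolding strand_def by blast
    ultimately have im: "(\<lambda>i. F i p) ` {1..n} = {1..n}"
      by blast
    moreover have "inj_on (\<lambda>i. F i p) {1..n}"
      using im by (intro eq_card_imp_inj_on) auto
    ultimately show "bij_betw (\<lambda>i. F i p) {1..n} {1..n}"
      unfolding bij_betw_def by blast
  next
    assume b: "bij_betw (\<lambda>i. F i p) {1..n} {1..n}"
    show "\<forall>x\<in>{1..n}. card {i \<in> {1..n}. F i p = x} = 1"
    proof
      fix x assume "x \<in> {1..n}"
      then have "x \<in> (\<lambda>i. F i p) ` {1..n}"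
        unfolding bij_betw_imp_surj_on[OF b] .
      then obtain i where i: "i \<in> {1..n}" "F i p = x"
        by (metis imageE)
      have "j = i" if "j \<in> {1..n}" "F j p = x" for j
        using inj_onD[OF bij_betw_imp_inj_on[OF b], of j i] that i by simp
      then have "{i \<in> {1..n}. F i p = x} = {i}"
        using i by blast
      then show "card {i \<in> {1..n}. F i p = x} = 1"
        by simp
    qed
  qed
  have lastbij: "bij_betw (\<lambda>i. F i (length Js)) {1..n} {1..n}"
  proof -
    have "F i (length Js) \<in> {1..n}" if "i \<in> {1..n}" for i
      using F[OF that] unfolding strand_def by blast
    then have "(\<lambda>i. F i (length Js)) ` {1..n} = {1..n}"
      using last by (intro card_subset_eq) (auto simp: card_image)
    then show ?thesis
      using last unfolding bij_betw_def by blast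
  qed
  show ?thesis
  proof
    assume c: "covers n Js (map (\<lambda>i. path_from Js 0 (F i)) [1..<Suc n])"
    show "\<forall>p\<le>length Js. bij_betw (\<lambda>i. F i p) {1..n} {1..n}"
    proof (intro allI impI)
      fix p assume "p \<le> length Js"
      show "bij_betw (\<lambda>i. F i p) {1..n} {1..n}"
      proof (cases "p = length Js")
        case False
        then have p: "p < length Js"
          using \<open>p \<le> length Js\<close> by simp
        have "card {i \<in> {1..n}. F i p = x} = 1" if x: "x \<in> {1..n}" for x
        proof (cases "passes Js p x")
          case True
          then have "(Col p x, Centre p) \<in> parcs (star_network n Js)"
            using p x unfolding parcs_star_network[OF V] by blast
          then show ?thesis
            using c out1[OF p True] unfolding covers_def by simp
        next
          case False
          then have "(Col p x, Col (Suc p) x) \<in> parcs (star_network n Js)"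
            using p x unfolding parcs_star_network[OF V] by blast
          then show ?thesis
            using c out2[OF p False] unfolding covers_def by simp
        qed
        then show ?thesis
          using one[OF \<open>p \<le> length Js\<close>] by blast
      qed (use lastbij in simp)
    qed
  next
    assume b: "\<forall>p\<le>length Js. bij_betw (\<lambda>i. F i p) {1..n} {1..n}"
    then have c1: "card {i \<in> {1..n}. F i p = x} = 1" if "p \<le> length Js" "x \<in> {1..n}" for p x
      using one that by blast
    show "covers n Js (map (\<lambda>i. path_from Js 0 (F i)) [1..<Suc n])"
      unfolding covers_def
    proof
      fix e assume "e \<in> parcs (star_network n Js)"
      then obtain p x where px: "p < length Js" "x \<in> {1..n}"
        and e: "(passes Js p x \<and> (e = (Col p x, Centre p) \<or> e = (Centre p, Col (Suc p) x))) \<or>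
          (\<not> passes Js p x \<and> e = (Col p x, Col (Suc p) x))"
        unfolding parcs_star_network[OF V] by blast
      have "card {i \<in> {1..n}. F i p = x} = 1" "card {i \<in> {1..n}. F i (Suc p) = x} = 1"
        using c1[of p x] c1[of "Suc p" x] px by auto
      then show "?C e = 1"
        using e out1[OF px(1)] out2[OF px(1)] in1[OF px(1)] by metis
    qed
  qed
qed

section \<open>Closed chains and column-strict tableaux\<close>

lemma star_chains_iff:
  "cs \<in> star_chains Js c \<longleftrightarrow> length cs = Suc (length Js) \<and> cs ! 0 = c \<and>
     (\<forall>p<length Js. star_step (Js ! p) (cs ! p) (cs ! Suc p))"
proof (induction Js arbitrary: cs c)
  case Nil
  show ?case
    by (cases cs) auto
next
  case (Cons J Js)
  show ?case
  proof
    assume "cs \<in> star_chains (J # Js) c"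
    then obtain c' cs' where "star_step J c c'" "cs' \<in> star_chains Js c'" "cs = c # cs'"
      by auto
    then show "length cs = Suc (length (J # Js)) \<and> cs ! 0 = c \<and>
        (\<forall>p<length (J # Js). star_step ((J # Js) ! p) (cs ! p) (cs ! Suc p))"
      using Cons[of cs' c'] by (auto simp: less_Suc_eq_0_disj)
  next
    assume *: "length cs = Suc (length (J # Js)) \<and> cs ! 0 = c \<and>
        (\<forall>p<length (J # Js). star_step ((J # Js) ! p) (cs ! p) (cs ! Suc p))"
    then obtain cs' where cs: "cs = c # cs'"
      by (cases cs) auto
    have "star_step J c (cs' ! 0)"
      using * cs by auto
    moreover have "cs' \<in> star_chains Js (cs' ! 0)"
      unfolding Cons using * cs by auto
    ultimately show "cs \<in> star_chains (J # Js) c"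
      using cs by auto
  qed
qed

lemma chain_weight_eq:
  "length cs = Suc (length Js) \<Longrightarrow> chain_weight Js cs = (\<Sum>p<length Js. step_weight (Js ! p) (cs ! p) (cs ! Suc p))"
proof (induction Js arbitrary: cs)
  case (Cons J Js)
  then obtain c c' cs' where cs: "cs = c # c' # cs'"
    by (metis length_Suc_conv)
  show ?case
    using Cons.IH[of "c' # cs'"] Cons.prems unfolding cs by (simp add: sum.lessThan_Suc_shift del: sum.lessThan_Suc)
qed simp

text \<open>x and y are the heights at which two strands leave the star, \<open>v x\<close> and
  \<open>v y\<close> those at which they enter it. A noncrossing pair has its colours inverted on
  both sides or on neither; a crossing pair is inverted on exactly one side, because its colours are
  distinct.\<close>

lemma step_weight_crossings:
  assumes v: "v permutes {a..b}" and inj: "inj_on c {a..b}"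
  shows "step_weight (a, b) c (c \<circ> v) =
    2 * card {(x, y). x \<in> {a..b} \<and> y \<in> {a..b} \<and> v x < v y \<and> x < y \<and> c (v y) < c (v x)} +
    card {(x, y). x \<in> {a..b} \<and> y \<in> {a..b} \<and> v x < v y \<and> y < x}"
proof -
  define S where "S P = {(x, y). x \<in> {a..b} \<and> y \<in> {a..b} \<and> P x y}" for P :: "nat \<Rightarrow> nat \<Rightarrow> bool"
  have fin: "finite (S P)" for P
    by (rule finite_subset[of _ "{a..b} \<times> {a..b}"]) (auto simp: S_def)
  have split: "card (S P) = card (S (\<lambda>x y. P x y \<and> Q x y)) + card (S (\<lambda>x y. P x y \<and> \<not> Q x y))" for P Q
  proof -
    have "S P = S (\<lambda>x y. P x y \<and> Q x y) \<union> S (\<lambda>x y. P x y \<and> \<not> Q x y)"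
      by (auto simp: S_def)
    moreover have "S (\<lambda>x y. P x y \<and> Q x y) \<inter> S (\<lambda>x y. P x y \<and> \<not> Q x y) = {}"
      by (auto simp: S_def)
    ultimately show ?thesis
      using card_Un_disjoint[OF fin fin] by metis
  qed
  have cong: "S P = S Q" if "\<And>x y. x \<in> {a..b} \<Longrightarrow> y \<in> {a..b} \<Longrightarrow> P x y \<longleftrightarrow> Q x y" for P Q
    using that by (auto simp: S_def)
  have vin: "v x \<in> {a..b} \<longleftrightarrow> x \<in> {a..b}" for x
    using permutes_in_image[OF v] .
  have vinj: "v x = v y \<longleftrightarrow> x = y" for x y
    using permutes_inj[OF v] by (simp add: inj_eq)
  have cinj: "c (v x) = c (v y) \<longleftrightarrow> x = y" if "x \<in> {a..b}" "y \<in> {a..b}" for x y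
    using inj_onD[OF inj, of "v x" "v y"] vin that vinj by blast
  let ?d = "\<lambda>x y. c (v y) < c (v x)"
  have n': "ninv a b (c \<circ> v) = card (S (\<lambda>x y. x < y \<and> ?d x y))"
    unfolding ninv_def inversions_def S_def by (intro arg_cong[of _ _ card]) auto
  have n: "ninv a b c = card (S (\<lambda>x y. v x < v y \<and> ?d x y))"
  proof -
    have "bij_betw (\<lambda>(x, y). (v x, v y)) (S (\<lambda>x y. v x < v y \<and> ?d x y)) (inversions a b c)"
    proof (rule bij_betw_byWitness[where f' = "\<lambda>(x, y). (pinv v x, pinv v y)"])
      have pin: "pinv v x \<in> {a..b} \<longleftrightarrow> x \<in> {a..b}" for x
        using permutes_in_image[OF permutes_inv[OF v]] .
      have "(pinv v x, pinv v y) \<in> S (\<lambda>x y. v x < v y \<and> ?d x y)" if "(x, y) \<in> inversions a b c" for x y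
        unfolding S_def mem_Collect_eq case_prod_conv pin permutes_inverses[OF v]
        using that by (simp add: inversions_def)
      then show "(\<lambda>(x, y). (pinv v x, pinv v y)) ` inversions a b c \<subseteq> S (\<lambda>x y. v x < v y \<and> ?d x y)"
        by auto
      have "(v x, v y) \<in> inversions a b c" if "(x, y) \<in> S (\<lambda>x y. v x < v y \<and> ?d x y)" for x y
      proof -
        have "v x \<in> {a..b}" "v y \<in> {a..b}" "v x < v y" "?d x y"
          using that unfolding S_def mem_Collect_eq case_prod_conv vin by blast+
        then show ?thesis
          by (simp add: inversions_def)
      qed
      then show "(\<lambda>(x, y). (v x, v y)) ` S (\<lambda>x y. v x < v y \<and> ?d x y) \<subseteq> inversions a b c"
        by auto
    qed (auto simp: permutes_inverses[OF v])
    from bij_betw_same_card[OF this] show ?thesis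
      unfolding ninv_def by (rule sym)
  qed
  have s1: "card (S (\<lambda>x y. x < y \<and> ?d x y)) =
      card (S (\<lambda>x y. v x < v y \<and> x < y \<and> ?d x y)) + card (S (\<lambda>x y. v x < v y \<and> y < x \<and> \<not> ?d x y))"
  proof -
    have "S (\<lambda>x y. (x < y \<and> ?d x y) \<and> v x < v y) = S (\<lambda>x y. v x < v y \<and> x < y \<and> ?d x y)"
      by (rule cong) auto
    moreover have "card (S (\<lambda>x y. (x < y \<and> ?d x y) \<and> \<not> v x < v y)) = card (S (\<lambda>x y. v x < v y \<and> y < x \<and> \<not> ?d x y))"
    proof (rule bij_betw_same_card)
      have *: "(x, y) \<in> S (\<lambda>x y. (x < y \<and> ?d x y) \<and> \<not> v x < v y) \<longleftrightarrow> (y, x) \<in> S (\<lambda>x y. v x < v y \<and> y < x \<and> \<not> ?d x y)" for x y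
        using cinj[of x y] vinj[of x y] by (auto simp: S_def not_less)
      show "bij_betw prod.swap (S (\<lambda>x y. (x < y \<and> ?d x y) \<and> \<not> v x < v y)) (S (\<lambda>x y. v x < v y \<and> y < x \<and> \<not> ?d x y))"
        by (rule bij_betw_byWitness[where f' = prod.swap]) (use * in auto)
    qed
    ultimately show ?thesis
      using split[of "\<lambda>x y. x < y \<and> ?d x y" "\<lambda>x y. v x < v y"] by simp
  qed
  have s2: "card (S (\<lambda>x y. v x < v y \<and> ?d x y)) =
      card (S (\<lambda>x y. v x < v y \<and> x < y \<and> ?d x y)) + card (S (\<lambda>x y. v x < v y \<and> y < x \<and> ?d x y))"
  proof -
    have "S (\<lambda>x y. (v x < v y \<and> ?d x y) \<and> x < y) = S (\<lambda>x y. v x < v y \<and> x < y \<and> ?d x y)"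
      by (rule cong) auto
    moreover have "S (\<lambda>x y. (v x < v y \<and> ?d x y) \<and> \<not> x < y) = S (\<lambda>x y. v x < v y \<and> y < x \<and> ?d x y)"
      by (rule cong) (auto simp: not_less le_less)
    ultimately show ?thesis
      using split[of "\<lambda>x y. v x < v y \<and> ?d x y" "\<lambda>x y. x < y"] by simp
  qed
  have s3: "card (S (\<lambda>x y. v x < v y \<and> y < x)) =
      card (S (\<lambda>x y. v x < v y \<and> y < x \<and> ?d x y)) + card (S (\<lambda>x y. v x < v y \<and> y < x \<and> \<not> ?d x y))"
    using split[of "\<lambda>x y. v x < v y \<and> y < x" "?d"] by (simp add: conj_assoc)
  have "step_weight (a, b) c (c \<circ> v) =
      2 * card (S (\<lambda>x y. v x < v y \<and> x < y \<and> ?d x y)) + card (S (\<lambda>x y. v x < v y \<and> y < x))"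
    unfolding step_weight_def fst_conv snd_conv n n' using s1 s2 s3 by linarith
  then show ?thesis
    unfolding S_def .
qed

text \<open>The letters on J are distinct, so for a position in J all equal letters counted below it
  lie below J, where nothing moves. For a position outside J, v permutes the positions below it
  among themselves.\<close>

lemma cell_star_step:
  assumes v: "v permutes {a..b}" and inj: "inj_on c {a..b}" and "1 \<le> a" "1 \<le> x"
  shows "cell (c \<circ> v) x = cell c (v x)"
proof (cases "x \<in> {a..b}")
  case True
  then have vx: "v x \<in> {a..b}"
    using permutes_in_image[OF v] by blast
  have "{y \<in> {1..<x}. (c \<circ> v) y = c (v x)} = {y \<in> {1..<a}. c y = c (v x)}"
  proof (intro equalityI subsetI)
    fix y assume y: "y \<in> {y \<in> {1..<x}. (c \<circ> v) y = c (v x)}"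
    have "y \<notin> {a..b}"
    proof
      assume yJ: "y \<in> {a..b}"
      then have "v y \<in> {a..b}"
        using permutes_in_image[OF v] by blast
      then have "v y = v x"
        using inj_onD[OF inj, of "v y" "v x"] y vx by simp
      then show False
        using y permutes_inj[OF v] by (simp add: inj_eq)
    qed
    then show "y \<in> {y \<in> {1..<a}. c y = c (v x)}"
      using y True permutes_not_in[OF v, of y] by auto
  next
    fix y assume y: "y \<in> {y \<in> {1..<a}. c y = c (v x)}"
    then have "v y = y"
      by (intro permutes_not_in[OF v]) auto
    then show "y \<in> {y \<in> {1..<x}. (c \<circ> v) y = c (v x)}"
      using y True by auto
  qed
  moreover have "{y \<in> {1..<v x}. c y = c (v x)} = {y \<in> {1..<a}. c y = c (v x)}"
  proof (intro equalityI subsetI)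
    fix y assume y: "y \<in> {y \<in> {1..<v x}. c y = c (v x)}"
    have "y \<notin> {a..b}"
      using inj_onD[OF inj, of y "v x"] y vx by auto
    then show "y \<in> {y \<in> {1..<a}. c y = c (v x)}"
      using y vx by auto
  next
    fix y assume "y \<in> {y \<in> {1..<a}. c y = c (v x)}"
    then show "y \<in> {y \<in> {1..<v x}. c y = c (v x)}"
      using vx by auto
  qed
  ultimately show ?thesis
    unfolding cell_def by simp
next
  case False
  then have vx: "v x = x"
    by (rule permutes_not_in[OF v])
  have vin: "v y \<in> {1..<x} \<longleftrightarrow> y \<in> {1..<x}" for y
    using permutes_in_image[OF v, of y] permutes_not_in[OF v, of y] False assms(3)
    by (cases "y \<in> {a..b}") auto
  have "{y \<in> {1..<x}. (c \<circ> v) y = c x} = v -` {y \<in> {1..<x}. c y = c x}"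
    using vin by auto
  then have "card {y \<in> {1..<x}. (c \<circ> v) y = c x} = card {y \<in> {1..<x}. c y = c x}"
    by (simp only:) (rule card_vimage_inj[OF permutes_inj[OF v]], simp add: permutes_surj[OF v])
  then show ?thesis
    unfolding cell_def by (simp add: vx)
qed

section \<open>From closed chains to column-strict tableaux\<close>

locale star_tableaux =
  fixes n :: nat and Js :: "(nat \<times> nat) list" and lam :: "nat list"
  assumes valid: "valid_intervals n Js" and part: "is_partition n lam"
begin

abbreviation "m \<equiv> length Js"

abbreviation "lo p \<equiv> fst (Js ! p)"

abbreviation "hi p \<equiv> snd (Js ! p)"

abbreviation "W \<equiv> rearrangements n (base_word lam)"

definition closed_chains :: "(nat \<Rightarrow> nat) list set" where
  "closed_chains = {cs. length cs = Suc m \<and> cs ! 0 \<in> W \<and> cs ! m = cs ! 0 \<and>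
     (\<forall>p<m. star_step (Js ! p) (cs ! p) (cs ! Suc p))}"

definition strand_of :: "(nat \<Rightarrow> nat) list \<Rightarrow> nat \<times> nat \<Rightarrow> nat \<Rightarrow> nat" where
  "strand_of cs d p = the_inv_into {1..n} (cell (cs ! p)) d"

abbreviation "path_of cs d \<equiv> path_from Js 0 (strand_of cs d)"

definition tableau_of :: "(nat \<Rightarrow> nat) list \<Rightarrow> tableau" where
  "tableau_of cs = map (\<lambda>r. map (\<lambda>k. path_of cs (r, k)) [0..<conjugate lam ! r]) [0..<length (conjugate lam)]"

lemma sum_lam: "sum_list lam = n"
  using part by (simp add: is_partition_def)

lemma lo_hi: "p < m \<Longrightarrow> 1 \<le> lo p \<and> lo p \<le> hi p \<and> hi p \<le> n"
  using valid nth_mem[of p Js] unfolding valid_intervals_def by fastforce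

lemma chain_W:
  assumes "cs \<in> closed_chains" "p \<le> m"
  shows "cs ! p \<in> W"
  using assms(2)
proof (induction p)
  case 0
  then show ?case
    using assms(1) by (simp add: closed_chains_def)
next
  case (Suc p)
  then have "star_step (Js ! p) (cs ! p) (cs ! Suc p)"
    using assms(1) by (simp add: closed_chains_def)
  then obtain v where v: "v permutes {lo p..hi p}" "cs ! Suc p = cs ! p \<circ> v"
    unfolding star_step_def by blast
  have "v permutes {1..n}"
    using lo_hi[of p] Suc.prems by (intro permutes_interval_mono[OF v(1)]) auto
  moreover have "cs ! p \<in> W"
    using Suc by simp
  ultimately show ?case
    unfolding v(2) by (intro rearrangements_comp)
qed

lemma bij_cell: "cs \<in> closed_chains \<Longrightarrow> p \<le> m \<Longrightarrow> bij_betw (cell (cs ! p)) {1..n} (cells lam)"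
  using bij_betw_cell[OF chain_W sum_lam] .

lemma bij_strand_of:
  assumes "cs \<in> closed_chains" "p \<le> m"
  shows "bij_betw (\<lambda>d. strand_of cs d p) (cells lam) {1..n}"
  unfolding strand_of_def using bij_betw_the_inv_into[OF bij_cell[OF assms]] .

lemma strand_of_cell:
  assumes "cs \<in> closed_chains" "p \<le> m" "x \<in> {1..n}"
  shows "strand_of cs (cell (cs ! p) x) p = x"
  unfolding strand_of_def using bij_cell[OF assms(1,2)] assms(3) by (intro the_inv_into_f_f) (auto simp: bij_betw_def)

lemma cell_strand_of:
  assumes "cs \<in> closed_chains" "p \<le> m" "d \<in> cells lam"
  shows "cell (cs ! p) (strand_of cs d p) = d" "strand_of cs d p \<in> {1..n}"
proof -
  show "cell (cs ! p) (strand_of cs d p) = d"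
    unfolding strand_of_def using bij_cell[OF assms(1,2)] assms(3) by (intro f_the_inv_into_f) (auto simp: bij_betw_def)
  show "strand_of cs d p \<in> {1..n}"
    using bij_strand_of[OF assms(1,2)] assms(3) unfolding bij_betw_def by blast
qed

text \<open>Words are composed with v on the right, so v runs against the direction of the paths: it
  sends the height of a strand after the star to its height before it.\<close>

lemma chain_step:
  assumes "cs \<in> closed_chains" "p < m"
  obtains v where "v permutes {lo p..hi p}" "cs ! Suc p = cs ! p \<circ> v" "inj_on (cs ! p) {lo p..hi p}"
    "\<And>x. x \<in> {1..n} \<Longrightarrow> cell (cs ! Suc p) x = cell (cs ! p) (v x)"
    "\<And>d. d \<in> cells lam \<Longrightarrow> strand_of cs d p = v (strand_of cs d (Suc p))"
proof -
  have "star_step (Js ! p) (cs ! p) (cs ! Suc p)"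
    using assms by (simp add: closed_chains_def)
  then obtain v where v: "v permutes {lo p..hi p}" "cs ! Suc p = cs ! p \<circ> v" and inj: "inj_on (cs ! p) {lo p..hi p}"
    unfolding star_step_def by blast
  have c: "cell (cs ! Suc p) x = cell (cs ! p) (v x)" if "x \<in> {1..n}" for x
    unfolding v(2) using lo_hi[OF assms(2)] that by (intro cell_star_step[OF v(1) inj]) auto
  have "strand_of cs d p = v (strand_of cs d (Suc p))" if d: "d \<in> cells lam" for d
  proof -
    have Suc: "Suc p \<le> m" and p: "p \<le> m"
      using assms(2) by auto
    let ?x = "strand_of cs d (Suc p)"
    have x: "?x \<in> {1..n}" "cell (cs ! Suc p) ?x = d"
      using cell_strand_of[OF assms(1) Suc d] by auto
    have "v permutes {1..n}"
      using lo_hi[OF assms(2)] by (intro permutes_interval_mono[OF v(1)]) auto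
    then have "v ?x \<in> {1..n}"
      using permutes_in_image x(1) by metis
    then have "strand_of cs (cell (cs ! p) (v ?x)) p = v ?x"
      by (rule strand_of_cell[OF assms(1) p])
    then show ?thesis
      using c[OF x(1)] x(2) by simp
  qed
  then show ?thesis
    using that v inj c by blast
qed

lemma strand_strand_of:
  assumes "cs \<in> closed_chains" "d \<in> cells lam"
  shows "strand n Js (strand_of cs d)"
  unfolding strand_def
proof (intro conjI allI impI)
  show "strand_of cs d p \<in> {1..n}" if "p \<le> m" for p
    using cell_strand_of(2)[OF assms(1) that assms(2)] .
  show "if passes Js p (strand_of cs d p) then passes Js p (strand_of cs d (Suc p)) else strand_of cs d (Suc p) = strand_of cs d p"
    if p: "p < m" for p
  proof -
    obtain v where v: "v permutes {lo p..hi p}" "strand_of cs d p = v (strand_of cs d (Suc p))"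
      using chain_step[OF assms(1) p] assms(2) by metis
    \<comment> \<open>For a one-point interval \<open>passes\<close> is false although the position
      may lie in it; v is trivial then and the strand goes straight.\<close>
    have "lo p = hi p \<Longrightarrow> v = id"
      using v(1) by simp
    moreover have "v x \<in> {lo p..hi p} \<longleftrightarrow> x \<in> {lo p..hi p}" "x \<notin> {lo p..hi p} \<Longrightarrow> v x = x" for x
      using permutes_in_image[OF v(1)] permutes_not_in[OF v(1)] by blast+
    ultimately show ?thesis
      using v(2) lo_hi[OF p] unfolding passes_def by (cases "lo p = hi p") auto
  qed
qed

lemma strand_of_closed: "cs \<in> closed_chains \<Longrightarrow> strand_of cs d m = strand_of cs d 0"
  by (simp add: strand_of_def closed_chains_def)

lemma mset_concat_cells:
  "mset (concat U) = image_mset (\<lambda>(r, k). U ! r ! k) (mset_set {(r, k). r < length U \<and> k < length (U ! r)})"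
proof (induction U rule: rev_induct)
  case Nil
  show ?case
    by simp
next
  case (snoc row U)
  let ?A = "{(r, k). r < length U \<and> k < length (U ! r)}" and ?B = "Pair (length U) ` {0..<length row}"
  have fin: "finite ?A"
    by (rule finite_subset[of _ "SIGMA r:{..<length U}. {..<length (U ! r)}"]) auto
  have "{(r, k). r < length (U @ [row]) \<and> k < length ((U @ [row]) ! r)} = ?A \<union> ?B"
    by (auto simp: nth_append less_Suc_eq image_iff split: if_splits)
  then have "mset_set {(r, k). r < length (U @ [row]) \<and> k < length ((U @ [row]) ! r)} = mset_set ?A + mset_set ?B"
    using fin by (simp add: mset_set_Union[of ?A ?B, symmetric] disjoint_iff image_iff)
  moreover have "mset_set ?B = image_mset (Pair (length U)) (mset_set {0..<length row})"
    by (rule image_mset_mset_set[symmetric]) (auto simp: inj_on_def)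
  moreover have "image_mset (\<lambda>(r, k). (U @ [row]) ! r ! k) (mset_set ?A) = image_mset (\<lambda>(r, k). U ! r ! k) (mset_set ?A)"
    using fin by (intro image_mset_cong) (auto simp: nth_append)
  moreover have "image_mset (\<lambda>k. row ! k) (mset_set {0..<length row}) = mset row"
    by (metis map_nth mset_map mset_upt)
  ultimately show ?case
    using snoc by (simp add: multiset.map_comp o_def)
qed

lemma shape_cells:
  assumes "map length U = conjugate lam"
  shows "{(r, k). r < length U \<and> k < length (U ! r)} = cells lam"
proof -
  have "length U = length (conjugate lam)"
    using assms by (metis length_map)
  moreover have "length (U ! r) = conjugate lam ! r" if "r < length U" for r
    using assms that by (metis nth_map)
  ultimately show ?thesis
    using cells_conjugate[OF part] by auto
qed

lemma mset_shape:
  "map length U = conjugate lam \<Longrightarrow> mset (concat U) = image_mset (\<lambda>(r, k). U ! r ! k) (mset_set (cells lam))"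
  using mset_concat_cells[of U] shape_cells[of U] by simp

lemma set_shape: "map length U = conjugate lam \<Longrightarrow> set (concat U) = (\<lambda>(r, k). U ! r ! k) ` cells lam"
  using mset_shape[of U] by (metis finite_cells finite_set_mset_mset_set set_image_mset set_mset_mset)

lemma shape_tableau_of: "map length (tableau_of cs) = conjugate lam"
  by (simp add: tableau_of_def o_def map_nth)

lemma nth_tableau_of: "(r, k) \<in> cells lam \<Longrightarrow> tableau_of cs ! r ! k = path_of cs (r, k)"
  using cells_conjugate[OF part] by (simp add: tableau_of_def)

lemma set_tableau_of: "set (concat (tableau_of cs)) = path_of cs ` cells lam"
  unfolding set_shape[OF shape_tableau_of] by (intro image_cong) (auto simp: nth_tableau_of)

lemma mset_paths: "mset (map h [1..<Suc n]) = image_mset h (mset_set {1..n})"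
  by (metis atLeastLessThanSuc_atLeastAtMost mset_map mset_upt)

text \<open>The chain ends with the word it starts from, so every strand returns to its initial
  height and the type is the identity. Covering holds because cells and heights correspond
  bijectively at each level.\<close>

lemma G_tableau_tableau_of:
  assumes cs: "cs \<in> closed_chains"
  shows "G_tableau n Js id (conjugate lam) (tableau_of cs)"
proof -
  define F where "F i = strand_of cs (cell (cs ! 0) i)" for i
  let ?ps = "map (\<lambda>i. path_from Js 0 (F i)) [1..<Suc n]"
  note b0 = bij_cell[OF cs le0]
  have cell_in: "cell (cs ! 0) i \<in> cells lam" if "i \<in> {1..n}" for i
    using b0 that unfolding bij_betw_def by blast
  have F: "strand n Js (F i) \<and> F i 0 = i \<and> F i m = id i" if "i \<in> {1..n}" for i
    unfolding F_def using strand_strand_of[OF cs cell_in[OF that]] strand_of_cell[OF cs le0 that] strand_of_closed[OF cs] by simp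
  have "path_family n Js id ?ps"
    unfolding path_family_iff[OF valid] using F by blast
  moreover have "covers n Js ?ps"
  proof (subst covers_iff[OF valid])
    show "inj_on (\<lambda>i. F i m) {1..n}"
      using F by (auto simp: inj_on_def)
    show "\<forall>p\<le>m. bij_betw (\<lambda>i. F i p) {1..n} {1..n}"
      using bij_betw_trans[OF b0 bij_strand_of[OF cs]] unfolding F_def o_def by blast
  qed (use F in auto)
  moreover have "is_tableau_of ?ps (conjugate lam) (tableau_of cs)"
  proof -
    have "mset (concat (tableau_of cs)) = image_mset (path_of cs) (mset_set (cells lam))"
      unfolding mset_shape[OF shape_tableau_of] by (intro image_mset_cong) (auto simp: nth_tableau_of)
    also have "mset_set (cells lam) = image_mset (cell (cs ! 0)) (mset_set {1..n})"
      using b0 by (simp add: image_mset_mset_set bij_betw_def)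
    finally show ?thesis
      unfolding is_tableau_of_def mset_paths F_def using shape_tableau_of by (simp add: multiset.map_comp o_def)
  qed
  ultimately show ?thesis
    unfolding G_tableau_def using is_partition_conjugate[OF part] by blast
qed

lemma entirely_below_iff:
  "entirely_below (path_from Js 0 f) (path_from Js 0 g) \<longleftrightarrow>
    (\<forall>p\<le>m. f p < g p) \<and> (\<forall>p<m. \<not> (passes Js p (f p) \<and> passes Js p (g p)))"
proof -
  have col: "Col p i \<in> set (path_from Js 0 h) \<longleftrightarrow> p \<le> m \<and> i = h p" for p i h
    by (auto simp: Col_in_path_from)
  have "set (path_from Js 0 f) \<inter> set (path_from Js 0 g) = {} \<longleftrightarrow>
      (\<forall>p\<le>m. f p \<noteq> g p) \<and> (\<forall>p<m. \<not> (passes Js p (f p) \<and> passes Js p (g p)))"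
    (is "?L \<longleftrightarrow> ?R")
  proof
    assume ?L
    then have "Col p i \<notin> set (path_from Js 0 f) \<or> Col p i \<notin> set (path_from Js 0 g)"
      "Centre p \<notin> set (path_from Js 0 f) \<or> Centre p \<notin> set (path_from Js 0 g)" for p i
      by blast+
    then show ?R
      unfolding col Centre_in_path_from by blast
  next
    assume R: ?R
    have "v \<notin> set (path_from Js 0 g)" if "v \<in> set (path_from Js 0 f)" for v
    proof (cases v)
      case (Col p i)
      then show ?thesis
        using that R by (auto simp: col)
    next
      case (Centre p)
      then show ?thesis
        using that R by (auto simp: Centre_in_path_from)
    qed
    then show ?L
      by blast
  qed
  then show ?thesis
    unfolding entirely_below_def col by (auto simp: less_imp_neq)
qed

lemma column_strict_iff:
  assumes "map length U = conjugate lam"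
  shows "column_strict U \<longleftrightarrow> (\<forall>r s k. (r, k) \<in> cells lam \<and> (s, k) \<in> cells lam \<and> r < s \<longrightarrow>
    entirely_below (U ! r ! k) (U ! s ! k))"
proof -
  have "(r, k) \<in> cells lam \<longleftrightarrow> r < length U \<and> k < length (U ! r)" for r k
    using shape_cells[OF assms] by blast
  then show ?thesis
    unfolding column_strict_def by (meson less_trans)
qed

text \<open>Strands in one column have the same letter, so their heights are ordered like their
  rows; and they cannot meet in a centre, because the letters entering a star are distinct.\<close>

lemma column_strict_tableau_of:
  assumes cs: "cs \<in> closed_chains"
  shows "column_strict (tableau_of cs)"
  unfolding column_strict_iff[OF shape_tableau_of]
proof (intro allI impI)
  fix r s k assume *: "(r, k) \<in> cells lam \<and> (s, k) \<in> cells lam \<and> r < s"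
  then have rs: "(r, k) \<in> cells lam" "(s, k) \<in> cells lam" "r < s"
    by auto
  have lt: "strand_of cs (r, k) p < strand_of cs (s, k) p" if p: "p \<le> m" for p
  proof -
    let ?x = "strand_of cs (r, k) p" and ?y = "strand_of cs (s, k) p"
    have x: "cell (cs ! p) ?x = (r, k)" "?x \<in> {1..n}" and y: "cell (cs ! p) ?y = (s, k)" "?y \<in> {1..n}"
      using cell_strand_of[OF cs p rs(1)] cell_strand_of[OF cs p rs(2)] by auto
    have "(cs ! p) ?x = k" "(cs ! p) ?y = k"
      using x(1) y(1) by (metis snd_cell snd_conv)+
    then show ?thesis
      using fst_cell_less_iff[of ?x ?y "cs ! p"] x y rs(3) by auto
  qed
  moreover have "\<not> (passes Js p (strand_of cs (r, k) p) \<and> passes Js p (strand_of cs (s, k) p))" if p: "p < m" for p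
  proof
    let ?x = "strand_of cs (r, k) p" and ?y = "strand_of cs (s, k) p"
    assume "passes Js p ?x \<and> passes Js p ?y"
    then have J: "?x \<in> {lo p..hi p}" "?y \<in> {lo p..hi p}"
      by (auto simp: passes_def)
    have "(cs ! p) ?x = k" "(cs ! p) ?y = k"
      using cell_strand_of(1)[OF cs less_imp_le[OF p] rs(1)] cell_strand_of(1)[OF cs less_imp_le[OF p] rs(2)]
      by (metis snd_cell snd_conv)+
    moreover have "inj_on (cs ! p) {lo p..hi p}"
      using chain_step[OF cs p] by metis
    ultimately have "?x = ?y"
      using J by (metis inj_onD)
    then show False
      using lt[OF less_imp_le[OF p]] by simp
  qed
  ultimately show "entirely_below (tableau_of cs ! r ! k) (tableau_of cs ! s ! k)"
    unfolding nth_tableau_of[OF rs(1)] nth_tableau_of[OF rs(2)] entirely_below_iff by blast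
qed

lemma W_outside: "c \<in> W \<Longrightarrow> x \<notin> {1..n} \<Longrightarrow> c x = base_word lam x"
  unfolding rearrangements_def using permutes_not_in by fastforce

text \<open>The paths show the heights of all strands, the heights determine the cell of each
  position, and the column of the cell is the letter. Outside 1..n all words of the chain agree with
  the sorted word.\<close>

lemma inj_tableau_of: "inj_on tableau_of closed_chains"
proof (rule inj_onI)
  fix cs cs' assume cs: "cs \<in> closed_chains" and cs': "cs' \<in> closed_chains" and eq: "tableau_of cs = tableau_of cs'"
  have st: "strand_of cs d p = strand_of cs' d p" if d: "d \<in> cells lam" and p: "p \<le> m" for d p
  proof -
    obtain r k where rk: "d = (r, k)"
      by (cases d)
    have "path_of cs d = path_of cs' d"
      using nth_tableau_of[of r k cs] nth_tableau_of[of r k cs'] d eq unfolding rk by simp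
    moreover have "Col p (strand_of cs d p) \<in> set (path_of cs d)"
      using p by (auto simp: Col_in_path_from)
    ultimately show ?thesis
      by (simp add: Col_in_path_from)
  qed
  show "cs = cs'"
  proof (rule nth_equalityI)
    show "length cs = length cs'"
      using cs cs' by (simp add: closed_chains_def)
    fix p assume "p < length cs"
    then have p: "p \<le> m"
      using cs by (simp add: closed_chains_def)
    show "cs ! p = cs' ! p"
    proof
      fix x
      show "(cs ! p) x = (cs' ! p) x"
      proof (cases "x \<in> {1..n}")
        case True
        let ?d = "cell (cs ! p) x"
        have d: "?d \<in> cells lam"
          using bij_cell[OF cs p] True unfolding bij_betw_def by blast
        have "strand_of cs' ?d p = x"
          using st[OF d p] strand_of_cell[OF cs p True] by simp
        then have "cell (cs' ! p) x = ?d"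
          using cell_strand_of(1)[OF cs' p d] by simp
        then show ?thesis
          by (metis snd_cell)
      qed (use W_outside[OF chain_W[OF cs p]] W_outside[OF chain_W[OF cs' p]] in simp)
    qed
  qed
qed

end

section \<open>From column-strict tableaux to closed chains\<close>

context star_tableaux
begin

text \<open>A tableau is linked to its path family only by an equality of multisets. As the paths
  have different sources, this equality becomes a bijection between cells and path indices.\<close>

lemma tableau_strands:
  assumes G: "G_tableau n Js id (conjugate lam) U"
  obtains f where "\<And>d. d \<in> cells lam \<Longrightarrow> strand n Js (f d) \<and> f d m = f d 0"
    and "\<And>p. p \<le> m \<Longrightarrow> bij_betw (\<lambda>d. f d p) (cells lam) {1..n}"
    and "\<And>r k. (r, k) \<in> cells lam \<Longrightarrow> U ! r ! k = path_from Js 0 (f (r, k))"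
proof -
  obtain ps where ps: "path_family n Js id ps" "covers n Js ps" "is_tableau_of ps (conjugate lam) U"
    using G unfolding G_tableau_def by blast
  obtain F where F: "ps = map (\<lambda>i. path_from Js 0 (F i)) [1..<Suc n]"
    "\<And>i. i \<in> {1..n} \<Longrightarrow> strand n Js (F i) \<and> F i 0 = i \<and> F i m = id i"
    using ps(1) unfolding path_family_iff[OF valid] by blast
  have injF: "inj_on (\<lambda>i. F i m) {1..n}"
    using F(2) by (auto simp: inj_on_def)
  have "covers n Js ps \<longleftrightarrow> (\<forall>p\<le>m. bij_betw (\<lambda>i. F i p) {1..n} {1..n})"
    unfolding F(1) by (rule covers_iff[OF valid]) (use F(2) injF in blast)+
  then have bijF: "bij_betw (\<lambda>i. F i p) {1..n} {1..n}" if "p \<le> m" for p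
    using ps(2) that by blast
  have shape: "map length U = conjugate lam" and ms: "mset (concat U) = mset ps"
    using ps(3) by (auto simp: is_tableau_of_def)
  define h where "h i = path_from Js 0 (F i)" for i
  define g where "g = (\<lambda>(r, k). U ! r ! k)"
  have injh: "inj_on h {1..n}"
  proof (rule inj_onI)
    fix i j assume ij: "i \<in> {1..n}" "j \<in> {1..n}" "h i = h j"
    then have "hd (h i) = hd (h j)"
      by simp
    then show "i = j"
      using F(2)[OF ij(1)] F(2)[OF ij(2)] by (simp add: h_def hd_path_from)
  qed
  have "image_mset g (mset_set (cells lam)) = image_mset h (mset_set {1..n})"
    using ms unfolding mset_shape[OF shape] F(1) mset_paths g_def h_def .
  then have im: "g ` cells lam = h ` {1..n}"
    by (metis finite_atLeastAtMost finite_cells finite_set_mset_mset_set set_image_mset)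
  have "card (g ` cells lam) = card (cells lam)"
    unfolding im card_image[OF injh] card_cells sum_lam by simp
  then have injg: "inj_on g (cells lam)"
    by (intro eq_card_imp_inj_on) simp_all
  define \<iota> where "\<iota> d = the_inv_into {1..n} h (g d)" for d
  have bij\<iota>: "bij_betw \<iota> (cells lam) {1..n}"
    unfolding \<iota>_def using bij_betw_trans[OF bij_betw_imageI[OF injg im] bij_betw_the_inv_into[OF bij_betw_imageI[OF injh refl]]]
    by (simp add: o_def)
  have \<iota>in: "\<iota> d \<in> {1..n}" if "d \<in> cells lam" for d
    using bij\<iota> that unfolding bij_betw_def by blast
  have h\<iota>: "h (\<iota> d) = g d" if "d \<in> cells lam" for d
    unfolding \<iota>_def using im that by (intro f_the_inv_into_f[OF injh]) blast
  show ?thesis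
  proof (rule that[of "\<lambda>d. F (\<iota> d)"])
    show "strand n Js (F (\<iota> d)) \<and> F (\<iota> d) m = F (\<iota> d) 0" if "d \<in> cells lam" for d
      using F(2)[OF \<iota>in[OF that]] by simp
    show "bij_betw (\<lambda>d. F (\<iota> d) p) (cells lam) {1..n}" if "p \<le> m" for p
      using bij_betw_trans[OF bij\<iota> bijF[OF that]] by (simp add: o_def)
    show "U ! r ! k = path_from Js 0 (F (\<iota> (r, k)))" if "(r, k) \<in> cells lam" for r k
      using h\<iota>[OF that] by (simp add: h_def g_def)
  qed
qed

text \<open>Colour each position at each level by the column of the strand through it.
  Column-strictness orders the strands of a column by rows, so \<open>cell\<close> recovers their
  labels, and it keeps them from sharing a centre, which is the injectivity demanded by
  \<open>star_step\<close>.\<close>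

lemma surj_tableau_of:
  assumes G: "G_tableau n Js id (conjugate lam) U" and strict: "column_strict U"
  shows "U \<in> tableau_of ` closed_chains"
proof -
  obtain f where f: "\<And>d. d \<in> cells lam \<Longrightarrow> strand n Js (f d) \<and> f d m = f d 0"
    and bij: "\<And>p. p \<le> m \<Longrightarrow> bij_betw (\<lambda>d. f d p) (cells lam) {1..n}"
    and U: "\<And>r k. (r, k) \<in> cells lam \<Longrightarrow> U ! r ! k = path_from Js 0 (f (r, k))"
    using tableau_strands[OF G] by metis
  have shape: "map length U = conjugate lam"
    using G unfolding G_tableau_def is_tableau_of_def by blast
  have below: "\<And>p. p \<le> m \<Longrightarrow> f (r, k) p < f (s, k) p"
    "\<And>p. p < m \<Longrightarrow> \<not> (passes Js p (f (r, k) p) \<and> passes Js p (f (s, k) p))"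
    if rs: "(r, k) \<in> cells lam" "(s, k) \<in> cells lam" "r < s" for r s k
  proof -
    have "entirely_below (path_from Js 0 (f (r, k))) (path_from Js 0 (f (s, k)))"
      using strict rs unfolding column_strict_iff[OF shape] by (simp flip: U)
    then show "\<And>p. p \<le> m \<Longrightarrow> f (r, k) p < f (s, k) p"
      "\<And>p. p < m \<Longrightarrow> \<not> (passes Js p (f (r, k) p) \<and> passes Js p (f (s, k) p))"
      unfolding entirely_below_iff by blast+
  qed
  define g where "g p = the_inv_into (cells lam) (\<lambda>d. f d p)" for p
  \<comment> \<open>Outside 1..n the sorted word is the right default: a rearrangement agrees with
    it there.\<close>
  define w where "w p x = (if x \<in> {1..n} then snd (g p x) else base_word lam x)" for p x
  define cs where "cs = map w [0..<Suc m]"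
  have nth: "cs ! p = w p" if "p \<le> m" for p
    using that by (simp add: cs_def nth_append le_Suc_eq less_Suc_eq_le del: upt_Suc)
  have fin: "f d p \<in> {1..n}" if "p \<le> m" "d \<in> cells lam" for p d
    using bij[OF that(1)] that(2) unfolding bij_betw_def by blast
  have gf: "g p (f d p) = d" if "p \<le> m" "d \<in> cells lam" for p d
    unfolding g_def using bij[OF that(1)] that(2) by (intro the_inv_into_f_f) (auto simp: bij_betw_def)
  have fg: "f (g p x) p = x" "g p x \<in> cells lam" if p: "p \<le> m" and x: "x \<in> {1..n}" for p x
  proof -
    have "x \<in> (\<lambda>d. f d p) ` cells lam"
      unfolding bij_betw_imp_surj_on[OF bij[OF p]] using x .
    then obtain d where d: "d \<in> cells lam" "f d p = x"
      by blast
    then show "f (g p x) p = x" "g p x \<in> cells lam"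
      using gf[OF p d(1)] by simp_all
  qed
  have wf: "w p (f d p) = snd d" if "p \<le> m" "d \<in> cells lam" for p d
    unfolding w_def using gf[OF that] fin[OF that] by simp
  \<comment> \<open>The positions below a strand with the same letter are those of the strands in
    lower rows of its column, so their number is its row.\<close>
  have cell_f: "cell (w p) (f d p) = d" if p: "p \<le> m" and d: "d \<in> cells lam" for p d
  proof -
    obtain r k where rk: "d = (r, k)"
      by (cases d)
    have rk': "(r', k) \<in> cells lam" if "r' \<le> r" for r'
      using d that unfolding rk by (simp add: cells_def)
    have "{y \<in> {1..<f d p}. w p y = k} = (\<lambda>r'. f (r', k) p) ` {..<r}"
    proof (intro equalityI subsetI)
      fix y assume y: "y \<in> {y \<in> {1..<f d p}. w p y = k}"
      then have yn: "y \<in> {1..n}"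
        using fin[OF p d] by auto
      obtain r' k' where d': "g p y = (r', k')"
        by (cases "g p y")
      have c': "(r', k') \<in> cells lam" "f (r', k') p = y"
        using fg[OF p yn] d' by simp_all
      have "k' = k"
        using wf[OF p c'(1)] c'(2) y by simp
      moreover have "r' < r"
      proof (rule ccontr)
        assume "\<not> r' < r"
        then consider "r' = r" | "r < r'"
          by linarith
        then show False
        proof cases
          case 1
          then show ?thesis
            using c'(2) y \<open>k' = k\<close> rk by simp
        next
          case 2
          then show ?thesis
            using below(1)[of r k r' p] c' d y p \<open>k' = k\<close> rk by simp
        qed
      qed
      ultimately show "y \<in> (\<lambda>r'. f (r', k) p) ` {..<r}"
        using c'(2) by blast
    next
      fix y assume "y \<in> (\<lambda>r'. f (r', k) p) ` {..<r}"
      then obtain r' where r': "r' < r" "y = f (r', k) p"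
        by blast
      then have c: "(r', k) \<in> cells lam"
        using rk' by simp
      show "y \<in> {y \<in> {1..<f d p}. w p y = k}"
        using below(1)[OF c d[unfolded rk] r'(1) p] wf[OF p c] fin[OF p c] r'(2) rk by simp
    qed
    moreover have "inj_on (\<lambda>r'. f (r', k) p) {..<r}"
    proof (rule inj_onI)
      fix r1 r2 assume r12: "r1 \<in> {..<r}" "r2 \<in> {..<r}" "f (r1, k) p = f (r2, k) p"
      then have "(r1, k) \<in> cells lam" "(r2, k) \<in> cells lam"
        using rk' by simp_all
      then have "(r1, k) = (r2, k)"
        using gf[OF p] r12(3) by metis
      then show "r1 = r2"
        by blast
    qed
    ultimately show ?thesis
      unfolding cell_def using wf[OF p d] by (simp add: rk card_image)
  qed
  have wW: "w p \<in> W" if p: "p \<le> m" for p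
  proof -
    let ?b = "the_inv_into {1..n} (cell (base_word lam))"
    have b: "bij_betw (cell (base_word lam)) {1..n} (cells lam)"
      using bij_betw_cell[OF rearrangements_self sum_lam] .
    \<comment> \<open>The strands at level p and the positions of the sorted word are labelled by
      the same cells; u sends a position to the one with the same label.\<close>
    define u where "u x = (if x \<in> {1..n} then ?b (g p x) else x)" for x
    have "bij_betw (\<lambda>x. ?b (g p x)) {1..n} {1..n}"
      using bij_betw_trans[OF bij_betw_the_inv_into[OF bij[OF p]] bij_betw_the_inv_into[OF b]]
      by (simp add: o_def g_def)
    then have "bij_betw u {1..n} {1..n}"
      using bij_betw_cong[of "{1..n}" u "\<lambda>x. ?b (g p x)"] by (simp add: u_def)
    then have "u permutes {1..n}"
      by (rule bij_imp_permutes) (simp only: u_def if_False)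
    moreover have "w p = base_word lam \<circ> u"
    proof
      fix x
      show "w p x = (base_word lam \<circ> u) x"
      proof (cases "x \<in> {1..n}")
        case True
        have "cell (base_word lam) (?b (g p x)) = g p x"
          using fg(2)[OF p True] b by (intro f_the_inv_into_f) (auto simp: bij_betw_def)
        from arg_cong[OF this, of snd] show ?thesis
          using True by (simp add: w_def u_def)
      next
        case False
        then show ?thesis
          by (simp only: w_def u_def comp_apply if_False)
      qed
    qed
    ultimately show ?thesis
      unfolding rearrangements_def by blast
  qed
  have step: "star_step (Js ! p) (w p) (w (Suc p))" if p: "p < m" for p
  proof -
    have p': "p \<le> m" "Suc p \<le> m"
      using p by auto
    note J = lo_hi[OF p]
    have st: "if passes Js p (f d p) then passes Js p (f d (Suc p)) else f d (Suc p) = f d p" if "d \<in> cells lam" for d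
      using f[OF that] p unfolding strand_def by blast
    have inj: "inj_on (w p) {lo p..hi p}"
    proof (rule inj_onI)
      fix x y assume xy: "x \<in> {lo p..hi p}" "y \<in> {lo p..hi p}" "w p x = w p y"
      show "x = y"
      proof (rule ccontr)
        assume ne: "x \<noteq> y"
        then have pass: "passes Js p x" "passes Js p y"
          using xy by (auto simp: passes_def)
        have n: "x \<in> {1..n}" "y \<in> {1..n}"
          using passes_bounds[OF valid p] pass by blast+
        obtain r k s l where d: "g p x = (r, k)" "g p y = (s, l)"
          by (metis surj_pair)
        have c: "(r, k) \<in> cells lam" "f (r, k) p = x" "(s, l) \<in> cells lam" "f (s, l) p = y"
          using fg[OF p'(1) n(1)] fg[OF p'(1) n(2)] d by simp_all
        have "k = l"
          using xy(3) n d by (simp add: w_def)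
        moreover have "r \<noteq> s"
          using ne c \<open>k = l\<close> by auto
        ultimately show False
          using below(2)[of r k s p] below(2)[of s k r p] c pass p by (metis linorder_neqE_nat)
      qed
    qed
    \<comment> \<open>The height after the star is sent to the height before it, which fits
      composition on the right.\<close>
    define v where "v x = (if x \<in> {1..n} then f (g (Suc p) x) p else x)" for x
    have "bij_betw (\<lambda>x. f (g (Suc p) x) p) {1..n} {1..n}"
      using bij_betw_trans[OF bij_betw_the_inv_into[OF bij[OF p'(2)]] bij[OF p'(1)]] by (simp add: o_def g_def)
    then have "bij_betw v {1..n} {1..n}"
      using bij_betw_cong[of "{1..n}" v "\<lambda>x. f (g (Suc p) x) p"] by (simp add: v_def)
    then have "v permutes {1..n}"
      by (rule bij_imp_permutes) (simp only: v_def if_False)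
    moreover have "v x = x" if "x \<in> {1..n} - {lo p..hi p}" for x
    proof -
      have x: "x \<in> {1..n}" "\<not> passes Js p x"
        using that by (auto simp: passes_def)
      let ?d = "g (Suc p) x"
      have d: "?d \<in> cells lam" "f ?d (Suc p) = x"
        using fg[OF p'(2) x(1)] by simp_all
      then have "f ?d p = x"
        using st[OF d(1)] x(2) by (metis (full_types))
      then show ?thesis
        using x(1) by (simp add: v_def)
    qed
    ultimately have v: "v permutes {lo p..hi p}"
      by (rule permutes_superset)
    have "w (Suc p) = w p \<circ> v"
    proof
      fix x
      show "w (Suc p) x = (w p \<circ> v) x"
      proof (cases "x \<in> {1..n}")
        case True
        have "w p (f (g (Suc p) x) p) = snd (g (Suc p) x)"
          using wf[OF p'(1) fg(2)[OF p'(2) True]] .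
        then show ?thesis
          using True by (simp add: v_def w_def[of "Suc p"])
      next
        case False
        then show ?thesis
          by (simp only: w_def v_def comp_apply if_False)
      qed
    qed
    then show ?thesis
      unfolding star_step_def using inj v by blast
  qed
  \<comment> \<open>The type is the identity, so each strand ends at the height where it
    began.\<close>
  have "w m = w 0"
  proof
    fix x
    show "w m x = w 0 x"
    proof (cases "x \<in> {1..n}")
      case True
      have d: "g 0 x \<in> cells lam" "f (g 0 x) 0 = x"
        using fg[OF le0 True] by simp_all
      then have "w m x = snd (g 0 x)"
        using wf[OF le_refl d(1)] f[OF d(1)] by simp
      then show ?thesis
        using True by (simp add: w_def)
    next
      case False
      then show ?thesis
        by (simp only: w_def if_False)
    qed
  qed
  then have cs: "cs \<in> closed_chains"
    unfolding closed_chains_def using nth step wW by (simp add: cs_def del: upt_Suc)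
  have "tableau_of cs = U"
  proof (rule nth_equalityI)
    have len: "length (tableau_of cs) = length U" "\<And>r. r < length U \<Longrightarrow> length (tableau_of cs ! r) = length (U ! r)"
      using shape shape_tableau_of[of cs] by (metis length_map, metis length_map nth_map)
    then show "length (tableau_of cs) = length U"
      by blast
    fix r assume r: "r < length (tableau_of cs)"
    show "tableau_of cs ! r = U ! r"
    proof (rule nth_equalityI)
      show "length (tableau_of cs ! r) = length (U ! r)"
        using len r by simp
      fix k assume k: "k < length (tableau_of cs ! r)"
      have d: "(r, k) \<in> cells lam"
        using r k shape_cells[OF shape_tableau_of[of cs]] by blast
      have "strand_of cs (r, k) p = f (r, k) p" if p: "p \<le> m" for p
        using strand_of_cell[OF cs p fin[OF p d]] cell_f[OF p d] nth[OF p] by simp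
      then have "path_of cs (r, k) = path_from Js 0 (f (r, k))"
        by (intro path_from_cong) auto
      then show "tableau_of cs ! r ! k = U ! r ! k"
        unfolding nth_tableau_of[OF d] U[OF d] .
    qed
  qed
  then show ?thesis
    using cs by blast
qed

lemma bij_tableau_of:
  "bij_betw tableau_of closed_chains {U. G_tableau n Js id (conjugate lam) U \<and> column_strict U}"
  unfolding bij_betw_def
  using inj_tableau_of G_tableau_tableau_of column_strict_tableau_of surj_tableau_of by blast

section \<open>Comparison of the weights\<close>

lemma inj_path_of:
  assumes "cs \<in> closed_chains"
  shows "inj_on (path_of cs) (cells lam)"
proof (rule inj_onI)
  fix d d' assume d: "d \<in> cells lam" "d' \<in> cells lam" "path_of cs d = path_of cs d'"
  then have "hd (path_of cs d) = hd (path_of cs d')"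
    by simp
  then have "strand_of cs d 0 = strand_of cs d' 0"
    by (simp add: hd_path_from)
  from arg_cong[OF this, of "cell (cs ! 0)"] show "d = d'"
    unfolding cell_strand_of(1)[OF assms le0 d(1)] cell_strand_of(1)[OF assms le0 d(2)] .
qed

lemma in_column_tableau_of:
  assumes cs: "cs \<in> closed_chains" and d: "d \<in> cells lam"
  shows "in_column (tableau_of cs) (path_of cs d) k \<longleftrightarrow> k = snd d"
proof -
  have sh: "(r, k) \<in> cells lam \<longleftrightarrow> r < length (tableau_of cs) \<and> k < length (tableau_of cs ! r)" for r k
    using shape_cells[OF shape_tableau_of[of cs]] by blast
  have "in_column (tableau_of cs) (path_of cs d) k \<longleftrightarrow> (\<exists>r. (r, k) \<in> cells lam \<and> tableau_of cs ! r ! k = path_of cs d)"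
    unfolding in_column_def sh by (metis in_set_conv_nth)
  also have "\<dots> \<longleftrightarrow> (\<exists>r. (r, k) \<in> cells lam \<and> path_of cs (r, k) = path_of cs d)"
    using nth_tableau_of by metis
  also have "\<dots> \<longleftrightarrow> (\<exists>r. (r, k) = d)"
    using inj_onD[OF inj_path_of[OF cs]] d by blast
  also have "\<dots> \<longleftrightarrow> k = snd d"
    by (cases d) auto
  finally show ?thesis .
qed

text \<open>Two paths through the centre of factor p are recovered from p and their exit heights.
  Irreflexivity of Q makes these heights distinct, so the interval has more than one point and a
  centre exists.\<close>

lemma card_path_triples:
  assumes cs: "cs \<in> closed_chains"
    and B: "\<And>d d' p. d \<in> cells lam \<Longrightarrow> d' \<in> cells lam \<Longrightarrow> B (path_of cs d) (path_of cs d') p \<longleftrightarrow>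
      p < m \<and> passes Js p (strand_of cs d (Suc p)) \<and> passes Js p (strand_of cs d' (Suc p)) \<and>
      Q p (strand_of cs d (Suc p)) (strand_of cs d' (Suc p))"
    and irrefl: "\<And>p x. \<not> Q p x x"
  shows "card {(P, P', p). P \<in> path_of cs ` cells lam \<and> P' \<in> path_of cs ` cells lam \<and> B P P' p} =
    (\<Sum>p<m. card {(x, y). x \<in> {lo p..hi p} \<and> y \<in> {lo p..hi p} \<and> Q p x y})"
proof -
  let ?S = "\<lambda>p. {(x, y). x \<in> {lo p..hi p} \<and> y \<in> {lo p..hi p} \<and> Q p x y}"
  let ?T = "{(P, P', p). P \<in> path_of cs ` cells lam \<and> P' \<in> path_of cs ` cells lam \<and> B P P' p}"
  define e where "e p x = path_of cs (cell (cs ! Suc p) x)" for p x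
  define h where "h = (\<lambda>(p, x, y). (e p x, e p y, p))"
  have fin: "finite (?S p)" for p
    by (rule finite_subset[of _ "{lo p..hi p} \<times> {lo p..hi p}"]) auto
  have inn: "x \<in> {1..n}" if "p < m" "x \<in> {lo p..hi p}" for p x
    using lo_hi[OF that(1)] that(2) by auto
  have cin: "cell (cs ! Suc p) x \<in> cells lam" "strand_of cs (cell (cs ! Suc p) x) (Suc p) = x"
    if p: "p < m" and x: "x \<in> {1..n}" for p x
  proof -
    have p': "Suc p \<le> m"
      using p by simp
    show "cell (cs ! Suc p) x \<in> cells lam"
      using bij_cell[OF cs p'] x unfolding bij_betw_def by blast
    show "strand_of cs (cell (cs ! Suc p) x) (Suc p) = x"
      using strand_of_cell[OF cs p' x] .
  qed
  have img: "h ` (SIGMA p:{..<m}. ?S p) = ?T"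
  proof (intro equalityI subsetI)
    fix t assume "t \<in> h ` (SIGMA p:{..<m}. ?S p)"
    then obtain p x y where t: "t = (e p x, e p y, p)" and p: "p < m"
      and x: "x \<in> {lo p..hi p}" and y: "y \<in> {lo p..hi p}" and Q: "Q p x y"
      unfolding h_def by auto
    have "x \<noteq> y"
      using Q irrefl by blast
    then have "passes Js p x" "passes Js p y"
      using x y by (auto simp: passes_def)
    then have "B (e p x) (e p y) p"
      unfolding e_def using B[OF cin(1)[OF p inn[OF p x]] cin(1)[OF p inn[OF p y]]] p Q
        cin(2)[OF p inn[OF p x]] cin(2)[OF p inn[OF p y]] by simp
    then show "t \<in> ?T"
      unfolding t e_def using cin(1)[OF p inn[OF p x]] cin(1)[OF p inn[OF p y]] by blast
  next
    fix t assume "t \<in> ?T"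
    then obtain d d' p where t: "t = (path_of cs d, path_of cs d', p)" and d: "d \<in> cells lam" "d' \<in> cells lam"
      and b: "B (path_of cs d) (path_of cs d') p"
      by auto
    let ?x = "strand_of cs d (Suc p)" and ?y = "strand_of cs d' (Suc p)"
    have p: "p < m" and J: "?x \<in> {lo p..hi p}" "?y \<in> {lo p..hi p}" and Q: "Q p ?x ?y"
      using b unfolding B[OF d] by (auto simp: passes_def)
    have p': "Suc p \<le> m"
      using p by simp
    have "t = h (p, ?x, ?y)"
      unfolding t h_def e_def case_prod_conv cell_strand_of(1)[OF cs p' d(1)] cell_strand_of(1)[OF cs p' d(2)] ..
    moreover have "(p, ?x, ?y) \<in> (SIGMA p:{..<m}. ?S p)"
      using p J Q by simp
    ultimately show "t \<in> h ` (SIGMA p:{..<m}. ?S p)"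
      by (rule image_eqI)
  qed
  have inj: "inj_on h (SIGMA p:{..<m}. ?S p)"
  proof (rule inj_on_inverseI)
    fix t assume "t \<in> (SIGMA p:{..<m}. ?S p)"
    then obtain p x y where t: "t = (p, x, y)" "p < m" "x \<in> {lo p..hi p}" "y \<in> {lo p..hi p}"
      by auto
    have inv: "the_inv_into (cells lam) (path_of cs) (e p z) = cell (cs ! Suc p) z" if "z \<in> {lo p..hi p}" for z
      unfolding e_def using the_inv_into_f_f[OF inj_path_of[OF cs] cin(1)[OF t(2) inn[OF t(2) that]]] .
    show "(\<lambda>(P, P', p). (p, strand_of cs (the_inv_into (cells lam) (path_of cs) P) (Suc p),
        strand_of cs (the_inv_into (cells lam) (path_of cs) P') (Suc p))) (h t) = t"
      unfolding t(1) h_def case_prod_conv inv[OF t(3)] inv[OF t(4)]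
      using cin(2)[OF t(2) inn[OF t(2) t(3)]] cin(2)[OF t(2) inn[OF t(2) t(4)]] by simp
  qed
  have "card ?T = card (SIGMA p:{..<m}. ?S p)"
    using card_image[OF inj] unfolding img .
  also have "\<dots> = (\<Sum>p<m. card (?S p))"
    using fin by (intro card_SigmaI) auto
  finally show ?thesis .
qed

text \<open>Exponents of \<open>qh\<close> count half powers of q, so the left side is the exponent
  belonging to q^(invnc + cr/2). Both sides are sums over the factors, compared by
  \<open>step_weight_crossings\<close>.\<close>

lemma weight_tableau_of:
  assumes cs: "cs \<in> closed_chains"
  shows "2 * invnc (tableau_of cs) + cr_tableau (tableau_of cs) = chain_weight Js cs"
proof -
  have "\<forall>p\<in>{..<m}. \<exists>v. v permutes {lo p..hi p} \<and> cs ! Suc p = cs ! p \<circ> v \<and> inj_on (cs ! p) {lo p..hi p} \<and>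
    (\<forall>d\<in>cells lam. strand_of cs d p = v (strand_of cs d (Suc p)))"
    using chain_step[OF cs] by (metis lessThan_iff)
  from bchoice[OF this] obtain v where v: "\<And>p. p < m \<Longrightarrow> v p permutes {lo p..hi p}"
    "\<And>p. p < m \<Longrightarrow> cs ! Suc p = cs ! p \<circ> v p" "\<And>p. p < m \<Longrightarrow> inj_on (cs ! p) {lo p..hi p}"
    "\<And>p d. p < m \<Longrightarrow> d \<in> cells lam \<Longrightarrow> strand_of cs d p = v p (strand_of cs d (Suc p))"
    by (metis lessThan_iff)
  have pass: "passes Js p (strand_of cs d p) \<longleftrightarrow> passes Js p (strand_of cs d (Suc p))" if "p < m" "d \<in> cells lam" for p d
    using strand_strand_of[OF cs that(2)] that(1) unfolding strand_def by metis
  have col: "Col p i \<in> set (path_of cs d) \<longleftrightarrow> p \<le> m \<and> i = strand_of cs d p" for p i d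
    by (auto simp: Col_in_path_from)
  have centre: "Centre p \<in> set (path_of cs d) \<longleftrightarrow> p < m \<and> passes Js p (strand_of cs d p)" for p d
    by (auto simp: Centre_in_path_from)
  have enters: "enters_below p (path_of cs d) (path_of cs d') \<longleftrightarrow> strand_of cs d p < strand_of cs d' p"
    and leaves: "leaves_below p (path_of cs d) (path_of cs d') \<longleftrightarrow> strand_of cs d (Suc p) < strand_of cs d' (Suc p)"
    if "p < m" for p d d'
    using that unfolding enters_below_def leaves_below_def col by auto
  have crossing: "crossing (path_of cs d) (path_of cs d') p \<longleftrightarrow>
      p < m \<and> passes Js p (strand_of cs d (Suc p)) \<and> passes Js p (strand_of cs d' (Suc p)) \<and>
      v p (strand_of cs d (Suc p)) < v p (strand_of cs d' (Suc p)) \<and> strand_of cs d' (Suc p) < strand_of cs d (Suc p)"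
    and noncrossing: "noncrossing (path_of cs d) (path_of cs d') p \<longleftrightarrow>
      p < m \<and> passes Js p (strand_of cs d (Suc p)) \<and> passes Js p (strand_of cs d' (Suc p)) \<and>
      v p (strand_of cs d (Suc p)) < v p (strand_of cs d' (Suc p)) \<and> strand_of cs d (Suc p) < strand_of cs d' (Suc p)"
    if d: "d \<in> cells lam" "d' \<in> cells lam" for d d' p
  proof (atomize (full), cases "p < m")
    case True
    have ne: "path_of cs d \<noteq> path_of cs d'" if "strand_of cs d p < strand_of cs d' p"
    proof
      assume "path_of cs d = path_of cs d'"
      then have "Col p (strand_of cs d p) \<in> set (path_of cs d')"
        using True col[of p "strand_of cs d p" d] by simp
      then show False
        using that unfolding col by simp
    qed
    show "(crossing (path_of cs d) (path_of cs d') p \<longleftrightarrow>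
      p < m \<and> passes Js p (strand_of cs d (Suc p)) \<and> passes Js p (strand_of cs d' (Suc p)) \<and>
      v p (strand_of cs d (Suc p)) < v p (strand_of cs d' (Suc p)) \<and> strand_of cs d' (Suc p) < strand_of cs d (Suc p)) \<and>
      (noncrossing (path_of cs d) (path_of cs d') p \<longleftrightarrow>
      p < m \<and> passes Js p (strand_of cs d (Suc p)) \<and> passes Js p (strand_of cs d' (Suc p)) \<and>
      v p (strand_of cs d (Suc p)) < v p (strand_of cs d' (Suc p)) \<and> strand_of cs d (Suc p) < strand_of cs d' (Suc p))"
      unfolding crossing_def noncrossing_def centre pass[OF True d(1)] pass[OF True d(2)]
        enters[OF True] leaves[OF True] v(4)[OF True d(1), symmetric] v(4)[OF True d(2), symmetric]
      using ne True by blast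
  qed (simp add: crossing_def noncrossing_def centre)
  have "cr_tableau (tableau_of cs) = card {(P, P', p). P \<in> path_of cs ` cells lam \<and> P' \<in> path_of cs ` cells lam \<and> crossing P P' p}"
    unfolding cr_tableau_def cr_def set_tableau_of ..
  also have "\<dots> = (\<Sum>p<m. card {(x, y). x \<in> {lo p..hi p} \<and> y \<in> {lo p..hi p} \<and> v p x < v p y \<and> y < x})"
    using crossing by (intro card_path_triples[OF cs]) auto
  finally have cr: "cr_tableau (tableau_of cs) = \<dots>" .
  let ?B = "\<lambda>P P' p. noncrossing P P' p \<and>
    (\<exists>c d. in_column (tableau_of cs) P' c \<and> in_column (tableau_of cs) P d \<and> c < d)"
  have inv: "?B (path_of cs d) (path_of cs d') p \<longleftrightarrow>
      p < m \<and> passes Js p (strand_of cs d (Suc p)) \<and> passes Js p (strand_of cs d' (Suc p)) \<and>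
      (v p (strand_of cs d (Suc p)) < v p (strand_of cs d' (Suc p)) \<and> strand_of cs d (Suc p) < strand_of cs d' (Suc p) \<and>
      (cs ! p) (v p (strand_of cs d' (Suc p))) < (cs ! p) (v p (strand_of cs d (Suc p))))"
    if d: "d \<in> cells lam" "d' \<in> cells lam" for d d' p
  proof (cases "p < m")
    case True
    \<comment> \<open>At every level the letter of a strand is the column of its cell, so comparing
      columns amounts to comparing letters.\<close>
    have "(cs ! p) (v p (strand_of cs z (Suc p))) = snd z" if z: "z \<in> cells lam" for z
      unfolding v(4)[OF True z, symmetric]
      using cell_strand_of(1)[OF cs less_imp_le[OF True] z] by (metis snd_cell)
    then show ?thesis
      unfolding noncrossing[OF d] in_column_tableau_of[OF cs d(1)] in_column_tableau_of[OF cs d(2)]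
      using d by auto
  qed (simp add: noncrossing[OF d])
  have "invnc (tableau_of cs) = card {(P, P', p). P \<in> path_of cs ` cells lam \<and> P' \<in> path_of cs ` cells lam \<and> ?B P P' p}"
    unfolding invnc_def set_tableau_of ..
  also have "\<dots> = (\<Sum>p<m. card {(x, y). x \<in> {lo p..hi p} \<and> y \<in> {lo p..hi p} \<and>
      (v p x < v p y \<and> x < y \<and> (cs ! p) (v p y) < (cs ! p) (v p x))})"
    by (rule card_path_triples[OF cs inv]) auto
  finally have invnc: "invnc (tableau_of cs) = \<dots>" .
  have "chain_weight Js cs = (\<Sum>p<m. step_weight (Js ! p) (cs ! p) (cs ! Suc p))"
    using cs by (intro chain_weight_eq) (simp add: closed_chains_def)
  also have "\<dots> = (\<Sum>p<m. 2 * card {(x, y). x \<in> {lo p..hi p} \<and> y \<in> {lo p..hi p} \<and>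
      v p x < v p y \<and> x < y \<and> (cs ! p) (v p y) < (cs ! p) (v p x)} +
    card {(x, y). x \<in> {lo p..hi p} \<and> y \<in> {lo p..hi p} \<and> v p x < v p y \<and> y < x})"
  proof (rule sum.cong[OF refl])
    fix p assume "p \<in> {..<m}"
    then have p: "p < m"
      by simp
    show "step_weight (Js ! p) (cs ! p) (cs ! Suc p) = 2 * card {(x, y). x \<in> {lo p..hi p} \<and> y \<in> {lo p..hi p} \<and>
      v p x < v p y \<and> x < y \<and> (cs ! p) (v p y) < (cs ! p) (v p x)} +
      card {(x, y). x \<in> {lo p..hi p} \<and> y \<in> {lo p..hi p} \<and> v p x < v p y \<and> y < x}"
      using step_weight_crossings[OF v(1)[OF p] v(3)[OF p]] unfolding v(2)[OF p] prod.collapse .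
  qed
  also have "\<dots> = 2 * invnc (tableau_of cs) + cr_tableau (tableau_of cs)"
    unfolding cr invnc by (simp add: sum.distrib sum_distrib_left)
  finally show ?thesis
    by simp
qed

section \<open>Summation over closed chains and over tableaux\<close>

lemma sum_closed_chains:
  "(\<Sum>c\<in>W. \<Sum>cs\<in>star_chains Js c. qh (int (chain_weight Js cs)) * delta c (last cs)) =
    (\<Sum>cs\<in>closed_chains. qh (int (chain_weight Js cs)))"
proof -
  let ?A = "\<lambda>c. {cs \<in> star_chains Js c. last cs = c}"
  have last: "last cs = cs ! m" if "cs \<in> star_chains Js c" for cs c
    using that unfolding star_chains_iff by (metis diff_Suc_1 last_conv_nth length_0_conv nat.distinct(1))
  have "(\<Sum>cs\<in>star_chains Js c. qh (int (chain_weight Js cs)) * delta c (last cs)) = (\<Sum>cs\<in>?A c. qh (int (chain_weight Js cs)))" for c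
  proof -
    have "(\<Sum>cs\<in>star_chains Js c. qh (int (chain_weight Js cs)) * delta c (last cs)) =
        (\<Sum>cs\<in>star_chains Js c. if last cs = c then qh (int (chain_weight Js cs)) else 0)"
      by (intro sum.cong refl) (simp add: delta_def)
    then show ?thesis
      by (simp add: sum.inter_filter)
  qed
  then have "(\<Sum>c\<in>W. \<Sum>cs\<in>star_chains Js c. qh (int (chain_weight Js cs)) * delta c (last cs)) =
      (\<Sum>c\<in>W. \<Sum>cs\<in>?A c. qh (int (chain_weight Js cs)))"
    by simp
  also have "\<dots> = (\<Sum>cs\<in>(\<Union>c\<in>W. ?A c). qh (int (chain_weight Js cs)))"
    by (rule sum.UNION_disjoint[symmetric]) auto
  also have "(\<Union>c\<in>W. ?A c) = closed_chains"
  proof (intro equalityI subsetI)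
    fix cs assume "cs \<in> (\<Union>c\<in>W. ?A c)"
    then obtain c where "c \<in> W" "cs \<in> star_chains Js c" "last cs = c"
      by blast
    then show "cs \<in> closed_chains"
      using last unfolding closed_chains_def star_chains_iff by auto
  next
    fix cs assume cs: "cs \<in> closed_chains"
    have sc: "cs \<in> star_chains Js (cs ! 0)"
      using cs unfolding closed_chains_def star_chains_iff by blast
    from last[OF sc] show "cs \<in> (\<Union>c\<in>W. ?A c)"
      using cs sc unfolding closed_chains_def by auto
  qed
  finally show ?thesis .
qed

lemma sum_tableaux:
  "(\<Sum>cs\<in>closed_chains. qh (int (chain_weight Js cs))) =
    (\<Sum>U | G_tableau n Js id (conjugate lam) U \<and> column_strict U. qh (int (2 * invnc U + cr_tableau U)))"
  unfolding sum.reindex_bij_betw[OF bij_tableau_of, symmetric]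
  by (intro sum.cong refl) (simp only: weight_tableau_of)

lemma trace_parabolic_sums:
  "induced_sgn n lam (hcoset n (prod_list (map (parabolic_sum n) Js))) =
    (\<Sum>U | G_tableau n Js id (conjugate lam) U \<and> column_strict U. qh (int (2 * invnc U + cr_tableau U)))"
proof -
  note induced_sgn_eq = sorted_word.induced_sgn_eq[OF sorted_word_base_word]
  have Js: "\<forall>J\<in>set Js. 1 \<le> fst J \<and> snd J \<le> n"
    using valid unfolding valid_intervals_def by fastforce
  have "prod_list (map (parabolic_sum n) Js) \<in> free_carrier n"
    by (induction Js) auto
  then have "induced_sgn n lam (hcoset n (prod_list (map (parabolic_sum n) Js))) =
      (\<Sum>c\<in>W. act (prod_list (map (parabolic_sum n) Js)) (delta c) c)"
    by (rule induced_sgn_eq)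
  then show ?thesis
    unfolding act_prod_parabolic_sum[OF Js] sum_closed_chains sum_tableaux .
qed

end

lemma to_fract_sum: "to_fract (\<Sum>x\<in>A. f x) = (\<Sum>x\<in>A. to_fract (f x))"
  by (induction A rule: infinite_finite_induct) auto

theorem corollary6p6:
  fixes n :: nat and w :: "nat \<Rightarrow> nat" and g :: "int poly"
    and Js :: "(nat \<times> nat) list" and lam :: "nat list"
  assumes "w permutes {1..n}"
    and "\<forall>(a, b) \<in> set Js. 1 \<le> a \<and> a \<le> b \<and> b \<le> n"
    and "at_q g \<odot>\<^bsub>hecke n\<^esub> kl_basis n w = hecke_prod n (map (\<lambda>J. kl_basis n (reversal J)) Js)"
    and "is_partition n lam"
  shows "to_fract (induced_sgn n lam (kl_basis n w)) =
    1 / to_fract (at_q g) *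
      (\<Sum>U | G_tableau n Js id (conjugate lam) U \<and> column_strict U.
         to_fract (qh (int (2 * invnc U + cr_tableau U))))"
proof -
  interpret star_tableaux n Js lam
    using assms(2,4) by unfold_locales (simp_all add: valid_intervals_def)
  note induced_sgn_eq = sorted_word.induced_sgn_eq[OF sorted_word_base_word]
  have Js: "\<forall>J\<in>set Js. 1 \<le> fst J \<and> snd J \<le> n"
    using assms(2) by fastforce
  define h where "h = (\<Sum>v\<in>bruhat_below n w. scalar (at_q (kl_poly n v w)) * T_elem n v)"
  let ?P = "prod_list (map (parabolic_sum n) Js)"
  have h: "h \<in> free_carrier n" "kl_basis n w = hcoset n h"
    unfolding h_def kl_basis_hcoset by auto
  have factors: "map (\<lambda>J. kl_basis n (reversal J)) Js = map (hcoset n) (map (parabolic_sum n) Js)"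
    using Js kl_basis_reversal by auto
  have "hecke_prod n (map (\<lambda>J. kl_basis n (reversal J)) Js) = hcoset n ?P"
    unfolding factors by (intro hecke_prod_hcoset[THEN conjunct1]) auto
  then have prod: "hcoset n (scalar (at_q g) * h) = hcoset n ?P"
    using assms(3) hcoset_smult[OF h(1)] unfolding h(2) by simp
  \<comment> \<open>If g were 0, the product of the reversal elements would vanish.\<close>
  have g: "at_q g \<noteq> 0"
  proof
    assume "at_q g = 0"
    then have "hcoset n ?P = hcoset n 0"
      unfolding prod[symmetric] by simp
    then show False
      using prod_parabolic_sum_nonzero[OF Js] by blast
  qed
  \<comment> \<open>The trace is linear over the ground ring, so g is carried across and division is
    postponed to the fraction field.\<close>
  have "at_q g * induced_sgn n lam (kl_basis n w) = induced_sgn n lam (hcoset n (scalar (at_q g) * h))"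
    using h by (simp add: induced_sgn_eq act_mult' act_scalar sum_distrib_left)
  also have "\<dots> = (\<Sum>U | G_tableau n Js id (conjugate lam) U \<and> column_strict U. qh (int (2 * invnc U + cr_tableau U)))"
    unfolding prod by (rule trace_parabolic_sums)
  finally have "to_fract (at_q g) * to_fract (induced_sgn n lam (kl_basis n w)) =
      (\<Sum>U | G_tableau n Js id (conjugate lam) U \<and> column_strict U. to_fract (qh (int (2 * invnc U + cr_tableau U))))"
    unfolding to_fract_mult[symmetric] to_fract_sum[symmetric] by (rule arg_cong)
  moreover have "to_fract (at_q g) \<noteq> 0"
    using g by simp
  ultimately show ?thesis
    by (metis nonzero_mult_div_cancel_left times_divide_eq_left mult_1)
qed

end
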